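(* Consider a directed column-convex polyomino (dcc) chosen uniformly at random among all dcc of area $n$, and let $\overline R(s)$, $0\le s\le n$, be its asymptotic total perimeter process as a function of the accumulated area $s$, and $\overline R(n)$ its asymptotic total perimeter, as defined in the context. Put $$\mu_4=\alpha+\beta\mu_1=\mu_1(\mu_3+2)=\frac65+\frac{6\sqrt5}{25},\qquad \sigma_4^2=\gamma\mu_1+\sigma_1^2\beta^2=\frac{17\sqrt5}{50}-\frac{19}{125},$$ with $\mu_1,\mu_3,\sigma_1,\alpha,\beta,\gamma$ as in the context (numerically $\mu_4=1.736656315\ldots$ and $\sigma_4^2=0.6082631123\ldots$). Then, as $n\to\infty$, $$\frac{\overline R(\lfloor nt\rfloor)-\mu_4nt}{\sqrt n\,\sigma_4}\longrightarrow B_4(t),\qquad t\in[0,1],$$ in distribution as processes, where $B_4$ is a standard Brownian motion; and $$\frac{\overline R(n)-n\mu_4}{\sqrt n\,\sigma_4}\longrightarrow\mathcal N(0,1)\quad\text{in distribution.}$$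
   Context: Polyominoes are sets of cells of the square lattice, counted up to translation. A directed column-convex polyomino (dcc) is made of finitely many consecutive non-empty columns, each consisting of vertically contiguous cells (no holes), such that the base (lowest) cell of each column other than the first is adjacent to some cell of the previous column. Area is the number of cells, width the number of columns. For a dcc with columns $1,\dots,m$ of sizes $x_1,\dots,x_m$, let $w_d$ be the position of the upper cell of column $d$ minus that of column $d-1$ ($2\le d\le m$), $z_d\ge0$ the position of the lower cell of column $d+1$ minus that of column $d$ ($1\le d\le m-1$), with the convention $w_1=z_m=0$, and $T_d=|w_d|+z_d$. The asymptotic total perimeter is $R=\sum_{d=1}^mT_d+2m$ (the exact perimeter is $R+x_1+x_m$). For $0\le s\le n$, with $N(s)$ the largest $d\le m$ such that $x_1+\dots+x_d\le s$, set $\overline R(s)=\sum_{d=1}^{N(s)}T_d+2N(s)$; in particular $\overline R(n)$ is $R$ for the random dcc of area $n$. Constants: $$\mu_1=\frac{\sqrt5}{5},\quad \sigma_1^2=\frac{2\sqrt5}{25},\quad \mu_2=\sqrt5,\quad \sigma_2^2=2,\quad \mu_3=\frac{6\sqrt5-4}{5},\quad \sigma_Q^2=\frac{229}{50}+\frac{\sqrt5}{25},$$ $$\rho_{X,Q}=\frac{1}{\sigma_2\sigma_Q}\left(\frac{13}{5}+\frac{\sqrt5}{25}\right),\quad \alpha=\frac{\sigma_Q\rho_{X,Q}}{\sigma_2},\quad \beta=\mu_3+2-\rho_{X,Q}\,\mu_2\,\frac{\sigma_Q}{\sigma_2},\quad \gamma=\sigma_Q^2(1-\rho_{X,Q}^2).$$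 Convergence of processes is weak convergence in the Skorokhod space $D[0,1]$. *)

theory Defs
  imports "HOL-Probability.Probability"
begin

section \<open>Directed column-convex polyominoes\<close>

type_synonym cell = "int \<times> int"

definition adjacent :: "cell \<Rightarrow> cell \<Rightarrow> bool" where
  "adjacent c c' \<longleftrightarrow> \<bar>fst c - fst c'\<bar> + \<bar>snd c - snd c'\<bar> = 1"

definition column_at :: "cell set \<Rightarrow> int \<Rightarrow> int set" where
  "column_at P i = {j. (i, j) \<in> P}"

definition dcc :: "cell set \<Rightarrow> bool" where
  "dcc P \<longleftrightarrow>
     (\<exists>a b. a \<le> b \<and> fst ` P = {a..b}) \<and>
     (\<forall>i\<in>fst ` P. \<exists>l h. l \<le> h \<and> column_at P i = {l..h}) \<and>
     (\<forall>i\<in>fst ` P. i - 1 \<in> fst ` P \<longrightarrow>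
        (\<exists>j\<in>column_at P (i - 1). adjacent (i, Min (column_at P i)) (i - 1, j)))"

text \<open>Columns are numbered \<open>1, \<dots>, width P\<close> from the leftmost one, so that widths, sizes, steps
  and the perimeter do not depend on the position of \<open>P\<close> in the plane (see \<open>Rbar_translate\<close> below).\<close>

definition width :: "cell set \<Rightarrow> nat" where
  "width P = card (fst ` P)"

definition column :: "cell set \<Rightarrow> nat \<Rightarrow> int set" where
  "column P d = column_at P (Min (fst ` P) + int d - 1)"

definition column_size :: "cell set \<Rightarrow> nat \<Rightarrow> nat" where
  "column_size P d = card (column P d)"

definition lower :: "cell set \<Rightarrow> nat \<Rightarrow> int" where
  "lower P d = Min (column P d)"

definition upper :: "cell set \<Rightarrow> nat \<Rightarrow> int" where
  "upper P d = Max (column P d)"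

definition w_step :: "cell set \<Rightarrow> nat \<Rightarrow> int" where
  "w_step P d = (if 2 \<le> d \<and> d \<le> width P then upper P d - upper P (d - 1) else 0)"

definition z_step :: "cell set \<Rightarrow> nat \<Rightarrow> int" where
  "z_step P d = (if 1 \<le> d \<and> d < width P then lower P (d + 1) - lower P d else 0)"

definition T_step :: "cell set \<Rightarrow> nat \<Rightarrow> int" where
  "T_step P d = \<bar>w_step P d\<bar> + z_step P d"

definition columns_within :: "cell set \<Rightarrow> nat \<Rightarrow> nat" where
  "columns_within P s = Max {d. d \<le> width P \<and> (\<Sum>i=1..d. column_size P i) \<le> s}"

definition Rbar :: "cell set \<Rightarrow> nat \<Rightarrow> int" where
  "Rbar P s = (\<Sum>d=1..columns_within P s. T_step P d) + 2 * int (columns_within P s)"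

definition asymptotic_perimeter :: "cell set \<Rightarrow> int" where
  "asymptotic_perimeter P = (\<Sum>d=1..width P. T_step P d) + 2 * int (width P)"

text \<open>Counting up to translation: every translation class of dcc is represented by its unique
  member whose first column has its base cell at the origin (see \<open>ex1_anchored_translate\<close> below).\<close>

definition anchored :: "cell set \<Rightarrow> bool" where
  "anchored P \<longleftrightarrow> Min (fst ` P) = 0 \<and> lower P 1 = 0"

definition dccs :: "nat \<Rightarrow> cell set set" where
  "dccs n = {P. dcc P \<and> anchored P \<and> card P = n}"

definition random_dcc :: "nat \<Rightarrow> cell set pmf" where
  "random_dcc n = pmf_of_set (dccs n)"

lemma dcc_finite:
  assumes "dcc P" shows "finite P" "P \<noteq> {}"
proof -
  obtain a b where ab: "a \<le> b" "fst ` P = {a..b}" using assms by (auto simp: dcc_def)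
  then show "P \<noteq> {}" by auto
  have "finite (column_at P i)" if "i \<in> fst ` P" for i
    using assms that unfolding dcc_def by (metis finite_atLeastAtMost_int)
  moreover have "P = Sigma (fst ` P) (column_at P)"
    by (force simp: column_at_def)
  ultimately show "finite P"
    using ab by (metis finite_SigmaI finite_atLeastAtMost_int)
qed

lemma fst_translate: "fst ` ((+) v ` P) = (+) (fst v) ` fst ` P" for v :: cell
  by (force simp: image_iff)

lemma column_at_translate:
  "column_at ((+) v ` P) i = (+) (snd v) ` column_at P (i - fst v)" for v :: cell
proof -
  have "((i, j) \<in> (+) v ` P) = (j \<in> (+) (snd v) ` column_at P (i - fst v))" for j
  proof
    assume "(i, j) \<in> (+) v ` P"
    then obtain c where "c \<in> P" "(i, j) = v + c" by auto
    then show "j \<in> (+) (snd v) ` column_at P (i - fst v)"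
      by (intro image_eqI[of _ _ "snd c"]) (auto simp: column_at_def prod_eq_iff plus_prod_def)
  next
    assume "j \<in> (+) (snd v) ` column_at P (i - fst v)"
    then obtain k where "(i - fst v, k) \<in> P" "j = snd v + k" by (auto simp: column_at_def)
    then show "(i, j) \<in> (+) v ` P"
      by (intro image_eqI[of _ _ "(i - fst v, k)"]) (auto simp: prod_eq_iff)
  qed
  then show ?thesis by (auto simp: column_at_def)
qed

lemma Min_translate:
  fixes A :: "int set" assumes "finite A" "A \<noteq> {}"
  shows "Min ((+) c ` A) = c + Min A" "Max ((+) c ` A) = c + Max A"
  using assms Min_add_commute[of A "\<lambda>x. x" c] Max_add_commute[of A "\<lambda>x. x" c]
  by (simp_all add: add.commute)

lemma dcc_column_finite:
  assumes "dcc P" "i \<in> fst ` P"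
  shows "finite (column_at P i)" "column_at P i \<noteq> {}"
  using assms unfolding dcc_def by (metis finite_atLeastAtMost_int, metis atLeastatMost_empty_iff)

lemma shift_mem: "i \<in> (+) c ` A \<Longrightarrow> i - c \<in> A" for i c :: int
  by auto

lemma dcc_translate:
  fixes v :: cell
  assumes "dcc P" shows "dcc ((+) v ` P)"
  unfolding dcc_def fst_translate column_at_translate
proof (intro conjI ballI impI)
  obtain a b where ab: "a \<le> b" "fst ` P = {a..b}" using assms by (auto simp: dcc_def)
  then show "\<exists>a b. a \<le> b \<and> (+) (fst v) ` fst ` P = {a..b}"
    by (intro exI[of _ "fst v + a"] exI[of _ "fst v + b"]) (simp add: image_add_atLeastAtMost)
next
  fix i assume "i \<in> (+) (fst v) ` fst ` P"
  then have "i - fst v \<in> fst ` P" by (rule shift_mem)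
  then obtain l h where "l \<le> h" "column_at P (i - fst v) = {l..h}"
    using assms unfolding dcc_def by blast
  then show "\<exists>l h. l \<le> h \<and> (+) (snd v) ` column_at P (i - fst v) = {l..h}"
    by (intro exI[of _ "snd v + l"] exI[of _ "snd v + h"]) (simp add: image_add_atLeastAtMost)
next
  fix i assume "i \<in> (+) (fst v) ` fst ` P" "i - 1 \<in> (+) (fst v) ` fst ` P"
  then have i: "i - fst v \<in> fst ` P" "i - fst v - 1 \<in> fst ` P"
    using shift_mem[of i "fst v" "fst ` P"] shift_mem[of "i - 1" "fst v" "fst ` P"]
    by (simp_all add: algebra_simps)
  then obtain j where "j \<in> column_at P (i - fst v - 1)"
      "adjacent (i - fst v, Min (column_at P (i - fst v))) (i - fst v - 1, j)"
    using assms unfolding dcc_def by blast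
  then show "\<exists>j\<in>(+) (snd v) ` column_at P (i - 1 - fst v).
      adjacent (i, Min ((+) (snd v) ` column_at P (i - fst v))) (i - 1, j)"
    using Min_translate(1)[OF dcc_column_finite[OF assms i(1)], of "snd v"]
    by (intro bexI[of _ "snd v + j"]) (auto simp: adjacent_def algebra_simps)
qed

lemma dcc_Min_translate:
  fixes v :: cell
  assumes "dcc P" shows "Min (fst ` ((+) v ` P)) = fst v + Min (fst ` P)"
  using dcc_finite[OF assms] unfolding fst_translate by (intro Min_translate) auto

lemma column_translate:
  fixes v :: cell
  assumes "dcc P" shows "column ((+) v ` P) d = (+) (snd v) ` column P d"
  unfolding column_def dcc_Min_translate[OF assms] column_at_translate
  by (simp add: algebra_simps)

lemma column_finite:
  assumes "dcc P" "1 \<le> d" "d \<le> width P"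
  shows "finite (column P d)" "column P d \<noteq> {}"
proof -
  obtain a b where ab: "a \<le> b" "fst ` P = {a..b}" using assms by (auto simp: dcc_def)
  have "Min (fst ` P) = a" using ab by (auto intro: Min_eqI)
  then have "Min (fst ` P) + int d - 1 \<in> fst ` P" using assms ab by (auto simp: width_def)
  then show "finite (column P d)" "column P d \<noteq> {}"
    using dcc_column_finite[OF assms(1)] by (auto simp: column_def)
qed

lemma width_translate: "width ((+) v ` P) = width P" for v :: cell
  unfolding width_def fst_translate by (rule card_image) auto

lemma width_pos: "dcc P \<Longrightarrow> 1 \<le> width P"
  using dcc_finite[of P] by (simp add: width_def Suc_le_eq card_gt_0_iff)

theorem ex1_anchored_translate:
  assumes "dcc P"
  shows "\<exists>!v. anchored ((+) v ` P)"
proof -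
  have "anchored ((+) v ` P) \<longleftrightarrow> v = (- Min (fst ` P), - lower P 1)" for v :: cell
    unfolding anchored_def lower_def dcc_Min_translate[OF assms] column_translate[OF assms]
    using Min_translate(1)[OF column_finite[OF assms, of 1]] width_pos[OF assms]
    by (auto simp: prod_eq_iff)
  then show ?thesis by simp
qed

theorem Rbar_translate:
  fixes v :: cell
  assumes "dcc P" shows "Rbar ((+) v ` P) s = Rbar P s"
proof -
  have cs: "column_size ((+) v ` P) d = column_size P d" for d
    unfolding column_size_def column_translate[OF assms] by (rule card_image) auto
  have lo: "lower ((+) v ` P) d = snd v + lower P d"
    and up: "upper ((+) v ` P) d = snd v + upper P d" if "1 \<le> d" "d \<le> width P" for d
    using Min_translate[OF column_finite[OF assms that]]
    by (auto simp: lower_def upper_def column_translate[OF assms])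
  have "w_step ((+) v ` P) d = w_step P d" "z_step ((+) v ` P) d = z_step P d" for d
    by (auto simp: w_step_def z_step_def width_translate lo up)
  then show ?thesis
    by (simp add: Rbar_def columns_within_def T_step_def cs width_translate)
qed

theorem Rbar_card:
  assumes "dcc P" shows "Rbar P (card P) = asymptotic_perimeter P"
proof -
  obtain a b where ab: "a \<le> b" "fst ` P = {a..b}" using assms by (auto simp: dcc_def)
  have m: "Min (fst ` P) = a" using ab by (auto intro: Min_eqI)
  have w: "int (width P) = b - a + 1" using ab by (simp add: width_def)
  have "P = Sigma {a..b} (column_at P)"
    using ab by (force simp: column_at_def)
  then have "card P = (\<Sum>i\<in>{a..b}. card (column_at P i))"
    using dcc_column_finite(1)[OF assms] ab card_SigmaI[of "{a..b}" "column_at P"] by auto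
  also have "\<dots> = (\<Sum>d=1..width P. column_size P d)"
    by (rule sum.reindex_bij_witness[of _ "\<lambda>d. a + int d - 1" "\<lambda>i. nat (i - a + 1)"])
       (use m w in \<open>auto simp: column_size_def column_def\<close>)
  finally have "columns_within P (card P) = width P"
    unfolding columns_within_def by (intro Max_eqI) auto
  then show ?thesis by (simp add: Rbar_def asymptotic_perimeter_def)
qed


section \<open>Constants\<close>

definition mu1 :: real where "mu1 = sqrt 5 / 5"
definition sigma1_sq :: real where "sigma1_sq = 2 * sqrt 5 / 25"
definition mu2 :: real where "mu2 = sqrt 5"
definition sigma2 :: real where "sigma2 = sqrt 2"
definition mu3 :: real where "mu3 = (6 * sqrt 5 - 4) / 5"
definition sigmaQ :: real where "sigmaQ = sqrt (229 / 50 + sqrt 5 / 25)"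
definition rhoXQ :: real where "rhoXQ = 1 / (sigma2 * sigmaQ) * (13 / 5 + sqrt 5 / 25)"
definition alpha :: real where "alpha = sigmaQ * rhoXQ / sigma2"
definition beta :: real where "beta = mu3 + 2 - rhoXQ * mu2 * (sigmaQ / sigma2)"
definition gamma :: real where "gamma = sigmaQ\<^sup>2 * (1 - rhoXQ\<^sup>2)"
definition mu4 :: real where "mu4 = alpha + beta * mu1"
definition sigma4 :: real where "sigma4 = sqrt (gamma * mu1 + sigma1_sq * beta\<^sup>2)"


section \<open>The Skorokhod space $D[0,1]$\<close>

text \<open>Functions on $[0,1]$ are represented by functions on the reals that are
  \<^const>\<open>undefined\<close> outside of $[0,1]$.\<close>

definition D01 :: "(real \<Rightarrow> real) set" where
  "D01 = {x \<in> extensional {0..1}.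
     (\<forall>t\<in>{0..<1}. continuous (at_right t) x) \<and>
     (\<forall>t\<in>{0<..1}. \<exists>l. (x \<longlongrightarrow> l) (at_left t))}"

definition time_changes :: "(real \<Rightarrow> real) set" where
  "time_changes = {l. continuous_on {0..1} l \<and> strict_mono_on {0..1} l \<and> l ` {0..1} = {0..1}}"

definition skorokhod_close :: "real \<Rightarrow> (real \<Rightarrow> real) \<Rightarrow> (real \<Rightarrow> real) \<Rightarrow> bool" where
  "skorokhod_close e x y \<longleftrightarrow>
     (\<exists>l\<in>time_changes. \<forall>t\<in>{0..1}. \<bar>l t - t\<bar> \<le> e \<and> \<bar>x t - y (l t)\<bar> \<le> e)"

text \<open>The value outside of \<^term>\<open>D01\<close> is irrelevant; it is set to \<open>0\<close> because the locale
  \<^locale>\<open>Metric_space\<close> asks for symmetry and nonnegativity on the whole type.\<close>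

definition skorokhod_dist :: "(real \<Rightarrow> real) \<Rightarrow> (real \<Rightarrow> real) \<Rightarrow> real" where
  "skorokhod_dist x y =
     (if x \<in> D01 \<and> y \<in> D01 then Inf {e. 0 < e \<and> skorokhod_close e x y} else 0)"

lemma time_changesD:
  assumes "l \<in> time_changes"
  shows "\<And>t. t \<in> {0..1} \<Longrightarrow> l t \<in> {0..1}" "inj_on l {0..1}" "l ` {0..1} = {0..1}"
    "\<And>s t. s \<in> {0..1} \<Longrightarrow> t \<in> {0..1} \<Longrightarrow> s < t \<Longrightarrow> l s < l t"
    "continuous_on {0..1} l"
  using assms unfolding time_changes_def
  by (auto simp: strict_mono_on_imp_inj_on strict_mono_on_def)

lemma id_time_change: "(\<lambda>t. t) \<in> time_changes"
  by (auto simp: time_changes_def strict_mono_on_def)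

lemma time_change_compose:
  assumes "k \<in> time_changes" "l \<in> time_changes"
  shows "(\<lambda>t. l (k t)) \<in> time_changes"
proof -
  note K = time_changesD[OF assms(1)] and L = time_changesD[OF assms(2)]
  have "continuous_on {0..1} (\<lambda>t. l (k t))"
    using continuous_on_compose2[OF L(5) K(5)] K(3) by auto
  moreover have "strict_mono_on {0..1} (\<lambda>t. l (k t))"
    using K(1,4) L(4) by (intro strict_mono_onI) blast
  moreover have "(\<lambda>t. l (k t)) ` {0..1} = {0..1}"
    using K(3) L(3) by (metis image_image)
  ultimately show ?thesis by (simp add: time_changes_def)
qed

lemma time_change_inverse:
  assumes "l \<in> time_changes"
  shows "inv_into {0..1} l \<in> time_changes"
proof -
  note L = time_changesD[OF assms]
  let ?k = "inv_into {0..1} l"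
  have im: "?k ` {0..1} = {0..1}" using inv_into_image_cancel[OF L(2), of "{0..1}"] L(3) by simp
  have "continuous_on (l ` {0..1}) ?k"
    using L by (intro continuous_on_inv) auto
  moreover have "strict_mono_on {0..1} ?k"
  proof (rule strict_mono_onI)
    fix r s :: real assume rs: "r \<in> {0..1}" "s \<in> {0..1}" "r < s"
    have k: "?k r \<in> {0..1}" "?k s \<in> {0..1}" "l (?k r) = r" "l (?k s) = s"
      using rs L(3) by (metis inv_into_into, metis inv_into_into,
          metis f_inv_into_f, metis f_inv_into_f)
    show "?k r < ?k s"
      using L(4)[of "?k s" "?k r"] k rs by (metis less_asym linorder_neqE_linordered_idom)
  qed
  ultimately show ?thesis using im L(3) by (simp add: time_changes_def)
qed

lemma skorokhod_close_sym:
  assumes "skorokhod_close e x y" shows "skorokhod_close e y x"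
proof -
  obtain l where l: "l \<in> time_changes"
    "\<And>t. t \<in> {0..1} \<Longrightarrow> \<bar>l t - t\<bar> \<le> e \<and> \<bar>x t - y (l t)\<bar> \<le> e"
    using assms unfolding skorokhod_close_def by blast
  have "\<bar>inv_into {0..1} l t - t\<bar> \<le> e \<and> \<bar>y t - x (inv_into {0..1} l t)\<bar> \<le> e"
    if "t \<in> {0..1}" for t
  proof -
    have "inv_into {0..1} l t \<in> {0..1}" "l (inv_into {0..1} l t) = t"
      using that time_changesD(3)[OF l(1)] by (metis inv_into_into, metis f_inv_into_f)
    then show ?thesis using l(2)[of "inv_into {0..1} l t"] by (simp add: abs_minus_commute)
  qed
  then show ?thesis using time_change_inverse[OF l(1)] unfolding skorokhod_close_def by blast
qed

lemma skorokhod_close_trans: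
  assumes "skorokhod_close d x y" "skorokhod_close e y z"
  shows "skorokhod_close (d + e) x z"
proof -
  obtain k where k: "k \<in> time_changes"
    "\<And>t. t \<in> {0..1} \<Longrightarrow> \<bar>k t - t\<bar> \<le> d \<and> \<bar>x t - y (k t)\<bar> \<le> d"
    using assms(1) unfolding skorokhod_close_def by blast
  obtain l where l: "l \<in> time_changes"
    "\<And>t. t \<in> {0..1} \<Longrightarrow> \<bar>l t - t\<bar> \<le> e \<and> \<bar>y t - z (l t)\<bar> \<le> e"
    using assms(2) unfolding skorokhod_close_def by blast
  have "\<bar>l (k t) - t\<bar> \<le> d + e \<and> \<bar>x t - z (l (k t))\<bar> \<le> d + e" if "t \<in> {0..1}" for t
    using k(2)[OF that] l(2)[OF time_changesD(1)[OF k(1) that]] by linarith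
  then show ?thesis
    unfolding skorokhod_close_def by (intro bexI[OF _ time_change_compose[OF k(1) l(1)]] ballI)
qed

lemma D01_bounded:
  assumes "x \<in> D01" shows "\<exists>B. \<forall>t\<in>{0..1}. \<bar>x t\<bar> \<le> B"
proof -
  define Q where "Q a b \<longleftrightarrow> (\<exists>B. \<forall>t\<in>{a..b} \<inter> {0..1}. \<bar>x t\<bar> \<le> B)" for a b
  have "Q 0 1"
  proof (rule Bolzano)
    show "(0::real) \<le> 1" by simp
  next
    fix a b c assume "Q a b" "Q b c" "a \<le> b" "b \<le> c"
    then obtain A B where "\<forall>t\<in>{a..b} \<inter> {0..1}. \<bar>x t\<bar> \<le> A" "\<forall>t\<in>{b..c} \<inter> {0..1}. \<bar>x t\<bar> \<le> B"
      unfolding Q_def by blast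
    then show "Q a c" unfolding Q_def by (intro exI[of _ "max A B"]) (auto simp: le_max_iff_disj)
  next
    fix t :: real assume t: "0 \<le> t" "t \<le> 1"
    have "\<exists>r>t. \<exists>B. \<forall>s\<in>{t<..<r} \<inter> {0..1}. \<bar>x s\<bar> \<le> B"
    proof (cases "t < 1")
      case True
      then have "(x \<longlongrightarrow> x t) (at_right t)"
        using assms t by (auto simp: D01_def continuous_within)
      then have "\<forall>\<^sub>F s in at_right t. dist (x s) (x t) < 1" by (rule tendstoD) simp
      then obtain r where "r > t" "\<forall>s>t. s < r \<longrightarrow> dist (x s) (x t) < 1"
        unfolding eventually_at_right_field by blast
      then show ?thesis
        by (intro exI[of _ r] conjI exI[of _ "\<bar>x t\<bar> + 1"]) (fastforce simp: dist_real_def)+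
    next
      case False
      then show ?thesis using t by (intro exI[of _ 2]) auto
    qed
    then obtain r B where r: "r > t" "\<And>s. s \<in> {t<..<r} \<inter> {0..1} \<Longrightarrow> \<bar>x s\<bar> \<le> B" by blast
    have "\<exists>q<t. \<exists>B. \<forall>s\<in>{q<..<t} \<inter> {0..1}. \<bar>x s\<bar> \<le> B"
    proof (cases "0 < t")
      case True
      then obtain y where "(x \<longlongrightarrow> y) (at_left t)"
        using assms t unfolding D01_def by fastforce
      then have "\<forall>\<^sub>F s in at_left t. dist (x s) y < 1" by (rule tendstoD) simp
      then obtain q where "q < t" "\<forall>s>q. s < t \<longrightarrow> dist (x s) y < 1"
        unfolding eventually_at_left_field by blast
      then show ?thesis
        by (intro exI[of _ q] conjI exI[of _ "\<bar>y\<bar> + 1"]) (fastforce simp: dist_real_def)+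
    next
      case False
      then show ?thesis using t by (intro exI[of _ "-1"]) auto
    qed
    then obtain q C where q: "q < t" "\<And>s. s \<in> {q<..<t} \<inter> {0..1} \<Longrightarrow> \<bar>x s\<bar> \<le> C" by blast
    show "\<exists>d>0. \<forall>a b. a \<le> t \<and> t \<le> b \<and> b - a < d \<longrightarrow> Q a b"
    proof (intro exI[of _ "min (r - t) (t - q)"] conjI allI impI)
      fix a b assume ab: "a \<le> t \<and> t \<le> b \<and> b - a < min (r - t) (t - q)"
      have "\<bar>x s\<bar> \<le> max \<bar>x t\<bar> (max B C)" if s: "s \<in> {a..b} \<inter> {0..1}" for s
        using r(2)[of s] q(2)[of s] s ab by (cases s t rule: linorder_cases) auto
      then show "Q a b" unfolding Q_def by blast
    qed (use r q in auto)
  qed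
  then show ?thesis unfolding Q_def by simp
qed

lemma skorokhod_close_ex:
  assumes "x \<in> D01" "y \<in> D01" shows "\<exists>e>0. skorokhod_close e x y"
proof -
  obtain A B where AB: "\<And>t. t \<in> {0..1} \<Longrightarrow> \<bar>x t\<bar> \<le> A" "\<And>t. t \<in> {0..1} \<Longrightarrow> \<bar>y t\<bar> \<le> B"
    using D01_bounded[OF assms(1)] D01_bounded[OF assms(2)] by blast
  have "0 \<le> A" "0 \<le> B" using AB[of 0] by auto
  moreover have "\<bar>x t - y t\<bar> \<le> A + B + 1" if "t \<in> {0..1}" for t
    using AB[OF that] by linarith
  ultimately have "skorokhod_close (A + B + 1) x y"
    unfolding skorokhod_close_def by (intro bexI[OF _ id_time_change]) auto
  then show ?thesis using \<open>0 \<le> A\<close> \<open>0 \<le> B\<close> by (intro exI[of _ "A + B + 1"]) simp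
qed

lemma skorokhod_dist_less_iff:
  assumes "x \<in> D01" "y \<in> D01"
  shows "skorokhod_dist x y < e \<longleftrightarrow> (\<exists>d>0. d < e \<and> skorokhod_close d x y)"
proof -
  have "{e. 0 < e \<and> skorokhod_close e x y} \<noteq> {}" using skorokhod_close_ex[OF assms] by blast
  moreover have "bdd_below {e. 0 < e \<and> skorokhod_close e x y}" by (rule bdd_belowI[of _ 0]) auto
  ultimately show ?thesis
    using assms by (auto simp: skorokhod_dist_def cInf_less_iff)
qed

lemma skorokhod_dist_nonneg: "0 \<le> skorokhod_dist x y"
proof (cases "x \<in> D01 \<and> y \<in> D01")
  case True
  then show ?thesis using skorokhod_dist_less_iff[of x y 0] by (meson not_less less_asym)
qed (auto simp: skorokhod_dist_def)

text \<open>If the distance is \<open>0\<close>, then \<open>x s\<close> is \<open>y s\<close> or the left limit of \<open>y\<close> at \<open>s\<close>; letting \<open>s\<close>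
  decrease to \<open>t\<close>, both approach \<open>y t\<close>.\<close>

lemma skorokhod_dist_zero_imp:
  assumes x: "x \<in> D01" and y: "y \<in> D01" and 0: "skorokhod_dist x y = 0"
  shows "x = y"
proof (rule extensionalityI[of _ "{0..1}"])
  show "x \<in> extensional {0..1}" "y \<in> extensional {0..1}" using x y by (auto simp: D01_def)
  have close: "\<exists>l\<in>time_changes. \<forall>t\<in>{0..1}. \<bar>l t - t\<bar> < e \<and> \<bar>x t - y (l t)\<bar> < e" if e: "e > 0" for e
  proof -
    obtain d where d: "0 < d" "d < e" "skorokhod_close d x y"
      using skorokhod_dist_less_iff[OF x y, of e] 0 e by auto
    then obtain l where l: "l \<in> time_changes"
        "\<forall>t\<in>{0..1}. \<bar>l t - t\<bar> \<le> d \<and> \<bar>x t - y (l t)\<bar> \<le> d"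
      unfolding skorokhod_close_def by blast
    show ?thesis using l d(2) by (intro bexI[OF _ l(1)]) fastforce
  qed
  fix t :: real assume t: "t \<in> {0..1}"
  show "x t = y t"
  proof (cases "t < 1")
    case True
    have lx: "(x \<longlongrightarrow> x t) (at_right t)" and ly: "(y \<longlongrightarrow> y t) (at_right t)"
      using x y t True by (auto simp: D01_def continuous_within)
    have "\<bar>x t - y t\<bar> \<le> e" if e: "e > 0" for e
    proof -
      have e3: "e / 3 > 0" using e by simp
      have "\<forall>\<^sub>F s in at_right t. dist (x s) (x t) < e / 3 \<and> dist (y s) (y t) < e / 3"
        by (rule eventually_conj[OF tendstoD[OF lx e3] tendstoD[OF ly e3]])
      then obtain r where r: "r > t"
          "\<And>s. t < s \<Longrightarrow> s < r \<Longrightarrow> dist (x s) (x t) < e / 3 \<and> dist (y s) (y t) < e / 3"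
        unfolding eventually_at_right_field by blast
      define r' where "r' = min r 1"
      define s where "s = (t + r') / 2"
      have r': "t < r'" "r' \<le> r" "r' \<le> 1" using r True by (auto simp: r'_def)
      have s: "t < s" "s < r'" "s \<in> {0..1}" using r' t by (auto simp: s_def field_simps)
      obtain l where l: "l \<in> time_changes"
          "\<forall>u\<in>{0..1}. \<bar>l u - u\<bar> < min (e / 3) (min (s - t) (r' - s))
             \<and> \<bar>x u - y (l u)\<bar> < min (e / 3) (min (s - t) (r' - s))"
        using close[of "min (e / 3) (min (s - t) (r' - s))"] e s by auto
      have ls: "\<bar>l s - s\<bar> < min (s - t) (r' - s)" "\<bar>x s - y (l s)\<bar> < e / 3"
        using l(2) s(3) by auto
      have "t < l s" "l s < r" using ls(1) r' by linarith+
      then have "dist (y (l s)) (y t) < e / 3" using r(2) by blast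
      moreover have "dist (x s) (x t) < e / 3" using r(2) s r' by auto
      ultimately show ?thesis using ls(2) unfolding dist_real_def by linarith
    qed
    then have "\<bar>x t - y t\<bar> \<le> 0" by (rule field_le_epsilon[of _ 0, simplified]) 
    then show ?thesis by simp
  next
    case False
    then have t1: "t = 1" using t by simp
    have l1: "l 1 = 1" if "l \<in> time_changes" for l
    proof -
      note L = time_changesD[OF that]
      obtain u where u: "u \<in> {0..1}" "l u = 1" using L(3) by (metis atLeastAtMost_iff imageE order_refl zero_le_one)
      show ?thesis using L(4)[of u 1] L(1)[of 1] u by (cases "u = 1") auto
    qed
    have "\<bar>x t - y t\<bar> \<le> e" if e: "e > 0" for e
    proof -
      obtain l where l: "l \<in> time_changes" "\<forall>u\<in>{0..1}. \<bar>l u - u\<bar> < e \<and> \<bar>x u - y (l u)\<bar> < e"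
        using close[OF e] by blast
      then have "\<bar>x 1 - y (l 1)\<bar> < e" by simp
      then show ?thesis using l1[OF l(1)] t1 by simp
    qed
    then have "\<bar>x t - y t\<bar> \<le> 0" by (rule field_le_epsilon[of _ 0, simplified])
    then show ?thesis by simp
  qed
qed

interpretation skorokhod: Metric_space D01 skorokhod_dist
proof
  show "0 \<le> skorokhod_dist x y" for x y by (rule skorokhod_dist_nonneg)
  show "skorokhod_dist x y = skorokhod_dist y x" for x y
    using skorokhod_close_sym by (auto simp: skorokhod_dist_def intro!: arg_cong[where f = Inf])
next
  fix x y assume xy: "x \<in> D01" "y \<in> D01"
  show "skorokhod_dist x y = 0 \<longleftrightarrow> x = y"
  proof
    assume "x = y"
    have "skorokhod_dist x y \<le> 0"
    proof (rule ccontr)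
      assume n: "\<not> skorokhod_dist x y \<le> 0"
      have "skorokhod_close (skorokhod_dist x y / 2) x y"
        unfolding skorokhod_close_def using n \<open>x = y\<close>
        by (intro bexI[OF _ id_time_change]) auto
      then have "skorokhod_dist x y < skorokhod_dist x y"
        using n by (subst skorokhod_dist_less_iff[OF xy])
          (auto intro!: exI[of _ "skorokhod_dist x y / 2"])
      then show False by simp
    qed
    then show "skorokhod_dist x y = 0" using skorokhod_dist_nonneg[of x y] by simp
  qed (use skorokhod_dist_zero_imp xy in blast)
next
  fix x y z assume xyz: "x \<in> D01" "y \<in> D01" "z \<in> D01"
  show "skorokhod_dist x z \<le> skorokhod_dist x y + skorokhod_dist y z"
  proof (rule field_le_epsilon)
    fix e :: real assume "e > 0"
    then obtain c d where "c > 0" "c < skorokhod_dist x y + e / 2" "skorokhod_close c x y"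
        "d > 0" "d < skorokhod_dist y z + e / 2" "skorokhod_close d y z"
      using skorokhod_dist_less_iff[OF xyz(1,2), of "skorokhod_dist x y + e / 2"]
        skorokhod_dist_less_iff[OF xyz(2,3), of "skorokhod_dist y z + e / 2"] by auto
    then have "skorokhod_dist x z < skorokhod_dist x y + skorokhod_dist y z + e"
      using skorokhod_close_trans[of c x y d z]
      by (subst skorokhod_dist_less_iff[OF xyz(1,3)]) (auto intro!: exI[of _ "c + d"])
    then show "skorokhod_dist x z \<le> skorokhod_dist x y + skorokhod_dist y z + e" by simp
  qed
qed

abbreviation skorokhod_topology :: "(real \<Rightarrow> real) topology" where
  "skorokhod_topology \<equiv> skorokhod.mtopology"


section \<open>Convergence in distribution and Brownian motion\<close>

definition borel_on :: "'c topology \<Rightarrow> 'c measure" where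
  "borel_on T = sigma (topspace T) {U. openin T U}"

text \<open>Weak convergence of the laws of random elements \<open>X n\<close> (on \<open>N n\<close>) of the topological space
  \<open>T\<close> to the law of \<open>Y\<close> (on \<open>M\<close>).\<close>

definition converges_in_distribution ::
  "'c topology \<Rightarrow> (nat \<Rightarrow> 'a measure) \<Rightarrow> (nat \<Rightarrow> 'a \<Rightarrow> 'c) \<Rightarrow> 'b measure \<Rightarrow> ('b \<Rightarrow> 'c) \<Rightarrow> bool" where
  "converges_in_distribution T N X M Y \<longleftrightarrow>
     (\<forall>n. X n \<in> measurable (N n) (borel_on T)) \<and> Y \<in> measurable M (borel_on T) \<and>
     (\<forall>f. continuous_map T euclideanreal f \<and> bounded (f ` topspace T) \<longrightarrow>
        (\<lambda>n. \<integral>\<omega>. f (X n \<omega>) \<partial>N n) \<longlonglongrightarrow> (\<integral>\<omega>. f (Y \<omega>) \<partial>M))"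

definition standard_brownian_motion :: "'b measure \<Rightarrow> (real \<Rightarrow> 'b \<Rightarrow> real) \<Rightarrow> bool" where
  "standard_brownian_motion M B \<longleftrightarrow>
     prob_space M \<and>
     (\<forall>t\<in>{0..1}. B t \<in> borel_measurable M) \<and>
     (AE \<omega> in M. B 0 \<omega> = 0) \<and>
     (\<forall>s t. 0 \<le> s \<and> s < t \<and> t \<le> 1 \<longrightarrow>
        distributed M lborel (\<lambda>\<omega>. B t \<omega> - B s \<omega>) (normal_density 0 (sqrt (t - s)))) \<and>
     (\<forall>k (\<tau> :: nat \<Rightarrow> real). mono_on {..k} \<tau> \<and> \<tau> ` {..k} \<subseteq> {0..1} \<longrightarrow>
        prob_space.indep_vars M (\<lambda>_. borel) (\<lambda>i \<omega>. B (\<tau> (Suc i)) \<omega> - B (\<tau> i) \<omega>) {..<k}) \<and>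
     (\<forall>\<omega>\<in>space M. continuous_on {0..1} (\<lambda>t. B t \<omega>))"


section \<open>The normalised perimeter process\<close>

definition perimeter_process :: "nat \<Rightarrow> cell set \<Rightarrow> real \<Rightarrow> real" where
  "perimeter_process n P = (\<lambda>t\<in>{0..1}.
     (of_int (Rbar P (nat \<lfloor>real n * t\<rfloor>)) - mu4 * (real n * t)) / (sqrt (real n) * sigma4))"

end

theory Submission
  imports Defs
begin

text \<open>A column with cells at heights \<open>l, \<dots>, l + x - 1\<close> whose successor has its base cell at height
\<open>l + z\<close> is recorded as the \<^emph>\<open>block\<close> \<open>(u, z)\<close> with \<open>u = x - z \<ge> 1\<close>; the last column gets \<open>z = 0\<close>. A dcc
of area \<open>n\<close> then is a word of blocks of total size \<open>n\<close> that ends with \<open>z = 0\<close>. Let \<open>q = (3 - sqrt 5) / 2\<close>,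
so that \<open>q = (1 - q)\<^sup>2\<close>. Weighting a block by \<open>q\<close> to the power of its size gives a probability law, under
which \<open>u - 1\<close> and \<open>z\<close> are independent geometric variables. The uniform law on words of size \<open>n\<close> is the law of
independent blocks conditioned to exhaust the area \<open>n\<close> with a block that has \<open>z = 0\<close>, and since the number of words is \<open>a / q ^ n + c * q ^ n\<close>
(\<open>card_words_fib\<close>), its first block differs from an unconditioned one by a density that tends to \<open>1\<close>
exponentially fast (\<open>dens_close\<close>). All expectations are computed by the resulting one-step equation \<open>avg_rec\<close>.

The increment of the centred perimeter over a column depends on the block and, through \<open>w\<^sub>d = x\<^sub>d - u\<^sub>d\<^sub>-\<^sub>1\<close>,
on the preceding \<open>u\<close>. Adding the mean distance \<open>pdist\<close> of a column size from \<open>u\<close> as a boundary term turns the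
increments into martingale differences \<open>incr\<close>, with conditional variance \<open>var_incr u\<close>. Their stationary mean
variance, divided by the mean column size \<open>sqrt 5\<close>, is \<open>\<sigma>\<^sub>4\<^sup>2\<close> (\<open>EQ_var_incr\<close>, \<open>mean_var_eq\<close>).

The central step works in area time, so that no random time change occurs. The characteristic
function of the martingale over a window of area \<open>s\<close> solves a renewal equation, and
\<open>exp (- \<sigma>\<^sub>4\<^sup>2 \<theta>\<^sup>2 s / 2) * (1 - \<theta>\<^sup>2 / 2 * (var_incr u - mean_var))\<close> solves the same equation up to
\<open>O(\<bar>\<theta>\<bar>\<^sup>3)\<close>: the corrector absorbs the fluctuation of the conditional variance, and the mean column size
turns variance per column into variance per area (\<open>approx_step\<close>). Hence \<open>char_walk\<close>, uniformly in the
conditioning and in the preceding \<open>u\<close>. This uniformity lets the windows be peeled off one after the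
other (\<open>fidi_CLT\<close>), first one window by Levy's continuity theorem and Skorohod's representation
(\<open>uniform_CLT\<close>).

For the process, an exponential supersolution of the one-step equation bounds the oscillation
inside the windows (\<open>maximal_inequality\<close>), and fourth moments exclude large columns. So the process is
uniformly close to a step function with \<open>k\<close> steps, and so is Brownian motion. Skorokhod distance is
at most uniform distance, and convergence of the integrals of bounded Lipschitz functions suffices
(\<open>converges_in_distribution_Lipschitz\<close>), which gives the limit theorem by letting first \<open>n\<close>, then \<open>k\<close> tend to
infinity.\<close>

section \<open>Words of blocks and their number\<close>

text \<open>The solution of \<open>q = (1 - q)\<^sup>2\<close> in the unit interval: the radius at which the weights \<open>x * q ^ x\<close> of the
columns of size \<open>x\<close>, each with \<open>x\<close> positions of its successor, sum to \<open>1\<close>.\<close>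

definition q :: real where "q = (3 - sqrt 5) / 2"

lemma q_bounds: "0 < q" "q < 1" "q < 2/5"
proof -
  have "sqrt 5 < 3" by (rule real_less_lsqrt) auto
  moreover have "22/10 < sqrt 5" by (rule real_less_rsqrt) (simp add: power2_eq_square)
  ultimately show "0 < q" "q < 1" "q < 2/5" by (auto simp: q_def)
qed

lemma q_square: "q\<^sup>2 = 3 * q - 1"
  by (simp add: q_def power2_eq_square field_simps)

lemma q_eq: "(1 - q)\<^sup>2 = q"
  using q_square by (simp add: power2_eq_square algebra_simps)

lemma sqrt5_q: "sqrt 5 = 3 - 2 * q"
  by (simp add: q_def field_simps)

type_synonym block = "nat \<times> nat"

definition bsize :: "block \<Rightarrow> nat" where
  "bsize b = fst b + snd b"

text \<open>The condition on the last block reflects that the last column has no successor, so only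
its size counts.\<close>

definition words :: "nat \<Rightarrow> block list set" where
  "words n = {L. (\<forall>b\<in>set L. 1 \<le> fst b) \<and> sum_list (map bsize L) = n \<and> (L \<noteq> [] \<longrightarrow> snd (last L) = 0)}"

text \<open>The possible first blocks of a word of size \<open>n\<close>. A block that exhausts the area is the last one.\<close>

definition first_blocks :: "nat \<Rightarrow> block set" where
  "first_blocks n = {b. 1 \<le> fst b \<and> bsize b \<le> n \<and> (bsize b = n \<longrightarrow> snd b = 0)}"

lemma finite_first_blocks: "finite (first_blocks n)"
  by (rule finite_subset[of _ "{..n} \<times> {..n}"]) (auto simp: first_blocks_def bsize_def)

lemma words_0: "words 0 = {[]}"
proof -
  have "L = []" if "L \<in> words 0" for L
    using that by (cases L) (auto simp: words_def bsize_def)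
  then show ?thesis by (auto simp: words_def)
qed

lemma words_Cons: "b # L \<in> words n \<longleftrightarrow> b \<in> first_blocks n \<and> L \<in> words (n - bsize b)"
proof (cases "L = []")
  case True
  then show ?thesis by (cases b) (auto simp: words_def first_blocks_def bsize_def)
next
  case False
  then obtain b' L' where L: "L = b' # L'" by (cases L) auto
  show ?thesis
    by (cases b; cases b') (auto simp: L words_def first_blocks_def bsize_def)
qed

lemma Nil_in_words: "[] \<in> words n \<longleftrightarrow> n = 0"
  by (auto simp: words_def)

lemma first_blocksD:
  assumes "b \<in> first_blocks n" shows "1 \<le> bsize b" "bsize b \<le> n" "1 \<le> fst b"
  using assms by (auto simp: first_blocks_def bsize_def)

lemma words_rec:
  assumes "0 < n"
  shows "words n = (\<Union>b\<in>first_blocks n. (#) b ` words (n - bsize b))"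
proof (intro set_eqI)
  fix L show "L \<in> words n \<longleftrightarrow> L \<in> (\<Union>b\<in>first_blocks n. (#) b ` words (n - bsize b))"
    using assms by (cases L) (auto simp: words_Cons Nil_in_words)
qed

lemma finite_words: "finite (words n)"
proof (induction n rule: less_induct)
  case (less n)
  show ?case
  proof (cases "n = 0")
    case False
    then have "n - bsize b < n" if "b \<in> first_blocks n" for b
      using first_blocksD[OF that] by simp
    then show ?thesis using False less finite_first_blocks by (simp add: words_rec)
  qed (simp add: words_0)
qed

lemma sum_words_rec:
  assumes "0 < n"
  shows "(\<Sum>L\<in>words n. f L) = (\<Sum>b\<in>first_blocks n. \<Sum>L\<in>words (n - bsize b). f (b # L))"
proof -
  have "(\<Sum>L\<in>words n. f L) = (\<Sum>b\<in>first_blocks n. \<Sum>L\<in>(#) b ` words (n - bsize b). f L)"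
    unfolding words_rec[OF assms]
    by (rule sum.UNION_disjoint) (auto simp: finite_first_blocks finite_words)
  then show ?thesis by (simp add: sum.reindex)
qed

text \<open>The probability that independent blocks, the last of them with \<open>z = 0\<close>, exhaust the area \<open>n\<close> exactly.
It is bounded away from \<open>0\<close> and tends to its limit like \<open>q ^ (2 * n)\<close>.\<close>

definition renewal :: "nat \<Rightarrow> real" where "renewal n = q ^ n * card (words n)"

text \<open>A block of size \<open>x < n\<close> can be split in \<open>x\<close> ways, a block of size \<open>n\<close> in one way.\<close>

lemma sum_first_blocks:
  fixes f :: "nat \<Rightarrow> real"
  assumes "0 < n"
  shows "(\<Sum>b\<in>first_blocks n. f (bsize b)) = (\<Sum>x<n. real x * f x) + f n"
proof -
  let ?S = "SIGMA x:{..<n}. {..<x}"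
  have 1: "first_blocks n = insert (n, 0) ((\<lambda>(x, z). (x - z, z)) ` ?S)" (is "_ = insert _ ?T")
  proof (intro set_eqI)
    fix b :: block
    obtain u z where b: "b = (u, z)" by (cases b)
    have "b \<in> ?T" if "1 \<le> u" "u + z < n"
      by (rule image_eqI[of _ _ "(u + z, z)"]) (use that in \<open>auto simp: b\<close>)
    then show "b \<in> first_blocks n \<longleftrightarrow> b \<in> insert (n, 0) ?T"
      using assms by (cases "u + z < n") (auto simp: first_blocks_def bsize_def b)
  qed
  have 2: "(n, 0) \<notin> ?T" by auto
  have inj: "inj_on (\<lambda>(x, z). (x - z, z)) ?S" by (auto simp: inj_on_def)
  have "(\<Sum>b\<in>first_blocks n. f (bsize b)) = f n + (\<Sum>(x,z)\<in>?S. f x)"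
    unfolding 1 using 2
    by (subst sum.insert) (auto simp: sum.reindex[OF inj] bsize_def intro!: sum.cong)
  also have "(\<Sum>(x,z)\<in>?S. f x) = (\<Sum>x<n. real x * f x)"
    by (subst sum.Sigma[symmetric]) auto
  finally show ?thesis by simp
qed

lemma card_words_rec:
  assumes "0 < n"
  shows "real (card (words n)) = (\<Sum>x<n. real x * card (words (n - x))) + 1"
proof -
  have "real (card (words n)) = (\<Sum>b\<in>first_blocks n. real (card (words (n - bsize b))))"
    using sum_words_rec[OF assms, of "\<lambda>_. 1::real"] by simp
  also have "\<dots> = (\<Sum>x<n. real x * card (words (n - x))) + real (card (words (n - n)))"
    by (rule sum_first_blocks[OF assms])
  finally show ?thesis by (simp add: words_0)
qed

text \<open>The numbers of words are the Fibonacci numbers of odd index. They are found together with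
their partial sums, the Fibonacci numbers of even index: the difference of consecutive instances of
\<open>card_words_rec\<close> is such a partial sum, which turns the convolution into a pair of first-order recursions.\<close>

lemma card_words_fib:
  assumes "0 < n"
  shows "real (card (words n)) = (1 - q) / sqrt 5 * (1 / q) ^ n + (2 - q) / sqrt 5 * q ^ n"
proof -
  let ?c = "\<lambda>n. real (card (words n))"
  let ?F = "\<lambda>n. (1 - q) / sqrt 5 * (1 / q) ^ n + (2 - q) / sqrt 5 * q ^ n"
  define G where "G n = ((1 / q) ^ n - q ^ n) / sqrt 5" for n
  have q0: "q \<noteq> 0" using q_bounds by simp
  have iq: "1 / q = 3 - q" using q_square q0 by (simp add: field_simps power2_eq_square)
  have rev: "(\<Sum>x<n. real x * ?c (n - x)) = (\<Sum>y=1..<n. real (n - y) * ?c y)" if "0 < n" for n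
  proof -
    have "(\<Sum>x<n. real x * ?c (n - x)) = (\<Sum>x=1..<n. real x * ?c (n - x))"
      by (rule sum.mono_neutral_right) auto
    also have "\<dots> = (\<Sum>y=1..<n. real (n - y) * ?c y)"
      by (rule sum.reindex_bij_witness[of _ "\<lambda>y. n - y" "\<lambda>y. n - y"]) auto
    finally show ?thesis .
  qed
  have step: "?c (Suc n) - ?c n = (\<Sum>y=1..n. ?c y)" if "0 < n" for n
  proof -
    have "(\<Sum>y=1..<Suc n. real (Suc n - y) * ?c y) = (\<Sum>y=1..<n. real (Suc n - y) * ?c y) + ?c n"
      using that by (simp add: sum.op_ivl_Suc)
    also have "(\<Sum>y=1..<n. real (Suc n - y) * ?c y) = (\<Sum>y=1..<n. real (n - y) * ?c y + ?c y)"
      by (rule sum.cong) (auto simp: algebra_simps Suc_diff_le)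
    finally have "?c (Suc n) - ?c n = (\<Sum>y=1..<n. ?c y) + ?c n"
      using that card_words_rec[of n] card_words_rec[of "Suc n"] rev[of n] rev[of "Suc n"]
      by (simp add: sum.distrib)
    also have "\<dots> = (\<Sum>y=1..n. ?c y)"
      using that by (metis One_nat_def Suc_leI add.commute sum.last_plus)
    finally show ?thesis .
  qed
  have FG: "?F (Suc n) = ?F n + G n" "G (Suc n) = G n + ?F (Suc n)" for n
  proof -
    have *: "(1 / q) * y = 3 * y - q * y" for y by (simp add: iq algebra_simps)
    have qq: "q * (q * y) = 3 * (q * y) - y" for y
      using q_square by (metis left_diff_distrib mult.assoc mult_1 power2_eq_square)
    show "?F (Suc n) = ?F n + G n" "G (Suc n) = G n + ?F (Suc n)"
      unfolding G_def power_Suc *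
      by (simp_all add: algebra_simps diff_divide_distrib add_divide_distrib qq) 
  qed
  have s5: "sqrt 5 \<noteq> 0" by simp
  have F1: "?F 1 = 1" and G1: "G 1 = 1"
  proof -
    have a: "(1 - q) * (1 / q) + (2 - q) * q = sqrt 5"
      unfolding iq sqrt5_q using q_square by (simp add: algebra_simps power2_eq_square)
    have "?F 1 = ((1 - q) * (1 / q) + (2 - q) * q) / sqrt 5"
      by (simp add: add_divide_distrib)
    then show "?F 1 = 1" unfolding a by simp
    have "1 / q - q = sqrt 5" using iq sqrt5_q by simp
    then show "G 1 = 1" unfolding G_def by (simp only: power_one_right) simp
  qed
  have c1: "?c 1 = 1" using card_words_rec[of 1] by simp
  have "?c n = ?F n \<and> (\<Sum>y=1..n. ?c y) = G n" if "0 < n" for n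
    using that
  proof (induction n rule: nat_induct_non_zero)
    case 1
    show ?case using c1 F1 G1 by simp
  next
    case (Suc n)
    have "?c (Suc n) = ?F (Suc n)" using step[of n] Suc FG(1)[of n] by simp
    then show ?case using Suc FG(2)[of n] by simp
  qed
  then show ?thesis using assms by blast
qed

lemma renewal_eq: "renewal n = (1 - q) / sqrt 5 + (2 - q) / sqrt 5 * q ^ (2 * n)"
proof (cases "n = 0")
  case True
  have "(1 - q) / sqrt 5 + (2 - q) / sqrt 5 = 1"
    unfolding sqrt5_q add_divide_distrib[symmetric] using q_bounds by simp
  then show ?thesis using True by (simp add: renewal_def words_0)
next
  case False
  have "q ^ n * (1 / q) ^ n = 1" using q_bounds by (simp add: power_one_over)
  then have *: "q ^ n * (x * (1 / q) ^ n) = x" for x by simp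
  have **: "q ^ n * (x * q ^ n) = x * q ^ (2 * n)" for x by (simp add: mult_2 power_add)
  show ?thesis using False unfolding renewal_def
    by (simp only: card_words_fib distrib_left * ** neq0_conv)
qed

lemma renewal_0: "renewal 0 = 1" by (simp add: renewal_def words_0)

lemma renewal_lower: "1/4 \<le> renewal n" and renewal_upper: "renewal n \<le> 1"
proof -
  have s: "sqrt 5 < 24/10" by (rule real_less_lsqrt) (auto simp: power2_eq_square)
  have "(1 - q) / sqrt 5 \<ge> 1/4" using s q_bounds by (simp add: field_simps)
  moreover have "0 \<le> (2 - q) / sqrt 5 * q ^ (2 * n)" using q_bounds by simp
  ultimately show "1/4 \<le> renewal n" unfolding renewal_eq by linarith
  have "renewal n \<le> renewal 0" unfolding renewal_eq using q_bounds
    by (intro add_left_mono mult_left_mono) (auto intro!: power_le_one)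
  then show "renewal n \<le> 1" by (simp add: renewal_0)
qed

lemma renewal_diff: "\<bar>renewal m - renewal n\<bar> \<le> q ^ (2 * min m n)"
proof -
  have "(2 - q) / sqrt 5 \<le> 1" unfolding sqrt5_q using q_bounds by (simp add: field_simps)
  moreover have "\<bar>q ^ (2 * m) - q ^ (2 * n)\<bar> \<le> q ^ (2 * min m n)"
  proof -
    have "q ^ (2 * max m n) \<le> q ^ (2 * min m n)" using q_bounds by (intro power_decreasing) auto
    moreover have "0 \<le> q ^ (2 * max m n)" using q_bounds by simp
    ultimately show ?thesis by (cases "m \<le> n") (auto simp: min_def max_def abs_if)
  qed
  moreover have "0 \<le> (2 - q) / sqrt 5" using q_bounds by simp
  moreover have "renewal m - renewal n = (2 - q) / sqrt 5 * (q ^ (2 * m) - q ^ (2 * n))"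
    unfolding renewal_eq by (simp add: algebra_simps)
  ultimately show ?thesis
    by (metis abs_ge_zero abs_mult abs_of_nonneg mult_left_le_one_le order_trans)
qed

lemma card_words_pos: "0 < card (words n)"
  using renewal_lower[of n] by (cases "card (words n)") (auto simp: renewal_def)

lemma words_nonempty: "words n \<noteq> {}" using card_words_pos[of n] by auto

section \<open>Uniform averages and the law of the first block\<close>

definition avg :: "nat \<Rightarrow> (block list \<Rightarrow> 'a::real_normed_vector) \<Rightarrow> 'a" where
  "avg n f = (\<Sum>L\<in>words n. f L) /\<^sub>R real (card (words n))"

lemma avg_0: "avg 0 f = f []"
  by (simp add: avg_def words_0)

lemma avg_const: "avg n (\<lambda>_. c) = c"
  using card_words_pos[of n] by (simp add: avg_def sum_constant_scaleR)

lemma avg_cong: "(\<And>L. L \<in> words n \<Longrightarrow> f L = g L) \<Longrightarrow> avg n f = avg n g"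
  by (simp add: avg_def cong: sum.cong)

lemma avg_add: "avg n (\<lambda>L. f L + g L) = avg n f + avg n g"
  by (simp add: avg_def sum.distrib scaleR_add_right)

lemma avg_diff: "avg n (\<lambda>L. f L - g L) = avg n f - avg n g"
  by (simp add: avg_def sum_subtractf scaleR_diff_right)

lemma avg_mult: "avg n (\<lambda>L. c * f L) = c * avg n f" for c :: real
  by (simp add: avg_def sum_distrib_left[symmetric])

lemma avg_norm: "norm (avg n f) \<le> avg n (\<lambda>L. norm (f L))"
  unfolding avg_def by (simp add: mult_left_mono norm_sum divide_right_mono)

lemma avg_mono: "(\<And>L. L \<in> words n \<Longrightarrow> f L \<le> g L) \<Longrightarrow> avg n f \<le> avg n g" for f g :: "_ \<Rightarrow> real"
  by (simp add: avg_def sum_mono divide_right_mono mult_left_mono)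

lemma avg_bound: "(\<And>L. L \<in> words n \<Longrightarrow> norm (f L) \<le> c) \<Longrightarrow> norm (avg n f) \<le> c"
  using avg_norm[of n f] avg_mono[of n "\<lambda>L. norm (f L)" "\<lambda>_. c"] by (simp add: avg_const)

lemma avg_sum: "avg n (\<lambda>L. \<Sum>i\<in>I. f i L) = (\<Sum>i\<in>I. avg n (f i))"
  unfolding avg_def by (subst sum.swap) (simp add: scaleR_sum_right)

text \<open>The law of a block in the absence of conditioning.\<close>

definition Q :: "block pmf" where
  "Q = map_pmf (\<lambda>(i, j). (Suc i, j)) (pair_pmf (geometric_pmf (1 - q)) (geometric_pmf (1 - q)))"

abbreviation EQ :: "(block \<Rightarrow> 'a::{banach,second_countable_topology}) \<Rightarrow> 'a" where
  "EQ f \<equiv> measure_pmf.expectation Q f"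

lemma geo: "1 - q \<in> {0<..1}" using q_bounds by auto

lemma pmf_Q: "pmf Q b = (if 1 \<le> fst b then q ^ bsize b else 0)"
proof (cases "1 \<le> fst b")
  case True
  then obtain i j where b: "b = (\<lambda>(i, j). (Suc i, j)) (i, j)"
    by (cases b) (metis One_nat_def Suc_le_D case_prod_conv fst_conv)
  have "inj (\<lambda>(i, j). (Suc i, j :: nat))" by (auto simp: inj_def)
  then have "pmf Q b = pmf (pair_pmf (geometric_pmf (1 - q)) (geometric_pmf (1 - q))) (i, j)"
    unfolding Q_def b by (rule pmf_map_inj')
  also have "\<dots> = q ^ i * q ^ j * (1 - q)\<^sup>2"
    using geo by (simp add: pmf_pair power2_eq_square)
  finally show ?thesis using True unfolding q_eq by (simp add: b bsize_def power_add)
next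
  case False
  have "b \<notin> set_pmf Q" using False by (auto simp: Q_def)
  then show ?thesis using False by (simp add: pmf_eq_0_set_pmf)
qed

lemma set_Q: "b \<in> set_pmf Q \<Longrightarrow> 1 \<le> fst b" "b \<in> set_pmf Q \<Longrightarrow> 1 \<le> bsize b"
  by (auto simp: Q_def bsize_def)

lemma AE_Q: "(\<And>b. 1 \<le> fst b \<Longrightarrow> 1 \<le> bsize b \<Longrightarrow> P b) \<Longrightarrow> AE b in Q. P b"
  unfolding AE_measure_pmf_iff using set_Q by blast

text \<open>The density, with respect to \<open>Q\<close>, of the first block of a uniform word of size \<open>n\<close>: the ratio of
the renewal probabilities after and before the block.\<close>

definition dens :: "nat \<Rightarrow> block \<Rightarrow> real" where
  "dens n b = (if b \<in> first_blocks n then renewal (n - bsize b) / renewal n else 0)"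

lemma dens_bounds: "0 \<le> dens n b" "dens n b \<le> 4"
proof -
  have p: "0 < renewal n" for n using renewal_lower[of n] by linarith
  show "0 \<le> dens n b" using less_imp_le[OF p] by (simp add: dens_def)
  have "renewal m / renewal n \<le> 4" for m
    using p[of n] renewal_lower[of n] renewal_upper[of m] by (simp add: divide_le_eq)
  then show "dens n b \<le> 4" by (simp add: dens_def)
qed

text \<open>For an admissible block of size \<open>x\<close> the error is of order \<open>q ^ (2 * (n - x))\<close>; other blocks have size at
least \<open>n\<close>. As \<open>q\<^sup>2 \<le> 2/3\<close>, powers of \<open>3/2\<close> cover both cases; and as \<open>3/2 < 1 / q\<close>, the bound is
integrable under \<open>Q\<close>.\<close>

lemma dens_close: "1 \<le> fst b \<Longrightarrow> \<bar>dens n b - 1\<bar> \<le> 4 * (3/2) ^ bsize b / (3/2) ^ n"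
proof (cases "b \<in> first_blocks n")
  case True
  then have x: "bsize b \<le> n" using first_blocksD by blast
  have p: "0 < renewal n" using renewal_lower[of n] by linarith
  have "\<bar>dens n b - 1\<bar> = \<bar>renewal (n - bsize b) - renewal n\<bar> / renewal n"
    proof -
    have "dens n b - 1 = (renewal (n - bsize b) - renewal n) / renewal n"
      using True p by (simp add: dens_def diff_divide_distrib)
    then show ?thesis using p by (simp only: abs_divide)
  qed
  also have "\<dots> \<le> \<bar>renewal (n - bsize b) - renewal n\<bar> / (1/4)"
    using renewal_lower[of n] by (intro divide_left_mono) auto
  also have "\<dots> \<le> 4 * q ^ (2 * (n - bsize b))"
    using renewal_diff[of "n - bsize b" n] by (simp add: min_def)
  also have "q ^ (2 * (n - bsize b)) \<le> (2/3) ^ (n - bsize b)"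
  proof -
    have "q\<^sup>2 \<le> (2/5)\<^sup>2" using q_bounds by (intro power_mono) auto
    then show ?thesis unfolding power_mult using q_bounds by (intro power_mono) (auto simp: power2_eq_square)
  qed
  also have "4 * (2/3) ^ (n - bsize b) = 4 * (3/2) ^ bsize b / (3/2::real) ^ n"
    using x by (simp add: power_diff power_divide field_simps)
  finally show ?thesis by simp
next
  case False
  assume "1 \<le> fst b"
  then have "n \<le> bsize b" using False by (auto simp: first_blocks_def)
  then have "(3/2) ^ n \<le> ((3/2) ^ bsize b :: real)" by (intro power_increasing) auto
  moreover have "0 \<le> ((3/2) ^ bsize b :: real)" by simp
  ultimately have "(3/2) ^ n \<le> 4 * ((3/2) ^ bsize b :: real)" by linarith
  then have "1 \<le> 4 * (3/2) ^ bsize b / (3/2::real) ^ n" by (simp add: le_divide_eq)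
  then show ?thesis using False by (simp add: dens_def)
qed

text \<open>The one-step equation: after the first block, the remaining word is uniform again. It is stated
with an expectation under the fixed law \<open>Q\<close>, so that moments of \<open>Q\<close> apply for all \<open>n\<close> at once.\<close>

lemma avg_rec:
  fixes f :: "block list \<Rightarrow> 'a::{banach,second_countable_topology}"
  assumes "0 < n"
  shows "avg n f = EQ (\<lambda>b. dens n b *\<^sub>R avg (n - bsize b) (\<lambda>L. f (b # L)))"
proof -
  have "EQ (\<lambda>b. dens n b *\<^sub>R avg (n - bsize b) (\<lambda>L. f (b # L)))
     = (\<Sum>b\<in>first_blocks n. pmf Q b *\<^sub>R dens n b *\<^sub>R avg (n - bsize b) (\<lambda>L. f (b # L)))"
    by (rule integral_measure_pmf) (auto simp: finite_first_blocks dens_def split: if_splits)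
  also have "\<dots> = (\<Sum>b\<in>first_blocks n. (\<Sum>L\<in>words (n - bsize b). f (b # L)) /\<^sub>R card (words n))"
  proof (rule sum.cong[OF refl])
    fix b assume b: "b \<in> first_blocks n"
    note bd = first_blocksD[OF b]
    have "pmf Q b * dens n b * inverse (real (card (words (n - bsize b)))) = inverse (real (card (words n)))"
      using b bd q_bounds card_words_pos[of "n - bsize b"] card_words_pos[of n]
      by (simp add: pmf_Q dens_def renewal_def field_simps power_add[symmetric])
    then show "pmf Q b *\<^sub>R dens n b *\<^sub>R avg (n - bsize b) (\<lambda>L. f (b # L)) = (\<Sum>L\<in>words (n - bsize b). f (b # L)) /\<^sub>R card (words n)"
      unfolding avg_def by (simp only: scaleR_scaleR mult.assoc[symmetric])
  qed
  also have "\<dots> = avg n f"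
    unfolding avg_def sum_words_rec[OF assms] by (simp add: scaleR_sum_right)
  finally show ?thesis by simp
qed

lemma EQ_dens: "0 < n \<Longrightarrow> EQ (dens n) = 1"
  using avg_rec[of n "\<lambda>_. 1::real"] by (simp add: avg_const)

section \<open>Products of discrete distributions\<close>

lemma measure_pair_pmf:
  fixes A :: "'a::countable pmf" and B :: "'b::countable pmf"
  shows "measure_pmf (pair_pmf A B) = measure_pmf A \<Otimes>\<^sub>M measure_pmf B"
proof (rule measure_eqI_countable[of _ UNIV])
  have "sets (measure_pmf A \<Otimes>\<^sub>M measure_pmf B) = sets (count_space UNIV \<Otimes>\<^sub>M count_space UNIV)"
    by (rule sets_pair_measure_cong) simp_all
  also have "\<dots> = Pow UNIV"
    by (metis UNIV_Times_UNIV countableI_type pair_measure_countable sets_count_space)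
  finally show "sets (measure_pmf A \<Otimes>\<^sub>M measure_pmf B) = Pow UNIV" .
  fix x :: "'a \<times> 'b"
  obtain a b where x: "x = (a, b)" by (cases x)
  have "emeasure (measure_pmf A \<Otimes>\<^sub>M measure_pmf B) ({a} \<times> {b}) = emeasure A {a} * emeasure B {b}"
    by (rule measure_pmf.emeasure_pair_measure_Times) auto
  then show "emeasure (measure_pmf (pair_pmf A B)) {x} = emeasure (measure_pmf A \<Otimes>\<^sub>M measure_pmf B) {x}"
    by (simp add: x emeasure_pmf_single pmf_pair ennreal_mult)
qed auto

lemma pair_pmf_Fubini:
  fixes A :: "'a::countable pmf" and B :: "'b::countable pmf"
    and f :: "'a \<times> 'b \<Rightarrow> real"
  assumes "integrable (pair_pmf A B) f"
  shows "measure_pmf.expectation (pair_pmf A B) f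
      = measure_pmf.expectation A (\<lambda>a. measure_pmf.expectation B (\<lambda>b. f (a, b)))"
    and "measure_pmf.expectation (pair_pmf A B) f
      = measure_pmf.expectation B (\<lambda>b. measure_pmf.expectation A (\<lambda>a. f (a, b)))"
proof -
  interpret pair_sigma_finite "measure_pmf A" "measure_pmf B" ..
  have i: "integrable (measure_pmf A \<Otimes>\<^sub>M measure_pmf B) f"
    using assms unfolding measure_pair_pmf .
  then have i': "integrable (measure_pmf A \<Otimes>\<^sub>M measure_pmf B) (case_prod (\<lambda>a b. f (a, b)))" by simp
  show "measure_pmf.expectation (pair_pmf A B) f
      = measure_pmf.expectation A (\<lambda>a. measure_pmf.expectation B (\<lambda>b. f (a, b)))"
    unfolding measure_pair_pmf using integral_fst'[OF i] by simp
  show "measure_pmf.expectation (pair_pmf A B) f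
      = measure_pmf.expectation B (\<lambda>b. measure_pmf.expectation A (\<lambda>a. f (a, b)))"
    unfolding measure_pair_pmf using integral_snd[OF i'] by simp
qed

lemma pair_pmf_has_integral:
  fixes A :: "'a::countable pmf" and B :: "'b::countable pmf"
    and f :: "'a \<Rightarrow> real" and g :: "'b \<Rightarrow> real"
  assumes "has_bochner_integral A f x" "has_bochner_integral B g y"
  shows "has_bochner_integral (pair_pmf A B) (\<lambda>(a, b). f a * g b) (x * y)"
proof -
  interpret pair_sigma_finite "measure_pmf A" "measure_pmf B" ..
  have fg: "integrable A f" "integrable B g" "measure_pmf.expectation A f = x" "measure_pmf.expectation B g = y"
    using assms by (auto simp: has_bochner_integral_iff)
  have "integrable (pair_pmf A B) (\<lambda>(a, b). f a * g b)"
    unfolding measure_pair_pmf using fg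
    by (intro Fubini_integrable) (auto simp: measure_pair_pmf[symmetric] abs_mult)
  then show ?thesis
    by (simp add: has_bochner_integral_iff pair_pmf_Fubini fg mult.commute[of y])
qed

abbreviation "Geo \<equiv> geometric_pmf (1 - q)"

section \<open>Moments of the geometric distribution\<close>

lemma Geo_sums:
  fixes f :: "nat \<Rightarrow> real"
  assumes "\<And>i. 0 \<le> f i" "(\<lambda>i. q ^ i * f i) sums s"
  shows "has_bochner_integral Geo f ((1 - q) * s)"
proof -
  have s: "(\<lambda>i. pmf Geo i * f i) sums ((1 - q) * s)"
    using sums_mult[OF assms(2), of "1 - q"] geo by (simp add: mult_ac)
  have i: "integrable (count_space UNIV) (\<lambda>i. pmf Geo i * f i)"
    unfolding integrable_count_space_nat_iff using s assms(1) by (auto simp: sums_iff)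
  have "integrable Geo f"
    unfolding measure_pmf_eq_density using i by (subst integrable_density) auto
  moreover have "measure_pmf.expectation Geo f = (1 - q) * s"
  proof -
    have "measure_pmf.expectation Geo f = (\<integral>n. pmf Geo n * f n \<partial>count_space UNIV)"
      unfolding measure_pmf_eq_density by (subst integral_density) auto
    then show ?thesis using i s by (simp add: integral_count_space_nat sums_iff)
  qed
  ultimately show ?thesis by (simp add: has_bochner_integral_iff)
qed

lemma geometric_sums_square:
  fixes x :: real
  assumes "0 \<le> x" "x < 1"
  shows "(\<lambda>n. real n ^ 2 * x ^ n) sums (x * (1 + x) / (1 - x) ^ 3)"
proof -
  have s1: "(\<lambda>n. x ^ n * real n) sums (x / (1 - x)\<^sup>2)"
    using geometric_sums_times_n[of x] assms by simp
  have s0: "(\<lambda>n. x ^ n) sums (1 / (1 - x))" using geometric_sums[of x] assms by simp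
  have "summable (\<lambda>n. real n ^ 2 * x ^ n)"
  proof -
    have y: "0 \<le> sqrt x" "sqrt x < 1" using assms by auto
    have sy: "summable (\<lambda>n. sqrt x ^ n * real n)"
      using geometric_sums_times_n[of "sqrt x"] y by (auto simp: sums_iff)
    have "\<forall>\<^sub>F n in sequentially. sqrt x ^ n * real n < 1"
      using order_tendstoD(2)[OF summable_LIMSEQ_zero[OF sy], of 1] by simp
    then have "\<forall>\<^sub>F n in sequentially. norm (real n ^ 2 * x ^ n) \<le> sqrt x ^ n * real n"
    proof eventually_elim
      case (elim n)
      have "x ^ n = sqrt x ^ n * sqrt x ^ n" using assms by (simp add: power_mult_distrib[symmetric])
      then have "norm (real n ^ 2 * x ^ n) = (sqrt x ^ n * real n) * (sqrt x ^ n * real n)"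
        using assms by (simp add: power2_eq_square mult_ac)
      also have "\<dots> \<le> 1 * (sqrt x ^ n * real n)"
        using elim y by (intro mult_right_mono) auto
      finally show ?case by simp
    qed
    then show ?thesis by (rule summable_comparison_test_ev[OF _ sy])
  qed
  then obtain S where S: "(\<lambda>n. real n ^ 2 * x ^ n) sums S" by (auto simp: summable_def)
  have "(\<lambda>n. real (Suc n) ^ 2 * x ^ Suc n) sums S"
    using sums_Suc_imp[of "\<lambda>n. real n ^ 2 * x ^ n" S] S sums_Suc_iff[of "\<lambda>n. real n ^ 2 * x ^ n" S] by simp
  moreover have "(\<lambda>n. x * (real n ^ 2 * x ^ n + 2 * (x ^ n * real n) + x ^ n)) sums (x * (S + 2 * (x / (1 - x)\<^sup>2) + 1 / (1 - x)))"
    by (intro sums_mult sums_add S s1 s0)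
  ultimately have "S = x * (S + 2 * (x / (1 - x)\<^sup>2) + 1 / (1 - x))"
    by (intro sums_unique2[of "\<lambda>n. real (Suc n) ^ 2 * x ^ Suc n"]) (simp_all add: power2_eq_square algebra_simps)
  then have "S * (1 - x) = x * (2 * (x / (1 - x)\<^sup>2) + 1 / (1 - x))" by (simp add: algebra_simps)
  also have "1 / (1 - x) = (1 - x) / (1 - x)\<^sup>2" using assms by (simp add: power2_eq_square)
  also have "x * (2 * (x / (1 - x)\<^sup>2) + (1 - x) / (1 - x)\<^sup>2) = x * (1 + x) / (1 - x)\<^sup>2"
    by (simp add: add_divide_distrib[symmetric])
  finally have "S = x * (1 + x) / (1 - x)\<^sup>2 / (1 - x)" using assms by (simp add: eq_divide_eq mult_ac)
  then have "S = x * (1 + x) / (1 - x) ^ 3" by (simp add: power2_eq_square power3_eq_cube mult.assoc)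
  then show ?thesis using S by simp
qed

lemma Geo_moment:
  assumes "0 \<le> r" "r \<le> 1"
  shows "has_bochner_integral Geo (\<lambda>i. r ^ i) ((1 - q) / (1 - q * r))"
    "has_bochner_integral Geo (\<lambda>i. real i * r ^ i) ((1 - q) * (q * r) / (1 - q * r)\<^sup>2)"
    "has_bochner_integral Geo (\<lambda>i. (real i)\<^sup>2 * r ^ i) ((1 - q) * (q * r * (1 + q * r)) / (1 - q * r) ^ 3)"
proof -
  have "q * r \<le> q * 1" using assms q_bounds by (intro mult_left_mono) auto
  then have x: "0 \<le> q * r" "q * r < 1" using assms q_bounds by (simp, linarith)
  show "has_bochner_integral Geo (\<lambda>i. r ^ i) ((1 - q) / (1 - q * r))"
    using Geo_sums[of "\<lambda>i. r ^ i" "1 / (1 - q * r)"] geometric_sums[of "q * r"] x assms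
    by (simp add: power_mult_distrib)
  show "has_bochner_integral Geo (\<lambda>i. real i * r ^ i) ((1 - q) * (q * r) / (1 - q * r)\<^sup>2)"
    using Geo_sums[of "\<lambda>i. real i * r ^ i" "q * r / (1 - q * r)\<^sup>2"] geometric_sums_times_n[of "q * r"] x assms
    by (simp add: power_mult_distrib mult_ac)
  show "has_bochner_integral Geo (\<lambda>i. (real i)\<^sup>2 * r ^ i) ((1 - q) * (q * r * (1 + q * r)) / (1 - q * r) ^ 3)"
    using Geo_sums[of "\<lambda>i. (real i)\<^sup>2 * r ^ i" "q * r * (1 + q * r) / (1 - q * r) ^ 3"] geometric_sums_square[of "q * r"] x assms
    by (simp add: power_mult_distrib mult_ac)
qed

abbreviation "s5 \<equiv> sqrt 5"

lemma s5: "s5 * s5 = 5" "s5 * (s5 * y) = 5 * y" "s5\<^sup>2 = 5"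
  by (simp_all add: mult.assoc[symmetric])

lemma s5_bounds: "2 < s5" "s5 < 24/10"
proof -
  show "2 < s5" by (rule real_less_rsqrt) simp
  show "s5 < 24/10" by (rule real_less_lsqrt) (simp_all add: power2_eq_square)
qed

lemma q_powers: "q = (3 - s5) / 2" "q * q = (7 - 3 * s5) / 2" "q * (q * q) = 9 - 4 * s5"
  using s5 by (simp_all add: q_def field_simps)

lemma Geo_table:
  "has_bochner_integral Geo (\<lambda>i. 1 :: real) 1"
  "has_bochner_integral Geo (\<lambda>i. real i) (- 1/2 + 1/2 * s5)"
  "has_bochner_integral Geo (\<lambda>i. (real i)\<^sup>2) (5/2 - 1/2 * s5)"
  "has_bochner_integral Geo (\<lambda>i. q ^ i) (1/2 + 1/10 * s5)"
  "has_bochner_integral Geo (\<lambda>i. real i * q ^ i) (- 1/10 + 1/10 * s5)"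
  "has_bochner_integral Geo (\<lambda>i. (real i)\<^sup>2 * q ^ i) (3/10 - 3/50 * s5)"
  "has_bochner_integral Geo (\<lambda>i. (q * q) ^ i) (3/8 + 1/8 * s5)"
  "has_bochner_integral Geo (\<lambda>i. real i * (q * q) ^ i) (- 1/32 + 1/32 * s5)"
  "has_bochner_integral Geo (\<lambda>i. (real i)\<^sup>2 * (q * q) ^ i) (5/64 - 1/64 * s5)"
proof -
  have q01: "0 \<le> q" "q \<le> 1" "0 \<le> q * q" "q * q \<le> 1" using q_bounds by (auto intro: mult_le_one)
  have gt: "2 < s5" by (rule real_less_rsqrt) simp
  moreover have "s5 < 9/4" by (rule real_less_lsqrt) (simp_all add: power2_eq_square)
  note gt = gt this
  have n: "1 - q \<noteq> 0" "1 - q * q \<noteq> 0" "1 - q * (q * q) \<noteq> 0"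
  proof -
    have "1 - q = (s5 - 1) / 2" "1 - q * q = (3 * s5 - 5) / 2" "1 - q * (q * q) = 4 * s5 - 8"
      unfolding q_powers(3) q_powers(2) by (simp_all add: q_powers(1) field_simps)
    then show "1 - q \<noteq> 0" "1 - q * q \<noteq> 0" "1 - q * (q * q) \<noteq> 0" using gt by auto
  qed
  have "(1 - q) * q / (1 - q)\<^sup>2 = q / (1 - q)" using n(1) by (simp add: power2_eq_square)
  moreover have "q / (1 - q) = - 1/2 + 1/2 * s5"
    using n(1) by (simp add: divide_eq_eq) (simp add: q_powers(1) field_simps s5)
  ultimately have b: "(1 - q) * q / (1 - q)\<^sup>2 = - 1/2 + 1/2 * s5" by (simp only:)
  show "has_bochner_integral Geo (\<lambda>i. 1 :: real) 1" using Geo_moment(1)[of 1] n(1) by simp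
  show "has_bochner_integral Geo (\<lambda>i. real i) (- 1/2 + 1/2 * s5)" using Geo_moment(2)[of 1] b by simp
  have "(1 - q) * (q * (1 + q)) = (5/2 - 1/2 * s5) * (1 - q) ^ 3"
    unfolding q_powers(1) by (simp add: power3_eq_cube s5 field_simps)
  then have "(1 - q) * (q * (1 + q)) / (1 - q) ^ 3 = 5/2 - 1/2 * s5"
    using n(1) by (simp add: nonzero_divide_eq_eq)
  then show "has_bochner_integral Geo (\<lambda>i. (real i)\<^sup>2) (5/2 - 1/2 * s5)" using Geo_moment(3)[of 1] by simp
  have "(1 - q) = (1/2 + 1/10 * s5) * (1 - q * q)"
    unfolding q_powers(3) unfolding q_powers(2) unfolding q_powers(1) by (simp add: power2_eq_square power3_eq_cube s5 field_simps)
  then have "(1 - q) / (1 - q * q) = 1/2 + 1/10 * s5"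
    using n(2) by (simp add: nonzero_divide_eq_eq)
  then show "has_bochner_integral Geo (\<lambda>i. q ^ i) (1/2 + 1/10 * s5)" using Geo_moment(1)[of q] q01 by simp
  have "(1 - q) * (q * q) = (- 1/10 + 1/10 * s5) * (1 - q * q)\<^sup>2"
    unfolding q_powers(3) unfolding q_powers(2) unfolding q_powers(1) by (simp add: power2_eq_square power3_eq_cube s5 field_simps)
  then have "(1 - q) * (q * q) / (1 - q * q)\<^sup>2 = - 1/10 + 1/10 * s5"
    using n(2) by (simp add: nonzero_divide_eq_eq)
  then show "has_bochner_integral Geo (\<lambda>i. real i * q ^ i) (- 1/10 + 1/10 * s5)" using Geo_moment(2)[of q] q01 by simp
  have "(1 - q) * (q * q * (1 + q * q)) = (3/10 - 3/50 * s5) * (1 - q * q) ^ 3"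
    unfolding q_powers(3) unfolding q_powers(2) unfolding q_powers(1) by (simp add: power2_eq_square power3_eq_cube s5 field_simps)
  then have "(1 - q) * (q * q * (1 + q * q)) / (1 - q * q) ^ 3 = 3/10 - 3/50 * s5"
    using n(2) by (simp add: nonzero_divide_eq_eq)
  then show "has_bochner_integral Geo (\<lambda>i. (real i)\<^sup>2 * q ^ i) (3/10 - 3/50 * s5)" using Geo_moment(3)[of q] q01 by simp
  have "(1 - q) = (3/8 + 1/8 * s5) * (1 - q * (q * q))"
    unfolding q_powers(3) unfolding q_powers(2) unfolding q_powers(1) by (simp add: power2_eq_square power3_eq_cube s5 field_simps)
  then have "(1 - q) / (1 - q * (q * q)) = 3/8 + 1/8 * s5"
    using n(3) by (simp add: nonzero_divide_eq_eq)
  then show "has_bochner_integral Geo (\<lambda>i. (q * q) ^ i) (3/8 + 1/8 * s5)" using Geo_moment(1)[of "q * q"] q01 by simp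
  have "(1 - q) * (q * (q * q)) = (- 1/32 + 1/32 * s5) * (1 - q * (q * q))\<^sup>2"
    unfolding q_powers(3) unfolding q_powers(2) unfolding q_powers(1) by (simp add: power2_eq_square power3_eq_cube s5 field_simps)
  then have "(1 - q) * (q * (q * q)) / (1 - q * (q * q))\<^sup>2 = - 1/32 + 1/32 * s5"
    using n(3) by (simp add: nonzero_divide_eq_eq)
  then show "has_bochner_integral Geo (\<lambda>i. real i * (q * q) ^ i) (- 1/32 + 1/32 * s5)" using Geo_moment(2)[of "q * q"] q01 by simp
  have "(1 - q) * (q * (q * q) * (1 + q * (q * q))) = (5/64 - 1/64 * s5) * (1 - q * (q * q)) ^ 3"
    unfolding q_powers(3) unfolding q_powers(2) unfolding q_powers(1) by (simp add: power2_eq_square power3_eq_cube s5 field_simps)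
  then have "(1 - q) * (q * (q * q) * (1 + q * (q * q))) / (1 - q * (q * q)) ^ 3 = 5/64 - 1/64 * s5"
    using n(3) by (simp add: nonzero_divide_eq_eq)
  then show "has_bochner_integral Geo (\<lambda>i. (real i)\<^sup>2 * (q * q) ^ i) (5/64 - 1/64 * s5)" using Geo_moment(3)[of "q * q"] q01 by simp
qed

text \<open>Serves as a table of the mixed moments of \<open>u\<close> and \<open>q\<^sup>u\<close>, where \<open>u - 1\<close> is geometric. These occur because
\<open>pdist\<close> and \<open>rho\<close> are of this form.\<close>

lemma Geo_poly_Suc:
  fixes a00 a10 a20 a01 a11 a21 a02 a12 a22 :: real
  shows "has_bochner_integral Geo
    (\<lambda>i. a00 + a10 * real (Suc i) + a20 * (real (Suc i))\<^sup>2
      + a01 * q ^ Suc i + a11 * (real (Suc i) * q ^ Suc i) + a21 * ((real (Suc i))\<^sup>2 * q ^ Suc i)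
      + a02 * (q ^ Suc i)\<^sup>2 + a12 * (real (Suc i) * (q ^ Suc i)\<^sup>2) + a22 * ((real (Suc i))\<^sup>2 * (q ^ Suc i)\<^sup>2))
    (a00 + a10 * (1/2 + 1/2 * s5) + a20 * (5/2 + 1/2 * s5)
      + a01 * (1/2 - 1/10 * s5) + a11 * (1/10 + 1/10 * s5) + a21 * (3/10 + 3/50 * s5)
      + a02 * (3/8 - 1/8 * s5) + a12 * (1/32 + 1/32 * s5) + a22 * (5/64 + 1/64 * s5))"
proof -
  note T = Geo_table
  have 1: "has_bochner_integral Geo (\<lambda>i. real i + 1) (- 1/2 + 1/2 * s5 + 1)" by (intro has_bochner_integral_add T)
  have 2: "has_bochner_integral Geo (\<lambda>i. (real i)\<^sup>2 + 2 * real i + 1) (5/2 - 1/2 * s5 + 2 * (- 1/2 + 1/2 * s5) + 1)"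
    by (intro has_bochner_integral_add has_bochner_integral_mult_right T)
  have 3: "has_bochner_integral Geo (\<lambda>i. q * q ^ i) (q * (1/2 + 1/10 * s5))"
    by (intro has_bochner_integral_mult_right T)
  have 4: "has_bochner_integral Geo (\<lambda>i. q * (real i * q ^ i + q ^ i)) (q * (- 1/10 + 1/10 * s5 + (1/2 + 1/10 * s5)))"
    by (intro has_bochner_integral_add has_bochner_integral_mult_right T)
  have 5: "has_bochner_integral Geo (\<lambda>i. q * ((real i)\<^sup>2 * q ^ i + 2 * (real i * q ^ i) + q ^ i))
     (q * (3/10 - 3/50 * s5 + 2 * (- 1/10 + 1/10 * s5) + (1/2 + 1/10 * s5)))"
    by (intro has_bochner_integral_add has_bochner_integral_mult_right T)
  have 6: "has_bochner_integral Geo (\<lambda>i. q * q * (q * q) ^ i) (q * q * (3/8 + 1/8 * s5))"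
    by (intro has_bochner_integral_mult_right T)
  have 7: "has_bochner_integral Geo (\<lambda>i. q * q * (real i * (q * q) ^ i + (q * q) ^ i)) (q * q * (- 1/32 + 1/32 * s5 + (3/8 + 1/8 * s5)))"
    by (intro has_bochner_integral_add has_bochner_integral_mult_right T)
  have 8: "has_bochner_integral Geo (\<lambda>i. q * q * ((real i)\<^sup>2 * (q * q) ^ i + 2 * (real i * (q * q) ^ i) + (q * q) ^ i))
     (q * q * (5/64 - 1/64 * s5 + 2 * (- 1/32 + 1/32 * s5) + (3/8 + 1/8 * s5)))"
    by (intro has_bochner_integral_add has_bochner_integral_mult_right T)
  have v: "- 1/2 + 1/2 * s5 + 1 = 1/2 + 1/2 * s5"
    "5/2 - 1/2 * s5 + 2 * (- 1/2 + 1/2 * s5) + 1 = 5/2 + 1/2 * s5"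
    "q * (1/2 + 1/10 * s5) = 1/2 - 1/10 * s5"
    "q * (- 1/10 + 1/10 * s5 + (1/2 + 1/10 * s5)) = 1/10 + 1/10 * s5"
    "q * (3/10 - 3/50 * s5 + 2 * (- 1/10 + 1/10 * s5) + (1/2 + 1/10 * s5)) = 3/10 + 3/50 * s5"
    "q * q * (3/8 + 1/8 * s5) = 3/8 - 1/8 * s5"
    "q * q * (- 1/32 + 1/32 * s5 + (3/8 + 1/8 * s5)) = 1/32 + 1/32 * s5"
    "q * q * (5/64 - 1/64 * s5 + 2 * (- 1/32 + 1/32 * s5) + (3/8 + 1/8 * s5)) = 5/64 + 1/64 * s5"
    unfolding q_powers(2) unfolding q_powers(1) by (simp_all add: field_simps s5)
  have e: "real (Suc i) = real i + 1" "(real (Suc i))\<^sup>2 = (real i)\<^sup>2 + 2 * real i + 1"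
    "q ^ Suc i = q * q ^ i" "real (Suc i) * q ^ Suc i = q * (real i * q ^ i + q ^ i)"
    "(real (Suc i))\<^sup>2 * q ^ Suc i = q * ((real i)\<^sup>2 * q ^ i + 2 * (real i * q ^ i) + q ^ i)"
    "(q ^ Suc i)\<^sup>2 = q * q * (q * q) ^ i"
    "real (Suc i) * (q ^ Suc i)\<^sup>2 = q * q * (real i * (q * q) ^ i + (q * q) ^ i)"
    "(real (Suc i))\<^sup>2 * (q ^ Suc i)\<^sup>2 = q * q * ((real i)\<^sup>2 * (q * q) ^ i + 2 * (real i * (q * q) ^ i) + (q * q) ^ i)" for i
    by (simp_all add: algebra_simps power2_eq_square power_mult_distrib)
  have c: "has_bochner_integral Geo (\<lambda>i. a00) (a00)"
    using has_bochner_integral_mult_right[OF T(1), of "a00"] by simp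
  show ?thesis
    using 1 2 3 4 5 6 7 8 c unfolding v e[symmetric]
    by (intro has_bochner_integral_add has_bochner_integral_mult_right)
qed

section \<open>The law of one block\<close>

lemma Q_has_integral:
  fixes f g :: "nat \<Rightarrow> real"
  assumes "has_bochner_integral Geo (\<lambda>i. f (Suc i)) x" "has_bochner_integral Geo g y"
  shows "has_bochner_integral Q (\<lambda>b. f (fst b) * g (snd b)) (x * y)"
  using pair_pmf_has_integral[OF assms]
  unfolding Q_def has_bochner_integral_iff by (simp add: case_prod_unfold)

lemma Q_has_integral_fst:
  assumes "has_bochner_integral Geo (\<lambda>i. f (Suc i)) x"
  shows "has_bochner_integral Q (\<lambda>b. f (fst b)) (x::real)"
  using Q_has_integral[OF assms Geo_table(1)] by simp

lemma Q_has_integral_snd: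
  assumes "has_bochner_integral Geo g x"
  shows "has_bochner_integral Q (\<lambda>b. g (snd b)) (x::real)"
  using Q_has_integral[of "\<lambda>_. 1", OF Geo_table(1) assms] by simp

lemma integrable_Q_two_power: "integrable Q (\<lambda>b. 2 ^ bsize b :: real)"
proof -
  have x: "2 * q < 1" "0 < q" using q_bounds by auto
  have g: "has_bochner_integral Geo (\<lambda>i. 2 ^ i) ((1 - q) * (1 / (1 - 2 * q)))"
    by (rule Geo_sums) (use geometric_sums[of "2 * q"] x in \<open>auto simp: power_mult_distrib mult.commute\<close>)
  have "has_bochner_integral Geo (\<lambda>i. 2 * 2 ^ i) (2 * ((1 - q) * (1 / (1 - 2 * q))))"
    by (rule has_bochner_integral_mult_right) (use g in auto)
  then have "has_bochner_integral Geo (\<lambda>i. 2 ^ Suc i) (2 * ((1 - q) * (1 / (1 - 2 * q))))" by simp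
  from Q_has_integral[OF this g] show ?thesis
    by (simp add: has_bochner_integral_iff bsize_def power_add)
qed

lemma integrable_Q:
  fixes f :: "block \<Rightarrow> 'a::{banach,second_countable_topology}"
  assumes "\<And>b. 1 \<le> fst b \<Longrightarrow> norm (f b) \<le> C * 2 ^ bsize b"
  shows "integrable Q f"
proof (rule Bochner_Integration.integrable_bound)
  show "integrable Q (\<lambda>b. C * 2 ^ bsize b)"
    using integrable_Q_two_power by simp
  show "AE b in Q. norm (f b) \<le> norm (C * 2 ^ bsize b)"
    by (rule AE_Q) (use assms in \<open>fastforce intro: order_trans\<close>)
qed simp

text \<open>Bernoulli's inequality with the step \<open>7/100\<close>, whose fourth power is still below the quotient \<open>4/3\<close>
of the two bases.\<close>

lemma power_le_two_power: "real x ^ 4 * (3/2) ^ x \<le> 13 ^ 5 * 2 ^ x"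
proof -
  have "1 + real x * (7/100) \<le> (1 + 7/100) ^ x" by (rule Bernoulli_inequality) simp
  then have "real x \<le> 100/7 * (107/100) ^ x" by simp
  then have "real x ^ 4 \<le> (100/7 * (107/100) ^ x) ^ 4" by (intro power_mono) auto
  also have "\<dots> = (100/7) ^ 4 * ((107/100) ^ 4) ^ x" 
  proof -
    have "((107/100) ^ x) ^ 4 = (((107/100) ^ 4) ^ x :: real)" by (metis power_mult mult.commute)
    then show ?thesis by (simp only: power_mult_distrib)
  qed
  also have "\<dots> \<le> 13 ^ 5 * (4/3) ^ x" by (intro mult_mono power_mono) (auto simp: power4_eq_xxxx)
  finally have "real x ^ 4 * (3/2) ^ x \<le> 13 ^ 5 * (4/3) ^ x * (3/2) ^ x" by (intro mult_right_mono) auto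
  also have "\<dots> = 13 ^ 5 * (4/3 * (3/2)) ^ x" by (simp only: power_mult_distrib mult.assoc)
  finally show ?thesis by simp
qed

text \<open>The form in which domination is used below: four powers of the size and the factor \<open>3/2\<close> per cell
from \<open>dens_close\<close> are admitted.\<close>

lemma integrable_Q':
  fixes f :: "block \<Rightarrow> 'a::{banach,second_countable_topology}"
  assumes C: "0 \<le> C" and "\<And>b. 1 \<le> fst b \<Longrightarrow> norm (f b) \<le> C * (real (bsize b) ^ 4 * (3/2) ^ bsize b)"
  shows "integrable Q f"
proof (rule integrable_Q)
  fix b :: block assume "1 \<le> fst b"
  have "C * (real (bsize b) ^ 4 * (3/2) ^ bsize b) \<le> C * (13 ^ 5 * 2 ^ bsize b)"
    using power_le_two_power C by (rule mult_left_mono)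
  then show "norm (f b) \<le> (C * 13 ^ 5) * 2 ^ bsize b"
    using assms(2)[OF \<open>1 \<le> fst b\<close>] by simp
qed

lemma bsize_moments:
  "has_bochner_integral Q (\<lambda>b. real (bsize b)) s5"
  "has_bochner_integral Q (\<lambda>b. (real (bsize b))\<^sup>2) 7"
proof -
  have U: "has_bochner_integral Geo (\<lambda>i. real (Suc i)) (1/2 + 1/2 * s5)"
    using Geo_poly_Suc[of 0 1 0 0 0 0 0 0 0] by simp
  have U2: "has_bochner_integral Geo (\<lambda>i. (real (Suc i))\<^sup>2) (5/2 + 1/2 * s5)"
    using Geo_poly_Suc[of 0 0 1 0 0 0 0 0 0] by simp
  note Z = Geo_table(2,3)
  have "has_bochner_integral Q (\<lambda>b. real (fst b) + real (snd b)) (1/2 + 1/2 * s5 + (- 1/2 + 1/2 * s5))"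
    by (intro has_bochner_integral_add Q_has_integral_fst Q_has_integral_snd U Z)
  then show "has_bochner_integral Q (\<lambda>b. real (bsize b)) s5" by (simp add: bsize_def)
  have "has_bochner_integral Q (\<lambda>b. (real (fst b))\<^sup>2 + 2 * (real (fst b) * real (snd b)) + (real (snd b))\<^sup>2)
     (5/2 + 1/2 * s5 + 2 * ((1/2 + 1/2 * s5) * (- 1/2 + 1/2 * s5)) + (5/2 - 1/2 * s5))"
    by (intro has_bochner_integral_add has_bochner_integral_mult_right Q_has_integral
      Q_has_integral_fst[where f = "\<lambda>u. (real u)\<^sup>2"] Q_has_integral_snd[where g = "\<lambda>u. (real u)\<^sup>2"] U U2 Z)
  moreover have "5/2 + 1/2 * s5 + 2 * ((1/2 + 1/2 * s5) * (- 1/2 + 1/2 * s5)) + (5/2 - 1/2 * s5) = 7"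
    by (simp add: algebra_simps s5)
  moreover have "(real (fst b))\<^sup>2 + 2 * (real (fst b) * real (snd b)) + (real (snd b))\<^sup>2 = (real (bsize b))\<^sup>2" for b
    by (simp add: bsize_def power2_eq_square algebra_simps)
  ultimately show "has_bochner_integral Q (\<lambda>b. (real (bsize b))\<^sup>2) 7" by simp
qed

text \<open>Moving the reference point by one changes the distance by one, up or down according to the side.
So mean distances follow from tail probabilities by induction.\<close>

lemma pmf_expectation_abs_diff_step:
  fixes X :: "'c \<Rightarrow> nat"
  assumes "integrable (measure_pmf p) (\<lambda>b. real (X b))"
  shows "measure_pmf.expectation p (\<lambda>b. \<bar>real (X b) - real (Suc u)\<bar>)
    = measure_pmf.expectation p (\<lambda>b. \<bar>real (X b) - real u\<bar>) + 1 - 2 * measure_pmf.prob p {b. u < X b}"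
proof -
  have i: "integrable (measure_pmf p) (\<lambda>b. \<bar>real (X b) - real u\<bar>)" for u
    by (intro integrable_abs Bochner_Integration.integrable_diff assms) simp
  have "\<bar>real (X b) - real (Suc u)\<bar> = \<bar>real (X b) - real u\<bar> + 1 - 2 * indicator {b. u < X b} b" for b
    by (auto simp: indicator_def)
  then have "measure_pmf.expectation p (\<lambda>b. \<bar>real (X b) - real (Suc u)\<bar>)
     = measure_pmf.expectation p (\<lambda>b. \<bar>real (X b) - real u\<bar> + 1 - 2 * indicator {b. u < X b} b)" by simp
  also have "\<dots> = measure_pmf.expectation p (\<lambda>b. \<bar>real (X b) - real u\<bar>) + 1 - 2 * measure_pmf.prob p {b. u < X b}"
    using i by (subst Bochner_Integration.integral_diff) (auto simp: measure_pmf.emeasure_eq_measure)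
  finally show ?thesis .
qed

lemma pmf_tail_step:
  fixes X :: "'c \<Rightarrow> nat"
  shows "measure_pmf.prob p {b. Suc u < X b} = measure_pmf.prob p {b. u < X b} - measure_pmf.prob p {b. X b = Suc u}"
proof -
  have "{b. u < X b} = {b. Suc u < X b} \<union> {b. X b = Suc u}" by auto
  moreover have "measure_pmf.prob p ({b. Suc u < X b} \<union> {b. X b = Suc u})
     = measure_pmf.prob p {b. Suc u < X b} + measure_pmf.prob p {b. X b = Suc u}"
    by (rule measure_pmf.finite_measure_Union) auto
  ultimately show ?thesis by simp
qed

lemma q_mult_q: "q * (q * y) = 3 * (q * y) - y"
  using q_square by (metis left_diff_distrib mult.assoc mult_1 power2_eq_square)

text \<open>The mean distance of a random column size from \<open>u\<close>, see \<open>EQ_abs_diff\<close>.\<close>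

definition pdist :: "nat \<Rightarrow> real" where
  "pdist u = real u - s5 + 2 * (q ^ u * (real u + s5))"

lemma Q_tail: "measure_pmf.prob Q {b. u < bsize b} = q ^ u * (1 + real u * (1 - q))"
proof (induction u)
  case 0
  have "measure_pmf.prob Q {b. 0 < bsize b} = 1"
    by (subst measure_pmf.prob_eq_1) (auto intro!: AE_Q)
  then show ?case by simp
next
  case (Suc u)
  have fin: "finite {b :: block. bsize b = Suc u}"
    by (rule finite_subset[of _ "{..Suc u} \<times> {..Suc u}"]) (auto simp: bsize_def)
  have "measure_pmf.prob Q {b. bsize b = Suc u} = (\<Sum>b\<in>{b. bsize b = Suc u}. pmf Q b)"
    using fin by (rule measure_measure_pmf_finite)
  also have "\<dots> = (\<Sum>b\<in>(\<lambda>z. (Suc u - z, z)) ` {..u}. q ^ Suc u)"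
  proof (rule sum.mono_neutral_cong_right[OF fin])
    show "(\<lambda>z. (Suc u - z, z)) ` {..u} \<subseteq> {b. bsize b = Suc u}" by (auto simp: bsize_def)
    show "\<forall>b\<in>{b. bsize b = Suc u} - (\<lambda>z. (Suc u - z, z)) ` {..u}. pmf Q b = 0"
    proof
      fix b assume b: "b \<in> {b. bsize b = Suc u} - (\<lambda>z. (Suc u - z, z)) ` {..u}"
      have "\<not> 1 \<le> fst b"
      proof
        assume "1 \<le> fst b"
        then have "b = (\<lambda>z. (Suc u - z, z)) (snd b)" "snd b \<in> {..u}" using b by (cases b; auto simp: bsize_def)+
        then show False using b by blast
      qed
      then show "pmf Q b = 0" by (simp add: pmf_Q)
    qed
    show "pmf Q b = q ^ Suc u" if "b \<in> (\<lambda>z. (Suc u - z, z)) ` {..u}" for b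
      using that by (auto simp: pmf_Q bsize_def)
  qed
  also have "\<dots> = real (Suc u) * q ^ Suc u"
    by (subst sum.reindex) (auto simp: inj_on_def)
  finally show ?case
    unfolding pmf_tail_step Suc by (simp add: algebra_simps q_mult_q)
qed

lemma q_s5: "s5 - q - q * s5 = 1"
  unfolding sqrt5_q using q_square by (simp add: algebra_simps power2_eq_square)

lemma EQ_abs_diff: "EQ (\<lambda>b. \<bar>real (bsize b) - real u\<bar>) = pdist u"
proof (induction u)
  case 0
  then show ?case using bsize_moments(1) by (simp add: has_bochner_integral_iff pdist_def)
next
  case (Suc u)
  have "integrable Q (\<lambda>b. real (bsize b))" using bsize_moments(1) by (simp add: has_bochner_integral_iff)
  note st = pmf_expectation_abs_diff_step[OF this, of u]
  have e: "pdist u + 1 - 2 * (q ^ u * (1 + real u * (1 - q))) = pdist (Suc u)"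
  proof -
    have "q ^ u * 1 = q ^ u * (s5 - q - q * s5)" by (simp only: q_s5)
    then show ?thesis by (simp add: pdist_def algebra_simps)
  qed
  show ?case unfolding st Suc Q_tail by (rule e)
qed

text \<open>The mean distance from \<open>w\<close> of a random \<open>u\<close>, see \<open>Geo_abs_diff\<close>.\<close>

definition rho :: "nat \<Rightarrow> real" where
  "rho w = real w - (1/2 + 1/2 * s5) + (1 + s5) * q ^ w"

lemma Geo_tail: "measure_pmf.prob Geo {i. u < Suc i} = q ^ u"
proof (induction u)
  case (Suc u)
  have "measure_pmf.prob Geo {i. Suc i = Suc u} = measure_pmf.prob Geo {u}" by simp
  also have "\<dots> = q ^ u * (1 - q)" using geo by (simp add: measure_pmf_single)
  finally show ?case unfolding pmf_tail_step Suc by (simp add: algebra_simps)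
qed simp

lemma Geo_abs_diff: "measure_pmf.expectation Geo (\<lambda>i. \<bar>real (Suc i) - real w\<bar>) = rho w"
proof (induction w)
  case 0
  have "has_bochner_integral Geo (\<lambda>i. real (Suc i)) (1/2 + 1/2 * s5)"
    using Geo_poly_Suc[of 0 1 0 0 0 0 0 0 0] by simp
  then show ?case by (simp add: has_bochner_integral_iff rho_def add_divide_distrib)
next
  case (Suc u)
  have "has_bochner_integral Geo (\<lambda>i. real (Suc i)) (1/2 + 1/2 * s5)"
    using Geo_poly_Suc[of 0 1 0 0 0 0 0 0 0] by simp
  then have "integrable Geo (\<lambda>i. real (Suc i))" by (simp add: has_bochner_integral_iff)
  note st = pmf_expectation_abs_diff_step[OF this, of u]
  have "(1 + s5) * (1 - q) / 2 = 1" using q_s5 by (simp add: algebra_simps)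
  then have "q ^ u * 1 = q ^ u * ((1 + s5) * (1 - q) / 2)" by (simp only:)
  then have "rho u + 1 - 2 * q ^ u = rho (Suc u)" by (simp add: rho_def algebra_simps)
  then show ?case unfolding st Suc Geo_tail .
qed

section \<open>Martingale increments and their variance\<close>

text \<open>The part of the increment that does not depend on the preceding block.\<close>

definition block_part :: "block \<Rightarrow> real" where
  "block_part b = real (snd b) + 2 - mu4 * real (bsize b) + pdist (fst b)"

text \<open>The contribution of a block \<open>b\<close> to perimeter minus \<open>mu4\<close> times area, after a block with first
component \<open>u0\<close>, is \<open>\<bar>bsize b - u0\<bar> + snd b + 2 - mu4 * bsize b\<close>. Its conditional mean is
\<open>pdist u0 - E (pdist u)\<close>. Subtracting \<open>pdist u0\<close> and adding \<open>pdist (fst b)\<close> changes sums only by a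
boundary term and makes the conditional mean vanish.\<close>

definition incr :: "nat \<Rightarrow> block \<Rightarrow> real" where
  "incr u0 b = \<bar>real (bsize b) - real u0\<bar> - pdist u0 + block_part b"

lemma alpha_eq: "alpha = (13/5 + s5/25) / 2"
  and beta_eq: "beta = mu3 + 2 - (13/5 + s5/25) * s5 / 2"
  and gamma_eq: "gamma = 229/50 + s5/25 - (13/5 + s5/25)\<^sup>2 / 2"
proof -
  have p: "0 < 229/50 + s5/25" by (simp add: add_pos_nonneg)
  then have S: "sigmaQ \<noteq> 0" "sigmaQ\<^sup>2 = 229/50 + s5/25" by (simp_all add: sigmaQ_def)
  have t: "sigma2 \<noteq> 0" "sigma2\<^sup>2 = 2" by (simp_all add: sigma2_def)
  let ?C = "13/5 + s5/25"
  have r: "rhoXQ * sigmaQ = ?C / sigma2" using S t by (simp add: rhoXQ_def)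
  have "alpha = (rhoXQ * sigmaQ) / sigma2" by (simp add: alpha_def mult.commute)
  also have "\<dots> = ?C / sigma2\<^sup>2" unfolding r by (simp add: power2_eq_square)
  finally show "alpha = ?C / 2" unfolding t .
  have "rhoXQ * mu2 * (sigmaQ / sigma2) = (rhoXQ * sigmaQ) * mu2 / sigma2" by simp
  also have "\<dots> = ?C * mu2 / sigma2\<^sup>2" unfolding r by (simp add: power2_eq_square)
  finally have "rhoXQ * mu2 * (sigmaQ / sigma2) = ?C * s5 / 2" unfolding t mu2_def .
  then show "beta = mu3 + 2 - ?C * s5 / 2" unfolding beta_def by simp
  have "gamma = sigmaQ\<^sup>2 - (rhoXQ * sigmaQ)\<^sup>2"
    by (simp add: gamma_def power_mult_distrib algebra_simps)
  also have "\<dots> = sigmaQ\<^sup>2 - ?C\<^sup>2 / sigma2\<^sup>2" unfolding r by (simp add: power_divide)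
  finally show "gamma = 229/50 + s5/25 - ?C\<^sup>2 / 2" unfolding t S .
qed

lemma mu4_eq: "mu4 = 6/5 + 6/25 * s5" "mu4 = mu1 * (mu3 + 2)"
  unfolding mu4_def alpha_eq beta_eq mu1_def mu3_def by (simp_all add: field_simps s5)

lemma sigma4_square: "sigma4\<^sup>2 = 17 * s5 / 50 - 19/125" "sigma4\<^sup>2 = gamma * mu1 + sigma1_sq * beta\<^sup>2"
proof -
  have e: "gamma * mu1 + sigma1_sq * beta\<^sup>2 = 17 * s5 / 50 - 19/125"
    unfolding gamma_eq beta_eq mu1_def sigma1_sq_def mu3_def by (simp add: power2_eq_square field_simps s5)
  have "0 \<le> 17 * s5 / 50 - 19/125" using s5_bounds by simp
  then show "sigma4\<^sup>2 = 17 * s5 / 50 - 19/125" "sigma4\<^sup>2 = gamma * mu1 + sigma1_sq * beta\<^sup>2"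
    unfolding sigma4_def e by simp_all
qed

lemma sigma4_pos: "0 < sigma4"
proof -
  have "0 < sigma4\<^sup>2" unfolding sigma4_square(1) using s5_bounds by simp
  moreover have "0 \<le> sigma4" unfolding sigma4_def
    using sigma4_square by (metis real_sqrt_ge_0_iff zero_le_power2)
  ultimately show ?thesis by (cases "sigma4 = 0") auto
qed

lemma block_part_split: "block_part b = (2 - s5 + (1 - mu4) * real (fst b) + 2 * s5 * q ^ fst b + 2 * (real (fst b) * q ^ fst b)) + (1 - mu4) * real (snd b)"
  by (simp add: block_part_def pdist_def bsize_def algebra_simps)

lemma Geo_linear:
  "has_bochner_integral Geo (\<lambda>i. a + m * real (Suc i) + 2 * s5 * q ^ Suc i + 2 * (real (Suc i) * q ^ Suc i))
    (a + m * (1/2 + 1/2 * s5) + 2 * s5 * (1/2 - 1/10 * s5) + 2 * (1/10 + 1/10 * s5))"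
  using Geo_poly_Suc[of a m 0 "2 * s5" 2 0 0 0 0] by simp

lemma Geo_linear_square:
  "has_bochner_integral Geo (\<lambda>i. (a + m * real (Suc i) + 2 * s5 * q ^ Suc i + 2 * (real (Suc i) * q ^ Suc i))\<^sup>2)
    (a * a + 2 * a * m * (1/2 + 1/2 * s5) + m * m * (5/2 + 1/2 * s5) + 4 * a * s5 * (1/2 - 1/10 * s5)
     + (4 * a + 4 * m * s5) * (1/10 + 1/10 * s5) + 4 * m * (3/10 + 3/50 * s5)
     + 20 * (3/8 - 1/8 * s5) + 8 * s5 * (1/32 + 1/32 * s5) + 4 * (5/64 + 1/64 * s5))"
proof -
  have "(a + m * u + 2 * s5 * y + 2 * (u * y))\<^sup>2 = a * a + 2 * a * m * u + m * m * u\<^sup>2 + 4 * a * s5 * y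
     + (4 * a + 4 * m * s5) * (u * y) + 4 * m * (u\<^sup>2 * y) + 20 * y\<^sup>2 + 8 * s5 * (u * y\<^sup>2) + 4 * (u\<^sup>2 * y\<^sup>2)" for u y :: real
    by (simp add: power2_eq_square algebra_simps s5)
  then show ?thesis
    using Geo_poly_Suc[of "a * a" "2 * a * m" "m * m" "4 * a * s5" "4 * a + 4 * m * s5" "4 * m" 20 "8 * s5" 4] by simp
qed

lemma EQ_block_part: "has_bochner_integral Q block_part 0"
proof -
  have "has_bochner_integral Q (\<lambda>b. (2 - s5 + (1 - mu4) * real (fst b) + 2 * s5 * q ^ fst b + 2 * (real (fst b) * q ^ fst b)) + (1 - mu4) * real (snd b))
   (2 - s5 + (1 - mu4) * (1/2 + 1/2 * s5) + 2 * s5 * (1/2 - 1/10 * s5) + 2 * (1/10 + 1/10 * s5) + (1 - mu4) * (- 1/2 + 1/2 * s5))"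
    by (intro has_bochner_integral_add Geo_linear has_bochner_integral_mult_right Geo_table
       Q_has_integral_snd[where g = real] Q_has_integral_fst[where f = "\<lambda>u. 2 - s5 + (1 - mu4) * real u + 2 * s5 * q ^ u + 2 * (real u * q ^ u)"])
  moreover have "2 - s5 + (1 - mu4) * (1/2 + 1/2 * s5) + 2 * s5 * (1/2 - 1/10 * s5) + 2 * (1/10 + 1/10 * s5) + (1 - mu4) * (- 1/2 + 1/2 * s5) = 0"
    unfolding mu4_eq(1) by (simp add: field_simps s5)
  ultimately show ?thesis unfolding block_part_split[abs_def, symmetric] by (simp add: block_part_split[symmetric])
qed

lemma EQ_block_part_square: "has_bochner_integral Q (\<lambda>b. (block_part b)\<^sup>2) (3981/2000 + 713/2000 * s5)"
proof -
  let ?m = "1 - mu4"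
  let ?F = "\<lambda>u. 2 - s5 + ?m * real u + 2 * s5 * q ^ u + 2 * (real u * q ^ u)"
  let ?f1 = "2 - s5 + ?m * (1/2 + 1/2 * s5) + 2 * s5 * (1/2 - 1/10 * s5) + 2 * (1/10 + 1/10 * s5)"
  let ?f2 = "(2 - s5) * (2 - s5) + 2 * (2 - s5) * ?m * (1/2 + 1/2 * s5) + ?m * ?m * (5/2 + 1/2 * s5) + 4 * (2 - s5) * s5 * (1/2 - 1/10 * s5)
     + (4 * (2 - s5) + 4 * ?m * s5) * (1/10 + 1/10 * s5) + 4 * ?m * (3/10 + 3/50 * s5)
     + 20 * (3/8 - 1/8 * s5) + 8 * s5 * (1/32 + 1/32 * s5) + 4 * (5/64 + 1/64 * s5)"
  have "has_bochner_integral Q (\<lambda>b. (?F (fst b))\<^sup>2 + 2 * ?m * (?F (fst b) * real (snd b)) + ?m * ?m * (real (snd b))\<^sup>2)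
    (?f2 + 2 * ?m * (?f1 * (- 1/2 + 1/2 * s5)) + ?m * ?m * (5/2 - 1/2 * s5))"
    by (intro has_bochner_integral_add has_bochner_integral_mult_right Geo_linear Geo_linear_square Geo_table
       Q_has_integral_snd[where g = "\<lambda>z. (real z)\<^sup>2"] Q_has_integral_fst[where f = "\<lambda>u. (?F u)\<^sup>2"] Q_has_integral[where f = ?F])
  moreover have "?f2 + 2 * ?m * (?f1 * (- 1/2 + 1/2 * s5)) + ?m * ?m * (5/2 - 1/2 * s5) = 3981/2000 + 713/2000 * s5"
    unfolding mu4_eq(1) by (simp add: field_simps s5)
  moreover have "(block_part b)\<^sup>2 = (?F (fst b))\<^sup>2 + 2 * ?m * (?F (fst b) * real (snd b)) + ?m * ?m * (real (snd b))\<^sup>2" for b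
    unfolding block_part_split by (simp add: power2_eq_square algebra_simps)
  ultimately show ?thesis by simp
qed

text \<open>Arises from exchanging the order of integration in the covariance of \<open>block_part\<close> and the
distance of the column size from the preceding \<open>u\<close>.\<close>

lemma EQ_block_part_rho: "has_bochner_integral Q (\<lambda>b. block_part b * rho (bsize b)) (- 507/500 - 57/250 * s5)"
proof -
  let ?m = "1 - mu4" and ?a = "2 - s5"
  let ?c = "1/2 + 1/2 * s5" and ?k = "1 + s5"
  let ?F = "\<lambda>u. ?a + ?m * real u + 2 * s5 * q ^ u + 2 * (real u * q ^ u)"
  let ?f1 = "?a + ?m * (1/2 + 1/2 * s5) + 2 * s5 * (1/2 - 1/10 * s5) + 2 * (1/10 + 1/10 * s5)"
  have Fu: "has_bochner_integral Geo (\<lambda>i. ?F (Suc i) * real (Suc i))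
     (?a * (1/2 + 1/2 * s5) + ?m * (5/2 + 1/2 * s5) + 2 * s5 * (1/10 + 1/10 * s5) + 2 * (3/10 + 3/50 * s5))"
    using Geo_poly_Suc[of 0 ?a ?m 0 "2 * s5" 2 0 0 0] by (simp add: power2_eq_square algebra_simps)
  have Fy: "has_bochner_integral Geo (\<lambda>i. ?F (Suc i) * q ^ Suc i)
     (?a * (1/2 - 1/10 * s5) + ?m * (1/10 + 1/10 * s5) + 2 * s5 * (3/8 - 1/8 * s5) + 2 * (1/32 + 1/32 * s5))"
    using Geo_poly_Suc[of 0 0 0 ?a ?m 0 "2 * s5" 2 0] by (simp add: power2_eq_square algebra_simps)
  have U: "has_bochner_integral Geo (\<lambda>i. real (Suc i)) (1/2 + 1/2 * s5)"
    using Geo_poly_Suc[of 0 1 0 0 0 0 0 0 0] by simp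
  have Y: "has_bochner_integral Geo (\<lambda>i. q ^ Suc i) (1/2 - 1/10 * s5)"
    using Geo_poly_Suc[of 0 0 0 1 0 0 0 0 0] by simp
  have one: "has_bochner_integral Geo (\<lambda>i. 1 :: real) 1" by (rule Geo_table)
  have "has_bochner_integral Q (\<lambda>b. (?F (fst b) * real (fst b)) * 1 + ?F (fst b) * real (snd b) + (- ?c) * (?F (fst b) * 1)
      + ?k * ((?F (fst b) * q ^ fst b) * q ^ snd b) + ?m * (real (fst b) * real (snd b)) + ?m * (1 * (real (snd b))\<^sup>2)
      + (- ?c * ?m) * (1 * real (snd b)) + (?k * ?m) * (q ^ fst b * (real (snd b) * q ^ snd b)))
    ((?a * (1/2 + 1/2 * s5) + ?m * (5/2 + 1/2 * s5) + 2 * s5 * (1/10 + 1/10 * s5) + 2 * (3/10 + 3/50 * s5)) * 1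
      + ?f1 * (- 1/2 + 1/2 * s5) + (- ?c) * (?f1 * 1)
      + ?k * ((?a * (1/2 - 1/10 * s5) + ?m * (1/10 + 1/10 * s5) + 2 * s5 * (3/8 - 1/8 * s5) + 2 * (1/32 + 1/32 * s5)) * (1/2 + 1/10 * s5))
      + ?m * ((1/2 + 1/2 * s5) * (- 1/2 + 1/2 * s5)) + ?m * (1 * (5/2 - 1/2 * s5))
      + (- ?c * ?m) * (1 * (- 1/2 + 1/2 * s5)) + (?k * ?m) * ((1/2 - 1/10 * s5) * (- 1/10 + 1/10 * s5)))"
    by (intro has_bochner_integral_add has_bochner_integral_mult_right
       Q_has_integral[where f = "\<lambda>u. ?F u * real u" and g = "\<lambda>_. 1", OF Fu one]
       Q_has_integral[where f = ?F and g = real, OF Geo_linear Geo_table(2)]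
       Q_has_integral[where f = ?F and g = "\<lambda>_. 1", OF Geo_linear one]
       Q_has_integral[where f = "\<lambda>u. ?F u * q ^ u" and g = "\<lambda>z. q ^ z", OF Fy Geo_table(4)]
       Q_has_integral[where f = real and g = real, OF U Geo_table(2)]
       Q_has_integral[where f = "\<lambda>_. 1" and g = "\<lambda>z. (real z)\<^sup>2", OF one Geo_table(3)]
       Q_has_integral[where f = "\<lambda>_. 1" and g = real, OF one Geo_table(2)]
       Q_has_integral[where f = "\<lambda>u. q ^ u" and g = "\<lambda>z. real z * q ^ z", OF Y Geo_table(5)])
  moreover have "(?a * (1/2 + 1/2 * s5) + ?m * (5/2 + 1/2 * s5) + 2 * s5 * (1/10 + 1/10 * s5) + 2 * (3/10 + 3/50 * s5)) * 1
      + ?f1 * (- 1/2 + 1/2 * s5) + (- ?c) * (?f1 * 1)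
      + ?k * ((?a * (1/2 - 1/10 * s5) + ?m * (1/10 + 1/10 * s5) + 2 * s5 * (3/8 - 1/8 * s5) + 2 * (1/32 + 1/32 * s5)) * (1/2 + 1/10 * s5))
      + ?m * ((1/2 + 1/2 * s5) * (- 1/2 + 1/2 * s5)) + ?m * (1 * (5/2 - 1/2 * s5))
      + (- ?c * ?m) * (1 * (- 1/2 + 1/2 * s5)) + (?k * ?m) * ((1/2 - 1/10 * s5) * (- 1/10 + 1/10 * s5)) = - 507/500 - 57/250 * s5"
    unfolding mu4_eq(1) by (simp add: field_simps s5)
  moreover have "(F * u) * 1 + F * z + (- ?c) * (F * 1) + ?k * ((F * y) * w) + m * (u * z) + m * (1 * z\<^sup>2)
      + (- ?c * m) * (1 * z) + (?k * m) * (y * (z * w)) = (F + m * z) * (u + z - ?c + ?k * (y * w))" for F u z y w m :: real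
    by (simp add: power2_eq_square field_simps)
  ultimately show ?thesis
    unfolding block_part_split rho_def bsize_def power_add of_nat_add by simp
qed

text \<open>\<open>pdist u - u\<close> lies between \<open>- sqrt 5\<close> and \<open>sqrt 5\<close>, because \<open>q ^ u * (u + sqrt 5)\<close> is largest for \<open>u = 0\<close>.\<close>

lemma pdist_bounds: "\<bar>pdist u - real u\<bar> \<le> 3" "0 \<le> pdist u"
proof -
  note s = s5_bounds
  have "1 + real u * (3/2) \<le> (1 + 3/2) ^ u" by (rule Bernoulli_inequality) simp
  then have 1: "1 + real u * (3/2) \<le> (5/2) ^ u" by simp
  have "(5/2) ^ u * q ^ u = (5/2 * q) ^ u" by (simp only: power_mult_distrib)
  also have "\<dots> \<le> 1" using q_bounds by (intro power_le_one) auto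
  finally have "(5/2) ^ u * q ^ u \<le> 1" .
  moreover have "(1 + real u * (3/2)) * q ^ u \<le> (5/2) ^ u * q ^ u"
    using 1 q_bounds by (intro mult_right_mono) auto
  ultimately have "(1 + real u * (3/2)) * q ^ u * s5 \<le> 1 * s5" using s by (intro mult_right_mono) auto
  moreover have "q ^ u * (real u + s5) \<le> (1 + real u * (3/2)) * q ^ u * s5"
  proof -
    have "real u * 1 \<le> real u * (3/2 * s5)" using s by (intro mult_left_mono) auto
    then have "real u + s5 \<le> (1 + real u * (3/2)) * s5" by (simp add: algebra_simps)
    then have "q ^ u * (real u + s5) \<le> q ^ u * ((1 + real u * (3/2)) * s5)" using q_bounds by (intro mult_left_mono) auto
    then show ?thesis by (simp add: mult_ac)
  qed
  ultimately have 2: "q ^ u * (real u + s5) \<le> s5" by linarith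
  have 3: "0 \<le> q ^ u * (real u + s5)" using q_bounds by simp
  show "\<bar>pdist u - real u\<bar> \<le> 3" using 2 3 s unfolding pdist_def by linarith
  show "0 \<le> pdist u" unfolding EQ_abs_diff[symmetric] by simp
qed

lemma mu4_bounds: "1 \<le> mu4" "mu4 < 2"
proof -
  show "1 \<le> mu4" "mu4 < 2" unfolding mu4_eq(1) using s5_bounds by simp_all
qed

lemma block_part_bound: "1 \<le> bsize b \<Longrightarrow> \<bar>block_part b\<bar> \<le> 7 * real (bsize b)"
proof -
  assume b: "1 \<le> bsize b"
  have m: "mu4 * real (bsize b) \<le> 2 * real (bsize b)" "0 \<le> mu4 * real (bsize b)"
    using mu4_bounds by (auto intro: mult_right_mono)
  have "real (fst b) + real (snd b) = real (bsize b)" by (simp add: bsize_def)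
  moreover have "pdist (fst b) \<le> real (fst b) + 3" using pdist_bounds(1)[of "fst b"] by linarith
  moreover have "1 \<le> real (bsize b)" using b by simp
  moreover note pdist_bounds(2)[of "fst b"] of_nat_0_le_iff[of "fst b", where 'a = real] of_nat_0_le_iff[of "snd b", where 'a = real]
  ultimately show ?thesis
    using m unfolding block_part_def by linarith
qed

text \<open>The bound does not depend on \<open>u0\<close>: the difference of \<open>\<bar>x - u0\<bar>\<close> and its mean is at most the size of the
column up to a constant. All later estimates are uniform in the past for this reason.\<close>

lemma incr_bound: "1 \<le> bsize b \<Longrightarrow> \<bar>incr u0 b\<bar> \<le> 11 * real (bsize b)"
proof -
  assume b: "1 \<le> bsize b"
  have "\<bar>\<bar>real (bsize b) - real u0\<bar> - pdist u0\<bar> \<le> real (bsize b) + 3"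
    using pdist_bounds[of u0] by linarith
  then show ?thesis using block_part_bound[OF b] b unfolding incr_def by linarith
qed

lemma integrable_Q_poly:
  fixes f :: "block \<Rightarrow> 'a::{banach,second_countable_topology}"
  assumes "0 \<le> C" "\<And>b. 1 \<le> fst b \<Longrightarrow> 1 \<le> bsize b \<Longrightarrow> norm (f b) \<le> C * real (bsize b) ^ 4"
  shows "integrable Q f"
proof (rule integrable_Q'[OF assms(1)])
  fix b :: block assume b: "1 \<le> fst b"
  have "real (bsize b) ^ 4 * 1 \<le> real (bsize b) ^ 4 * (3/2) ^ bsize b" by (intro mult_left_mono) auto
  then have "C * real (bsize b) ^ 4 \<le> C * (real (bsize b) ^ 4 * (3/2) ^ bsize b)" using assms(1) by (intro mult_left_mono) auto
  then show "norm (f b) \<le> C * (real (bsize b) ^ 4 * (3/2) ^ bsize b)"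
    using assms(2)[OF b] b by (simp add: bsize_def)
qed

lemma bsize_power_mono: "1 \<le> bsize b \<Longrightarrow> k \<le> l \<Longrightarrow> real (bsize b) ^ k \<le> real (bsize b) ^ l"
  by (intro power_increasing) auto

lemma integrable_incr: "integrable Q (incr u0)" "integrable Q (\<lambda>b. (incr u0 b)\<^sup>2)"
proof -
  show "integrable Q (incr u0)"
  proof (rule integrable_Q_poly[of 11])
    fix b :: block assume b: "1 \<le> bsize b"
    show "norm (incr u0 b) \<le> 11 * real (bsize b) ^ 4"
      using incr_bound[OF b, of u0] bsize_power_mono[OF b, of 1 4]
      unfolding power_one_right real_norm_def by linarith
  qed simp
  show "integrable Q (\<lambda>b. (incr u0 b)\<^sup>2)"
  proof (rule integrable_Q_poly[of 121])
    fix b :: block assume b: "1 \<le> bsize b"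
    have "\<bar>incr u0 b\<bar>\<^sup>2 \<le> (11 * real (bsize b))\<^sup>2"
      using incr_bound[OF b, of u0] by (intro power_mono) auto
    then show "norm ((incr u0 b)\<^sup>2) \<le> 121 * real (bsize b) ^ 4"
      using bsize_power_mono[OF b, of 2 4] by (simp add: power_mult_distrib)
  qed simp
qed

lemma integrable_bsize: "integrable Q (\<lambda>b. \<bar>real (bsize b) - real u\<bar>)" "integrable Q (\<lambda>b. (real (bsize b) - real u)\<^sup>2)"
proof -
  have i: "integrable Q (\<lambda>b. real (bsize b))" "integrable Q (\<lambda>b. (real (bsize b))\<^sup>2)"
    using bsize_moments by (auto simp: has_bochner_integral_iff)
  then show "integrable Q (\<lambda>b. \<bar>real (bsize b) - real u\<bar>)" by auto
  have "integrable Q (\<lambda>b. (real (bsize b))\<^sup>2 - 2 * real u * real (bsize b) + (real u)\<^sup>2)" using i by auto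
  then show "integrable Q (\<lambda>b. (real (bsize b) - real u)\<^sup>2)"
    by (simp add: power2_eq_square algebra_simps)
qed

lemma EQ_incr: "EQ (incr u0) = 0"
proof -
  have "EQ (incr u0) = EQ (\<lambda>b. \<bar>real (bsize b) - real u0\<bar> - pdist u0 + block_part b)"
    by (simp add: incr_def[abs_def])
  also have "\<dots> = 0"
    using EQ_block_part integrable_bsize[of u0] EQ_abs_diff[of u0] by (simp add: has_bochner_integral_iff)
  finally show ?thesis .
qed

definition var_incr :: "nat \<Rightarrow> real" where "var_incr u0 = EQ (\<lambda>b. (incr u0 b)\<^sup>2)"

definition mean_var :: real where "mean_var = 17/10 - 19/125 * s5"

lemma integrable_cross: "integrable Q (\<lambda>b. \<bar>real (bsize b) - real u\<bar> * block_part b)"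
proof (rule integrable_Q_poly[of "7 * (1 + real u)"])
  fix b :: block assume b: "1 \<le> bsize b"
  have "\<bar>real (bsize b) - real u\<bar> \<le> (1 + real u) * real (bsize b)"
  proof -
    have "real u * 1 \<le> real u * real (bsize b)" using b by (intro mult_left_mono) auto
    then show ?thesis unfolding distrib_right by linarith
  qed
  then have "\<bar>real (bsize b) - real u\<bar> * \<bar>block_part b\<bar> \<le> ((1 + real u) * real (bsize b)) * (7 * real (bsize b))"
    using block_part_bound[OF b] by (intro mult_mono) auto
  also have "\<dots> = 7 * (1 + real u) * real (bsize b) ^ 2" by (simp add: power2_eq_square)
  also have "\<dots> \<le> 7 * (1 + real u) * real (bsize b) ^ 4"
    using bsize_power_mono[OF b, of 2 4] by (intro mult_left_mono) auto
  finally show "norm (\<bar>real (bsize b) - real u\<bar> * block_part b) \<le> 7 * (1 + real u) * real (bsize b) ^ 4"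
    by (simp add: abs_mult)
qed simp

text \<open>In the square of \<open>\<bar>x - u0\<bar> - pdist u0 + block_part b\<close> the two mixed terms with \<open>pdist u0\<close> are known, since
the mean distance is \<open>pdist u0\<close> and the mean of \<open>block_part\<close> is \<open>0\<close>.\<close>

lemma var_incr_eq:
  "var_incr u0 = 7 - 2 * s5 * real u0 + (real u0)\<^sup>2 - (pdist u0)\<^sup>2 + (3981/2000 + 713/2000 * s5)
     + 2 * EQ (\<lambda>b. \<bar>real (bsize b) - real u0\<bar> * block_part b)"
proof -
  let ?a = "\<lambda>b. \<bar>real (bsize b) - real u0\<bar>"
  note i = integrable_bsize[of u0] integrable_cross[of u0]
  have "has_bochner_integral Q (\<lambda>b. (real (bsize b))\<^sup>2 + (- 2 * real u0) * real (bsize b) + (real u0)\<^sup>2) (7 + (- 2 * real u0) * s5 + (real u0)\<^sup>2)"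
    using bsize_moments by (intro has_bochner_integral_add has_bochner_integral_mult_right) (auto simp: has_bochner_integral_iff)
  then have a2: "EQ (\<lambda>b. (?a b)\<^sup>2) = 7 + (- 2 * real u0) * s5 + (real u0)\<^sup>2"
    by (simp add: has_bochner_integral_iff power2_eq_square algebra_simps)
  have e: "(incr u0 b)\<^sup>2 = (?a b)\<^sup>2 + (pdist u0)\<^sup>2 + (block_part b)\<^sup>2 - 2 * pdist u0 * ?a b + 2 * (?a b * block_part b) - 2 * pdist u0 * block_part b" for b
    unfolding incr_def by (simp add: power2_eq_square algebra_simps del: abs_mult_self_eq)
  have "var_incr u0 = EQ (\<lambda>b. (?a b)\<^sup>2) + (pdist u0)\<^sup>2 + EQ (\<lambda>b. (block_part b)\<^sup>2) - 2 * pdist u0 * EQ ?a + 2 * EQ (\<lambda>b. ?a b * block_part b) - 2 * pdist u0 * EQ block_part"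
    unfolding var_incr_def e using i EQ_block_part EQ_block_part_square by (simp add: has_bochner_integral_iff)
  then show ?thesis
    unfolding a2 EQ_abs_diff using EQ_block_part EQ_block_part_square by (simp add: has_bochner_integral_iff power2_eq_square)
qed

text \<open>Fubini's theorem: averaging over the preceding \<open>u\<close> first replaces the distance by \<open>rho\<close>, which leaves
sums of products of one-variable moments.\<close>

lemma EQ_cross_swap:
  "has_bochner_integral Geo (\<lambda>k. EQ (\<lambda>b. \<bar>real (bsize b) - real (Suc k)\<bar> * block_part b)) (- 507/500 - 57/250 * s5)"
proof -
  let ?f = "\<lambda>(b, k). \<bar>real (bsize b) - real (Suc k)\<bar> * block_part b"
  have x: "has_bochner_integral Q (\<lambda>b. real (bsize b) * \<bar>block_part b\<bar>) (EQ (\<lambda>b. real (bsize b) * \<bar>block_part b\<bar>))"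
    "has_bochner_integral Q (\<lambda>b. \<bar>block_part b\<bar>) (EQ (\<lambda>b. \<bar>block_part b\<bar>))"
    using integrable_abs[OF integrable_cross[of 0]] EQ_block_part by (auto simp: has_bochner_integral_iff abs_mult)
  have U: "has_bochner_integral Geo (\<lambda>i. real (Suc i)) (1/2 + 1/2 * s5)"
    using Geo_poly_Suc[of 0 1 0 0 0 0 0 0 0] by simp
  have "integrable (pair_pmf Q Geo) (\<lambda>p. (case p of (b, k) \<Rightarrow> (real (bsize b) * \<bar>block_part b\<bar>) * 1) + (case p of (b, k) \<Rightarrow> \<bar>block_part b\<bar> * real (Suc k)))"
    using pair_pmf_has_integral[OF x(1) Geo_table(1)] pair_pmf_has_integral[OF x(2) U]
    by (auto simp: has_bochner_integral_iff intro!: Bochner_Integration.integrable_add)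
  then have int: "integrable (pair_pmf Q Geo) ?f"
  proof (rule Bochner_Integration.integrable_bound)
    show "AE p in pair_pmf Q Geo. norm (?f p) \<le> norm ((case p of (b, k) \<Rightarrow> (real (bsize b) * \<bar>block_part b\<bar>) * 1) + (case p of (b, k) \<Rightarrow> \<bar>block_part b\<bar> * real (Suc k)))"
    proof (rule AE_pmfI)
      fix p :: "block \<times> nat"
      obtain b k where p: "p = (b, k)" by (cases p)
      have "\<bar>real (bsize b) - real (Suc k)\<bar> * \<bar>block_part b\<bar> \<le> (real (bsize b) + real (Suc k)) * \<bar>block_part b\<bar>"
        by (intro mult_right_mono) auto
      also have "\<dots> = (real (bsize b) * \<bar>block_part b\<bar>) * 1 + \<bar>block_part b\<bar> * real (Suc k)" by (simp add: algebra_simps)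
      finally show "norm (?f p) \<le> norm ((case p of (b, k) \<Rightarrow> (real (bsize b) * \<bar>block_part b\<bar>) * 1) + (case p of (b, k) \<Rightarrow> \<bar>block_part b\<bar> * real (Suc k)))"
        unfolding p prod.case real_norm_def abs_mult by (simp only: abs_abs)
    qed
  qed simp
  have "measure_pmf.expectation (pair_pmf Q Geo) ?f = EQ (\<lambda>b. block_part b * rho (bsize b))"
    unfolding pair_pmf_Fubini(1)[OF int]
    by (rule arg_cong[where f = "\<lambda>f. EQ f"]) (simp add: fun_eq_iff Geo_abs_diff[symmetric] abs_minus_commute mult.commute)
  then have v: "measure_pmf.expectation Geo (\<lambda>k. EQ (\<lambda>b. \<bar>real (bsize b) - real (Suc k)\<bar> * block_part b)) = - 507/500 - 57/250 * s5"
    using EQ_block_part_rho unfolding pair_pmf_Fubini(2)[OF int] by (simp add: has_bochner_integral_iff)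
  interpret pair_sigma_finite "measure_pmf Q" "measure_pmf Geo" ..
  have "integrable Geo (\<lambda>k. EQ (\<lambda>b. \<bar>real (bsize b) - real (Suc k)\<bar> * block_part b))"
    using integrable_snd[of "\<lambda>b k. \<bar>real (bsize b) - real (Suc k)\<bar> * block_part b"] int
    unfolding measure_pair_pmf by simp
  then show ?thesis using v by (simp add: has_bochner_integral_iff)
qed

text \<open>The stationary mean of the conditional variance; the preceding \<open>u\<close> has the law of \<open>fst b\<close>.\<close>

lemma EQ_var_incr: "has_bochner_integral Q (\<lambda>b. var_incr (fst b)) mean_var"
proof (rule Q_has_integral_fst)
  have U: "has_bochner_integral Geo (\<lambda>i. 7 + (-2 * s5) * real (Suc i) + (real (Suc i))\<^sup>2) (7 + (-2 * s5) * (1/2 + 1/2 * s5) + (5/2 + 1/2 * s5))"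
    using Geo_poly_Suc[of 7 "-2 * s5" 1 0 0 0 0 0 0] by simp
  have p: "has_bochner_integral Geo (\<lambda>i. (pdist (Suc i))\<^sup>2) (221/80 - 179/400 * s5)"
  proof -
    have "pdist u = - s5 + 1 * real u + 2 * s5 * q ^ u + 2 * (real u * q ^ u)" for u by (simp add: pdist_def algebra_simps)
    moreover have "(- s5) * (- s5) + 2 * (- s5) * 1 * (1/2 + 1/2 * s5) + 1 * 1 * (5/2 + 1/2 * s5) + 4 * (- s5) * s5 * (1/2 - 1/10 * s5)
     + (4 * (- s5) + 4 * 1 * s5) * (1/10 + 1/10 * s5) + 4 * 1 * (3/10 + 3/50 * s5)
     + 20 * (3/8 - 1/8 * s5) + 8 * s5 * (1/32 + 1/32 * s5) + 4 * (5/64 + 1/64 * s5) = 221/80 - 179/400 * s5"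
      by (simp add: field_simps s5)
    ultimately show ?thesis using Geo_linear_square[of "- s5" 1] by simp
  qed
  have "has_bochner_integral Geo (\<lambda>i. 7 + (-2 * s5) * real (Suc i) + (real (Suc i))\<^sup>2 + (-1) * (pdist (Suc i))\<^sup>2 + (3981/2000 + 713/2000 * s5) * 1
     + 2 * EQ (\<lambda>b. \<bar>real (bsize b) - real (Suc i)\<bar> * block_part b))
     (7 + (-2 * s5) * (1/2 + 1/2 * s5) + (5/2 + 1/2 * s5) + (-1) * (221/80 - 179/400 * s5) + (3981/2000 + 713/2000 * s5) * 1 + 2 * (- 507/500 - 57/250 * s5))"
    by (intro has_bochner_integral_add has_bochner_integral_mult_right U p EQ_cross_swap Geo_table(1))
  moreover have "7 + (-2 * s5) * (1/2 + 1/2 * s5) + (5/2 + 1/2 * s5) + (-1) * (221/80 - 179/400 * s5) + (3981/2000 + 713/2000 * s5) * 1 + 2 * (- 507/500 - 57/250 * s5) = mean_var"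
    unfolding mean_var_def by (simp add: field_simps s5)
  ultimately show "has_bochner_integral Geo (\<lambda>i. var_incr (Suc i)) mean_var"
    unfolding var_incr_eq by simp
qed

lemma mean_var_eq: "mean_var = s5 * sigma4\<^sup>2"
  unfolding mean_var_def sigma4_square(1) by (simp add: field_simps s5)

lemma var_incr_bounds: "0 \<le> var_incr u" "var_incr u \<le> 847"
proof -
  show "0 \<le> var_incr u" unfolding var_incr_def by simp
  have i: "integrable Q (\<lambda>b. 121 * (real (bsize b))\<^sup>2)" "EQ (\<lambda>b. 121 * (real (bsize b))\<^sup>2) = 847"
    using bsize_moments(2) by (auto simp: has_bochner_integral_iff)
  have "var_incr u \<le> EQ (\<lambda>b. 121 * (real (bsize b))\<^sup>2)"
    unfolding var_incr_def
  proof (rule integral_mono_AE[OF integrable_incr(2) i(1)], rule AE_Q)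
    fix b :: block assume b: "1 \<le> bsize b"
    have "\<bar>incr u b\<bar>\<^sup>2 \<le> (11 * real (bsize b))\<^sup>2"
      using incr_bound[OF b, of u] by (intro power_mono) auto
    then show "(incr u b)\<^sup>2 \<le> 121 * (real (bsize b))\<^sup>2" by (simp add: power_mult_distrib)
  qed
  then show "var_incr u \<le> 847" unfolding i .
qed

section \<open>The walk in area time and its Markov property\<close>

text \<open>The sum of the increments of all blocks that start before area \<open>s\<close>. The block that straddles \<open>s\<close> is
included, so that the summation stops at a stopping time.\<close>

fun walk :: "nat \<Rightarrow> block list \<Rightarrow> nat \<Rightarrow> real" where
  "walk u0 [] s = 0"
| "walk u0 (b # L) s = (if s = 0 then 0 else incr u0 b + walk (fst b) L (s - bsize b))"

text \<open>The state after the blocks that start before area \<open>s\<close> consists of the first component of the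
last block, the remaining word, and the area by which these blocks exceed \<open>s\<close>.\<close>

fun cut_u :: "nat \<Rightarrow> block list \<Rightarrow> nat \<Rightarrow> nat" where
  "cut_u u0 [] s = u0"
| "cut_u u0 (b # L) s = (if s = 0 then u0 else cut_u (fst b) L (s - bsize b))"

fun cut_rest :: "block list \<Rightarrow> nat \<Rightarrow> block list" where
  "cut_rest [] s = []"
| "cut_rest (b # L) s = (if s = 0 then b # L else cut_rest L (s - bsize b))"

fun cut_over :: "block list \<Rightarrow> nat \<Rightarrow> nat" where
  "cut_over [] s = 0"
| "cut_over (b # L) s = (if s = 0 then 0 else if s \<le> bsize b then bsize b - s else cut_over L (s - bsize b))"

lemma at_0 [simp]: "walk u0 L 0 = 0" "cut_u u0 L 0 = u0" "cut_rest L 0 = L" "cut_over L 0 = 0"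
  by (cases L; simp)+

lemma walk_add: "walk u0 L (s + t) = walk u0 L s + walk (cut_u u0 L s) (cut_rest L s) (t - cut_over L s)"
proof (induction L arbitrary: u0 s)
  case (Cons b L)
  show ?case
  proof (cases "s < bsize b")
    case True
    then have "s + t - bsize b = t - (bsize b - s)" by simp
    then show ?thesis using True by (cases "s = 0") auto
  next
    case False
    then have "s + t - bsize b = (s - bsize b) + t" by simp
    then show ?thesis using False Cons[of "fst b" "s - bsize b"] by (cases "s = bsize b") auto
  qed
qed simp

lemma cut_over_le: "r < cut_over L s \<Longrightarrow> \<exists>b\<in>set L. r < bsize b"
proof (induction L arbitrary: s)
  case (Cons b L)
  then show ?case by (auto split: if_splits)
qed simp

text \<open>The Markov property: given the blocks before the cut, the remaining word is uniform. It is obtained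
from the one-step equation by induction on the area.\<close>

lemma avg_cut:
  fixes f :: "real \<Rightarrow> nat \<Rightarrow> nat \<Rightarrow> block list \<Rightarrow> 'a::{banach,second_countable_topology}"
  assumes "s \<le> n"
  shows "avg n (\<lambda>L. f (walk u0 L s) (cut_u u0 L s) (cut_over L s) (cut_rest L s))
    = avg n (\<lambda>L. avg (n - s - cut_over L s) (f (walk u0 L s) (cut_u u0 L s) (cut_over L s)))"
  using assms
proof (induction s arbitrary: n u0 f rule: less_induct)
  case (less s)
  show ?case
  proof (cases "s = 0")
    case True
    then show ?thesis by (simp add: avg_const)
  next
    case False
    have n: "0 < n" using False less.prems by simp
    have "dens n b *\<^sub>R avg (n - bsize b) (\<lambda>L. f (walk u0 (b # L) s) (cut_u u0 (b # L) s) (cut_over (b # L) s) (cut_rest (b # L) s))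
       = dens n b *\<^sub>R avg (n - bsize b) (\<lambda>L. avg (n - s - cut_over (b # L) s) (f (walk u0 (b # L) s) (cut_u u0 (b # L) s) (cut_over (b # L) s)))" for b
    proof (cases "b \<in> first_blocks n")
      case True
      note b = first_blocksD[OF True]
      show ?thesis
      proof (cases "s \<le> bsize b")
        case True
        then show ?thesis using False b by (simp add: avg_const)
      next
        case s: False
        have "avg (n - bsize b) (\<lambda>L. f (incr u0 b + walk (fst b) L (s - bsize b)) (cut_u (fst b) L (s - bsize b)) (cut_over L (s - bsize b)) (cut_rest L (s - bsize b)))
          = avg (n - bsize b) (\<lambda>L. avg (n - bsize b - (s - bsize b) - cut_over L (s - bsize b))
              (f (incr u0 b + walk (fst b) L (s - bsize b)) (cut_u (fst b) L (s - bsize b)) (cut_over L (s - bsize b))))"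
          using less.IH[of "s - bsize b" "n - bsize b" "\<lambda>m. f (incr u0 b + m)" "fst b"] b s less.prems by simp
        moreover have "n - bsize b - (s - bsize b) = n - s" using s by simp
        ultimately show ?thesis using False s by simp
      qed
    next
      case False
      then show ?thesis by (simp add: dens_def)
    qed
    then show ?thesis by (simp only: avg_rec[OF n])
  qed
qed

section \<open>Large blocks and the maximal inequality\<close>

lemma integrable_Q_dens:
  fixes f :: "block \<Rightarrow> 'a::{banach,second_countable_topology}"
  shows "integrable Q (\<lambda>b. dens n b *\<^sub>R f b)"
proof (rule Bochner_Integration.integrable_bound)
  let ?B = "Max ((\<lambda>b. 4 * norm (f b)) ` insert (0,0) (first_blocks n))"
  show "integrable Q (\<lambda>b. ?B)" by simp
  show "AE b in Q. norm (dens n b *\<^sub>R f b) \<le> norm ?B"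
  proof (rule AE_pmfI)
    fix b
    show "norm (dens n b *\<^sub>R f b) \<le> norm ?B"
    proof (cases "b \<in> first_blocks n")
      case True
      have "norm (dens n b *\<^sub>R f b) \<le> 4 * norm (f b)" using dens_bounds by (simp add: mult_right_mono)
      also have "\<dots> \<le> ?B" using True by (intro Max_ge) (auto simp: finite_first_blocks)
      finally show ?thesis by simp
    next
      case False
      then show ?thesis by (simp add: dens_def)
    qed
  qed
qed simp

lemma integrable_bsize4: "integrable Q (\<lambda>b. real (bsize b) ^ 4)"
  by (rule integrable_Q_poly[of 1]) auto

text \<open>Every block removes at least one cell, and its mean fourth power is at most four times the
unconditioned one, since \<open>dens\<close> is at most \<open>4\<close>.\<close>

lemma avg_sum_bsize4: "avg n (\<lambda>L. \<Sum>b\<leftarrow>L. real (bsize b) ^ 4) \<le> 4 * EQ (\<lambda>b. real (bsize b) ^ 4) * real n"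
proof (induction n rule: less_induct)
  case (less n)
  let ?m = "EQ (\<lambda>b. real (bsize b) ^ 4)"
  let ?S = "\<lambda>L. \<Sum>b\<leftarrow>L. real (bsize b) ^ 4"
  have m: "0 \<le> ?m" by simp
  show ?case
  proof (cases "n = 0")
    case False
    then have n: "0 < n" by simp
    have "avg n ?S = EQ (\<lambda>b. dens n b *\<^sub>R avg (n - bsize b) (\<lambda>L. ?S (b # L)))" by (rule avg_rec[OF n])
    also have "\<dots> \<le> EQ (\<lambda>b. 4 * real (bsize b) ^ 4 + dens n b *\<^sub>R (4 * ?m * real (n - 1)))"
    proof (rule integral_mono_AE[OF integrable_Q_dens])
      show "integrable Q (\<lambda>b. 4 * real (bsize b) ^ 4 + dens n b *\<^sub>R (4 * ?m * real (n - 1)))"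
        using integrable_bsize4 by (intro Bochner_Integration.integrable_add integrable_Q_dens) auto
      show "AE b in Q. dens n b *\<^sub>R avg (n - bsize b) (\<lambda>L. ?S (b # L)) \<le> 4 * real (bsize b) ^ 4 + dens n b *\<^sub>R (4 * ?m * real (n - 1))"
      proof (rule AE_Q)
        fix b :: block assume b: "1 \<le> bsize b"
        have "avg (n - bsize b) ?S \<le> 4 * ?m * real (n - bsize b)" using less[of "n - bsize b"] b n by simp
        also have "\<dots> \<le> 4 * ?m * real (n - 1)" using m b by (intro mult_left_mono) auto
        finally have "dens n b * avg (n - bsize b) ?S \<le> dens n b * (4 * ?m * real (n - 1))" using dens_bounds by (intro mult_left_mono) auto
        moreover have "dens n b * real (bsize b) ^ 4 \<le> 4 * real (bsize b) ^ 4" using dens_bounds by (intro mult_right_mono) auto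
        ultimately show "dens n b *\<^sub>R avg (n - bsize b) (\<lambda>L. ?S (b # L)) \<le> 4 * real (bsize b) ^ 4 + dens n b *\<^sub>R (4 * ?m * real (n - 1))"
          by (simp add: avg_add avg_const distrib_left)
      qed
    qed
    also have "\<dots> = 4 * ?m + 4 * ?m * real (n - 1)"
      using integrable_bsize4 EQ_dens[OF n] integrable_Q_dens[of n "\<lambda>_. 1::real"] by (simp add: mult.commute)
    also have "\<dots> = 4 * ?m * real n" using n by (simp add: algebra_simps of_nat_diff)
    finally show ?thesis .
  qed (simp add: avg_0)
qed

lemma avg_large_block:
  obtains C where "0 \<le> C" "\<And>n r. 0 < r \<Longrightarrow> avg n (\<lambda>L. of_bool (\<exists>b\<in>set L. r < real (bsize b))) \<le> C * real n / r ^ 4"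
proof (rule that[of "4 * EQ (\<lambda>b. real (bsize b) ^ 4)"])
  fix n :: nat and r :: real assume r: "0 < r"
  let ?S = "\<lambda>L. \<Sum>b\<leftarrow>L. real (bsize b) ^ 4"
  have "of_bool (\<exists>b\<in>set L. r < real (bsize b)) \<le> (1 / r ^ 4) * ?S L" for L :: "block list"
  proof (cases "\<exists>b\<in>set L. r < real (bsize b)")
    case True
    then obtain b where b: "b \<in> set L" "r < real (bsize b)" by blast
    have "r ^ 4 \<le> real (bsize b) ^ 4" using b r by (intro power_mono) auto
    also have "\<dots> \<le> ?S L" using b by (intro member_le_sum_list) auto
    finally show ?thesis using True r by (simp add: le_divide_eq)
  next
    case False
    have "0 \<le> ?S L" by (intro sum_list_nonneg) auto
    then show ?thesis using False r by simp
  qed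
  then have "avg n (\<lambda>L. of_bool (\<exists>b\<in>set L. r < real (bsize b))) \<le> avg n (\<lambda>L. (1 / r ^ 4) * ?S L)" by (intro avg_mono)
  also have "\<dots> = (1 / r ^ 4) * avg n ?S" by (rule avg_mult)
  also have "\<dots> \<le> (1 / r ^ 4) * (4 * EQ (\<lambda>b. real (bsize b) ^ 4) * real n)"
    using avg_sum_bsize4 r by (intro mult_left_mono) auto
  finally show "avg n (\<lambda>L. of_bool (\<exists>b\<in>set L. r < real (bsize b))) \<le> 4 * EQ (\<lambda>b. real (bsize b) ^ 4) * real n / r ^ 4" by simp
qed simp

lemma exp_quadratic_bound: "exp y \<le> 1 + y + y\<^sup>2 * exp \<bar>y\<bar>" for y :: real
proof -
  obtain t where t: "\<bar>t\<bar> \<le> \<bar>y\<bar>" "exp y = (\<Sum>m<2. y ^ m / fact m) + (exp t / fact 2) * y ^ 2"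
    using Maclaurin_exp_le[of y 2] by auto
  have "exp t \<le> exp \<bar>y\<bar>" using t(1) by simp
  then have "exp t * y\<^sup>2 \<le> exp \<bar>y\<bar> * y\<^sup>2" by (intro mult_right_mono) auto
  moreover have "0 \<le> exp \<bar>y\<bar> * y\<^sup>2" by simp
  moreover have "exp y = 1 + y + (exp t * y\<^sup>2) / 2" using t(2) by (simp add: numeral_2_eq_2)
  moreover have "y\<^sup>2 * exp \<bar>y\<bar> = exp \<bar>y\<bar> * y\<^sup>2" by simp
  ultimately show ?thesis by linarith
qed

text \<open>The first-order term vanishes because the increments are centred; this leaves a bound quadratic in
\<open>\<theta>\<close>, as for sub-Gaussian variables near the origin.\<close>

lemma exp_incr_moment:
  obtains C where "0 \<le> C" "\<And>\<theta> u0. \<bar>\<theta>\<bar> \<le> 1/44 \<Longrightarrow> integrable Q (\<lambda>b. exp (\<theta> * incr u0 b))"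
    "\<And>\<theta> u0. \<bar>\<theta>\<bar> \<le> 1/44 \<Longrightarrow> EQ (\<lambda>b. exp (\<theta> * incr u0 b)) \<le> exp (C * \<theta>\<^sup>2)"
proof (rule that[of "121 * EQ (\<lambda>b. real (bsize b) ^ 2 * (3/2) ^ bsize b)"])
  let ?W = "\<lambda>b. real (bsize b) ^ 2 * (3/2) ^ bsize b"
  have iW: "integrable Q ?W"
  proof (rule integrable_Q'[of 1])
    fix b :: block assume "1 \<le> fst b"
    then have "real (bsize b) ^ 2 \<le> real (bsize b) ^ 4" by (intro bsize_power_mono) (auto simp: bsize_def)
    then show "norm (?W b) \<le> 1 * (real (bsize b) ^ 4 * (3/2) ^ bsize b)" by (simp add: mult_right_mono)
  qed simp
  show "0 \<le> 121 * EQ ?W" by (auto intro!: integral_nonneg_AE)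
  fix \<theta> :: real and u0 assume th: "\<bar>\<theta>\<bar> \<le> 1/44"
  \<comment> \<open>Since \<open>\<bar>incr\<bar> \<le> 11 * bsize\<close>, the exponent is at most a quarter of the size.\<close>
  have e14: "exp (1/4 :: real) \<le> 3/2" using exp_bound[of "1/4"] by (simp add: power2_eq_square)
  have bd: "exp \<bar>\<theta> * incr u0 b\<bar> \<le> (3/2) ^ bsize b" "(\<theta> * incr u0 b)\<^sup>2 \<le> 121 * \<theta>\<^sup>2 * real (bsize b) ^ 2" if b: "1 \<le> bsize b" for b
  proof -
    have i: "\<bar>incr u0 b\<bar> \<le> 11 * real (bsize b)" by (rule incr_bound[OF b])
    have "\<bar>\<theta> * incr u0 b\<bar> \<le> 1/44 * (11 * real (bsize b))"
      unfolding abs_mult using th i by (intro mult_mono) auto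
    then have "exp \<bar>\<theta> * incr u0 b\<bar> \<le> exp (real (bsize b) * (1/4))" by simp
    also have "\<dots> = exp (1/4) ^ bsize b" by (rule exp_of_nat_mult)
    also have "\<dots> \<le> (3/2) ^ bsize b" using e14 by (intro power_mono) auto
    finally show "exp \<bar>\<theta> * incr u0 b\<bar> \<le> (3/2) ^ bsize b" .
    have "\<bar>incr u0 b\<bar>\<^sup>2 \<le> (11 * real (bsize b))\<^sup>2" using i by (intro power_mono) auto
    then have "\<theta>\<^sup>2 * (incr u0 b)\<^sup>2 \<le> \<theta>\<^sup>2 * (11 * real (bsize b))\<^sup>2" by (intro mult_left_mono) auto
    then show "(\<theta> * incr u0 b)\<^sup>2 \<le> 121 * \<theta>\<^sup>2 * real (bsize b) ^ 2" by (simp add: power_mult_distrib)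
  qed
  show int: "integrable Q (\<lambda>b. exp (\<theta> * incr u0 b))"
  proof (rule integrable_Q'[of 1])
    fix b :: block assume "1 \<le> fst b"
    then have b: "1 \<le> bsize b" by (simp add: bsize_def)
    have "exp (\<theta> * incr u0 b) \<le> exp \<bar>\<theta> * incr u0 b\<bar>" by simp
    also have "\<dots> \<le> 1 * (3/2) ^ bsize b" using bd(1)[OF b] by simp
    also have "\<dots> \<le> real (bsize b) ^ 4 * (3/2) ^ bsize b" using bsize_power_mono[OF b, of 0 4] by (intro mult_right_mono) auto
    finally show "norm (exp (\<theta> * incr u0 b)) \<le> 1 * (real (bsize b) ^ 4 * (3/2) ^ bsize b)" by simp
  qed simp
  have "EQ (\<lambda>b. exp (\<theta> * incr u0 b)) \<le> EQ (\<lambda>b. 1 + \<theta> * incr u0 b + 121 * \<theta>\<^sup>2 * ?W b)"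
  proof (rule integral_mono_AE[OF int])
    show "integrable Q (\<lambda>b. 1 + \<theta> * incr u0 b + 121 * \<theta>\<^sup>2 * ?W b)"
      using integrable_incr iW by (intro Bochner_Integration.integrable_add integrable_mult_right) auto
    show "AE b in Q. exp (\<theta> * incr u0 b) \<le> 1 + \<theta> * incr u0 b + 121 * \<theta>\<^sup>2 * ?W b"
    proof (rule AE_Q)
      fix b :: block assume b: "1 \<le> bsize b"
      have "(\<theta> * incr u0 b)\<^sup>2 * exp \<bar>\<theta> * incr u0 b\<bar> \<le> (121 * \<theta>\<^sup>2 * real (bsize b) ^ 2) * (3/2) ^ bsize b"
        using bd[OF b] by (intro mult_mono) auto
      then show "exp (\<theta> * incr u0 b) \<le> 1 + \<theta> * incr u0 b + 121 * \<theta>\<^sup>2 * ?W b"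
        using exp_quadratic_bound[of "\<theta> * incr u0 b"] by (simp add: mult.assoc)
    qed
  qed
  also have "\<dots> = 1 + \<theta> * EQ (incr u0) + 121 * \<theta>\<^sup>2 * EQ ?W"
    using integrable_incr iW by simp
  also have "\<dots> = 1 + 121 * EQ ?W * \<theta>\<^sup>2"
    using EQ_incr[of u0] by simp
  also have "\<dots> \<le> exp (121 * EQ ?W * \<theta>\<^sup>2)" by (rule exp_ge_add_one_self)
  finally show "EQ (\<lambda>b. exp (\<theta> * incr u0 b)) \<le> exp (121 * EQ ?W * \<theta>\<^sup>2)" .
qed

text \<open>The function \<open>exp (C * \<theta>\<^sup>2 * a) * (exp (\<theta> * x) + exp (- \<theta> * x)) / exp (\<theta> * l)\<close>, divided by
\<open>renewal n\<close>, is at least \<open>1\<close> once the walk from \<open>x\<close> is outside \<open>(- l, l)\<close> and does not increase in mean in a step,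
because every block uses up at least one unit of \<open>a\<close>. The factor \<open>renewal n\<close> removes the conditioning exactly;
it lies between \<open>1/4\<close> and \<open>1\<close>.\<close>

lemma maximal_inequality:
  obtains C where "0 \<le> C"
    "\<And>\<theta> n a u0 l. 0 \<le> \<theta> \<Longrightarrow> \<theta> \<le> 1/44 \<Longrightarrow>
      avg n (\<lambda>L. of_bool (\<exists>s\<le>a. l \<le> \<bar>walk u0 L s\<bar>)) \<le> 8 * exp (C * \<theta>\<^sup>2 * real a - \<theta> * l)"
proof -
  obtain C where C: "0 \<le> C" "\<And>\<theta> u0. \<bar>\<theta>\<bar> \<le> 1/44 \<Longrightarrow> integrable Q (\<lambda>b. exp (\<theta> * incr u0 b))"
    "\<And>\<theta> u0. \<bar>\<theta>\<bar> \<le> 1/44 \<Longrightarrow> EQ (\<lambda>b. exp (\<theta> * incr u0 b)) \<le> exp (C * \<theta>\<^sup>2)"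
    using exp_incr_moment by blast
  show thesis
  proof (rule that[OF C(1)])
    fix \<theta> l :: real and n a u0
    assume th: "0 \<le> \<theta>" "\<theta> \<le> 1/44"
    let ?V = "\<lambda>a x. exp (C * \<theta>\<^sup>2 * real a - \<theta> * l) * (exp (\<theta> * x) + exp (- \<theta> * x))"
    have "renewal n * avg n (\<lambda>L. of_bool (\<exists>s\<le>a. l \<le> \<bar>x + walk u0 L s\<bar>)) \<le> ?V a x" for x
    proof (induction n arbitrary: a u0 x rule: less_induct)
      case (less n)
      have renewal: "0 \<le> renewal n" "renewal n \<le> 1" for n using renewal_lower[of n] renewal_upper[of n] by auto
      have V0: "0 \<le> ?V a x" for a x by (intro mult_nonneg_nonneg add_nonneg_nonneg) auto
      show ?case
      proof (cases "l \<le> \<bar>x\<bar>")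
        case True
        have "avg n (\<lambda>L. of_bool (\<exists>s\<le>a. l \<le> \<bar>x + walk u0 L s\<bar>)) \<le> avg n (\<lambda>_. 1 :: real)" by (intro avg_mono) auto
        then have "renewal n * avg n (\<lambda>L. of_bool (\<exists>s\<le>a. l \<le> \<bar>x + walk u0 L s\<bar>)) \<le> renewal n * 1"
          using renewal(1) by (intro mult_left_mono) (auto simp: avg_const)
        also have "\<dots> \<le> 1" using renewal by simp
        also have "1 \<le> ?V a x"
        proof -
          have "\<theta> * l \<le> \<theta> * \<bar>x\<bar>" using True th by (intro mult_left_mono)
          moreover have "0 \<le> C * \<theta>\<^sup>2 * real a" using C(1) by simp
          ultimately have "1 \<le> exp (C * \<theta>\<^sup>2 * real a - \<theta> * l + \<theta> * \<bar>x\<bar>)" by simp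
          also have "\<dots> = exp (C * \<theta>\<^sup>2 * real a - \<theta> * l) * exp (\<theta> * \<bar>x\<bar>)" by (rule exp_add)
          also have "\<dots> \<le> ?V a x" by (intro mult_left_mono) (auto simp: abs_if)
          finally show ?thesis .
        qed
        finally show ?thesis .
      next
        case x: False
        show ?thesis
        proof (cases "n = 0 \<or> a = 0")
          case True
          then have "\<not> (\<exists>s\<le>a. l \<le> \<bar>x + walk u0 L s\<bar>)" if "L \<in> words n" for L
            using x that by (auto simp: words_0)
          then have "avg n (\<lambda>L. of_bool (\<exists>s\<le>a. l \<le> \<bar>x + walk u0 L s\<bar>)) = avg n (\<lambda>_. 0 :: real)"
            by (intro avg_cong) auto
          then show ?thesis using V0 by (simp add: avg_const)
        next
          case False
          then have n: "0 < n" and a: "0 < a" by auto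
          let ?P = "\<lambda>b L. of_bool (\<exists>s\<le>a. l \<le> \<bar>x + walk u0 (b # L) s\<bar>) :: real"
          \<comment> \<open>The first block has size at least \<open>1\<close>; the factor lost in \<open>?K\<close> pays for its exponential moment.\<close>
          let ?K = "exp (C * \<theta>\<^sup>2 * real (a - 1) - \<theta> * l)"
          have i1: "integrable Q (\<lambda>b. exp (\<theta> * incr u0 b))" "integrable Q (\<lambda>b. exp (- \<theta> * incr u0 b))"
            using C(2)[of \<theta> u0] C(2)[of "- \<theta>" u0] th by auto
          have i2: "integrable Q (\<lambda>b. ?K * (exp (\<theta> * x) * exp (\<theta> * incr u0 b) + exp (- \<theta> * x) * exp (- \<theta> * incr u0 b)))"
            using i1 by auto
          have "renewal n * avg n (\<lambda>L. of_bool (\<exists>s\<le>a. l \<le> \<bar>x + walk u0 L s\<bar>)) = renewal n * EQ (\<lambda>b. dens n b *\<^sub>R avg (n - bsize b) (?P b))"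
            by (subst avg_rec[OF n]) (rule refl)
          also have "\<dots> = EQ (\<lambda>b. renewal n * (dens n b *\<^sub>R avg (n - bsize b) (?P b)))"
            by simp
          also have "\<dots> \<le> EQ (\<lambda>b. ?K * (exp (\<theta> * x) * exp (\<theta> * incr u0 b) + exp (- \<theta> * x) * exp (- \<theta> * incr u0 b)))"
          proof (rule integral_mono_AE[OF _ i2])
            show "integrable Q (\<lambda>b. renewal n * (dens n b *\<^sub>R avg (n - bsize b) (?P b)))"
              using integrable_Q_dens by (intro integrable_mult_right)
            show "AE b in Q. renewal n * (dens n b *\<^sub>R avg (n - bsize b) (?P b)) \<le> ?K * (exp (\<theta> * x) * exp (\<theta> * incr u0 b) + exp (- \<theta> * x) * exp (- \<theta> * incr u0 b))"
            proof (rule AE_Q)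
              fix b :: block assume b: "1 \<le> bsize b"
              have r0: "0 \<le> ?K * (exp (\<theta> * x) * exp (\<theta> * incr u0 b) + exp (- \<theta> * x) * exp (- \<theta> * incr u0 b))"
                by (intro mult_nonneg_nonneg add_nonneg_nonneg) auto
              show "renewal n * (dens n b *\<^sub>R avg (n - bsize b) (?P b)) \<le> ?K * (exp (\<theta> * x) * exp (\<theta> * incr u0 b) + exp (- \<theta> * x) * exp (- \<theta> * incr u0 b))"
              proof (cases "b \<in> first_blocks n")
                case True
                have "renewal n * (dens n b *\<^sub>R avg (n - bsize b) (?P b)) = renewal (n - bsize b) * avg (n - bsize b) (?P b)"
                  using True renewal_lower[of n] by (simp add: dens_def)
                also have "\<dots> \<le> renewal (n - bsize b) * avg (n - bsize b) (\<lambda>L. of_bool (\<exists>s\<le>a - bsize b. l \<le> \<bar>(x + incr u0 b) + walk (fst b) L s\<bar>))"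
                proof (intro mult_left_mono[OF _ renewal(1)] avg_mono)
                  fix L
                  have "\<exists>s\<le>a - bsize b. l \<le> \<bar>(x + incr u0 b) + walk (fst b) L s\<bar>" if ex: "\<exists>s\<le>a. l \<le> \<bar>x + walk u0 (b # L) s\<bar>"
                  proof -
                    obtain s where s: "s \<le> a" "l \<le> \<bar>x + walk u0 (b # L) s\<bar>" using ex by blast
                    have "s \<noteq> 0" using s(2) x by (cases "s = 0") auto
                    then show ?thesis using s by (intro exI[of _ "s - bsize b"]) (auto simp: add.assoc)
                  qed
                  then show "?P b L \<le> of_bool (\<exists>s\<le>a - bsize b. l \<le> \<bar>(x + incr u0 b) + walk (fst b) L s\<bar>)" by (simp add: of_bool_def)
                qed
                also have "\<dots> \<le> ?V (a - bsize b) (x + incr u0 b)"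
                  using less.IH[of "n - bsize b"] b n by simp
                also have "\<dots> \<le> ?K * (exp (\<theta> * (x + incr u0 b)) + exp (- \<theta> * (x + incr u0 b)))"
                proof (intro mult_right_mono)
                  have "C * \<theta>\<^sup>2 * real (a - bsize b) \<le> C * \<theta>\<^sup>2 * real (a - 1)" using C(1) b by (intro mult_left_mono) auto
                  then show "exp (C * \<theta>\<^sup>2 * real (a - bsize b) - \<theta> * l) \<le> ?K" by simp
                qed (simp add: add_nonneg_nonneg)
                also have "\<dots> = ?K * (exp (\<theta> * x) * exp (\<theta> * incr u0 b) + exp (- \<theta> * x) * exp (- \<theta> * incr u0 b))"
                  by (simp only: exp_add[symmetric] distrib_left)
                finally show ?thesis .
              next
                case False
                then show ?thesis using r0 by (simp add: dens_def)
              qed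
            qed
          qed
          also have "\<dots> = ?K * (exp (\<theta> * x) * EQ (\<lambda>b. exp (\<theta> * incr u0 b)) + exp (- \<theta> * x) * EQ (\<lambda>b. exp (- \<theta> * incr u0 b)))"
            using i1 by simp
          also have "\<dots> \<le> ?K * (exp (\<theta> * x) * exp (C * \<theta>\<^sup>2) + exp (- \<theta> * x) * exp (C * \<theta>\<^sup>2))"
            using C(3)[of \<theta> u0] C(3)[of "- \<theta>" u0] th by (intro mult_left_mono add_mono) auto
          also have "\<dots> = (?K * exp (C * \<theta>\<^sup>2)) * (exp (\<theta> * x) + exp (- \<theta> * x))" by (simp add: algebra_simps)
          also have "?K * exp (C * \<theta>\<^sup>2) = exp (C * \<theta>\<^sup>2 * real a - \<theta> * l)"
            unfolding exp_add[symmetric] using a by (simp add: algebra_simps of_nat_diff)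
          finally show ?thesis .
        qed
      qed
    qed
    from this[of 0] have 1: "renewal n * avg n (\<lambda>L. of_bool (\<exists>s\<le>a. l \<le> \<bar>walk u0 L s\<bar>)) \<le> exp (C * \<theta>\<^sup>2 * real a - \<theta> * l) * 2"
      by simp
    have "0 \<le> avg n (\<lambda>L. of_bool (\<exists>s\<le>a. l \<le> \<bar>walk u0 L s\<bar>) :: real)"
      using avg_mono[of n "\<lambda>_. 0" "\<lambda>L. of_bool (\<exists>s\<le>a. l \<le> \<bar>walk u0 L s\<bar>)"] by (simp add: avg_const)
    then have "1/4 * avg n (\<lambda>L. of_bool (\<exists>s\<le>a. l \<le> \<bar>walk u0 L s\<bar>)) \<le> renewal n * avg n (\<lambda>L. of_bool (\<exists>s\<le>a. l \<le> \<bar>walk u0 L s\<bar>))"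
      using renewal_lower[of n] by (intro mult_right_mono) auto
    then show "avg n (\<lambda>L. of_bool (\<exists>s\<le>a. l \<le> \<bar>walk u0 L s\<bar>)) \<le> 8 * exp (C * \<theta>\<^sup>2 * real a - \<theta> * l)"
      using 1 by linarith
  qed
qed

section \<open>The characteristic function of the walk\<close>

text \<open>Half the variance per unit of area, so that \<open>exp (- kappa * \<theta>\<^sup>2 * s)\<close> is the Gaussian characteristic function.\<close>

definition kappa :: real where "kappa = sigma4\<^sup>2 / 2"

lemma kappa_facts: "0 < kappa" "kappa \<le> 1" "2 * (kappa * s5) = mean_var"
proof -
  show "0 < kappa" using sigma4_pos by (simp add: kappa_def)
  show "kappa \<le> 1" using s5_bounds by (simp add: kappa_def sigma4_square(1))
  show "2 * (kappa * s5) = mean_var" unfolding mean_var_eq by (simp add: kappa_def)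
qed

lemma norm_iexp_Taylor2: "cmod (iexp y - (1 + \<i> * y - y\<^sup>2 / 2)) \<le> \<bar>y\<bar> ^ 3 / 6"
proof -
  have "(\<Sum>k\<le>2. (\<i> * y) ^ k / fact k) = 1 + \<i> * y - y\<^sup>2 / 2"
    by (simp add: numeral_2_eq_2 power2_eq_square algebra_simps mult.assoc[symmetric, of \<i> \<i>])
  then show ?thesis using iexp_approx1[of y 2] by (simp add: eval_nat_numeral)
qed

lemma norm_iexp_Taylor0: "cmod (iexp y - 1) \<le> \<bar>y\<bar>"
  using iexp_approx1[of y 0] by simp

lemma factor_1: "p - p * r * t = p * (1 - r * t)" for p r t :: real
  by (simp add: right_diff_distrib mult.assoc)

lemma factor_2: "p - p * r = p * (1 - r)" for p r :: real
  by (simp add: right_diff_distrib)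

text \<open>The time argument is truncated at \<open>0\<close>, as in the one-step equation. Without truncation
the error is quadratic, because \<open>1 - exp (- y) * (1 + y) \<le> y\<^sup>2\<close>.\<close>

lemma exp_time_step:
  fixes k :: real
  assumes "0 \<le> k"
  shows "\<bar>exp (- (k * real (s - x))) - exp (- (k * real s)) * (1 + k * real x)\<bar> \<le> (k * real x)\<^sup>2 + of_bool (s < x) * (2 * (k * real x))"
    "\<bar>exp (- (k * real (s - x))) - exp (- (k * real s))\<bar> \<le> k * real x"
proof -
  have kx: "0 \<le> k * real x" "0 \<le> k * real s" using assms by auto
  have e1: "1 - exp (- y) \<le> y" for y :: real using exp_ge_add_one_self[of "-y"] by linarith
  have main: "\<bar>exp (- (k * real (s - x))) - exp (- (k * real s)) * (1 + k * real x)\<bar> \<le> (k * real x)\<^sup>2 + of_bool (s < x) * (2 * (k * real x))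
    \<and> \<bar>exp (- (k * real (s - x))) - exp (- (k * real s))\<bar> \<le> k * real x"
  proof (cases "s < x")
    case True
    have "real s \<le> real x" using True by simp
    then have t: "k * real s \<le> k * real x" using assms by (intro mult_left_mono)
    have a: "0 \<le> exp (- (k * real s))" "exp (- (k * real s)) \<le> 1" using kx by auto
    have "exp (- (k * real s)) * (k * real x) \<le> 1 * (k * real x)" "0 \<le> exp (- (k * real s)) * (k * real x)"
      using a kx mult_right_mono[OF a(2) kx(1)] by auto
    moreover have "0 \<le> (k * real x)\<^sup>2" by simp
    ultimately have "\<bar>1 - exp (- (k * real s)) * (1 + k * real x)\<bar> \<le> (k * real x)\<^sup>2 + 2 * (k * real x)"
      "\<bar>1 - exp (- (k * real s))\<bar> \<le> k * real x"
      using t a e1[of "k * real s"] kx unfolding distrib_left mult_1_right by linarith+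
    then show ?thesis using True by simp
  next
    case False
    define y where "y = k * real x"
    define w where "w = exp (- (k * real (s - x)))"
    have y: "0 \<le> y" using kx by (simp add: y_def)
    have w: "0 \<le> w" "w \<le> 1" using assms by (auto simp: w_def)
    have "- (k * real s) = - (k * real (s - x)) + - y"
      using False by (simp add: y_def of_nat_diff algebra_simps)
    then have a: "exp (- (k * real s)) = w * exp (- y)" by (simp only: exp_add w_def)
    have i1: "1 - y \<le> exp (- y)" using exp_ge_add_one_self[of "-y"] by linarith
    have "(1 + y) * exp (- y) \<le> exp y * exp (- y)" using exp_ge_add_one_self[of y] by (intro mult_right_mono) auto
    then have i2: "exp (- y) * (1 + y) \<le> 1" by (simp add: exp_minus_inverse mult.commute)
    have "(1 - y) * (1 + y) \<le> exp (- y) * (1 + y)" using i1 y by (intro mult_right_mono) auto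
    then have i3: "1 - exp (- y) * (1 + y) \<le> y\<^sup>2" by (simp add: power2_eq_square algebra_simps)
    have "w * (1 - exp (- y) * (1 + y)) \<le> 1 * y\<^sup>2" using w i2 i3 by (intro mult_mono) auto
    moreover have "0 \<le> w * (1 - exp (- y) * (1 + y))" using w i2 by simp
    ultimately have 1: "\<bar>w - w * exp (- y) * (1 + y)\<bar> \<le> y\<^sup>2"
      unfolding factor_1 by (simp only: abs_of_nonneg mult_1)
    have "w * (1 - exp (- y)) \<le> 1 * y" using w y e1[of y] by (intro mult_mono) auto
    moreover have "0 \<le> w * (1 - exp (- y))" using w y by simp
    ultimately have 2: "\<bar>w - w * exp (- y)\<bar> \<le> y"
      unfolding factor_2 by (simp only: abs_of_nonneg mult_1)
    from 1 2
    show ?thesis unfolding a w_def[symmetric] y_def[symmetric] using False by simp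
  qed
  show "\<bar>exp (- (k * real (s - x))) - exp (- (k * real s)) * (1 + k * real x)\<bar> \<le> (k * real x)\<^sup>2 + of_bool (s < x) * (2 * (k * real x))"
    "\<bar>exp (- (k * real (s - x))) - exp (- (k * real s))\<bar> \<le> k * real x"
    using main by auto
qed

lemma norm_mult_le: "norm (a * b) \<le> A * B" if "norm a \<le> A" "norm b \<le> B" for a b :: complex
proof -
  have "0 \<le> A" using norm_ge_zero[of a] that(1) by linarith
  then show ?thesis using that by (simp add: norm_mult mult_mono)
qed

text \<open>Here \<open>X\<close> is the size of the block, \<open>d\<close> the increment, \<open>k\<close> the centred variance in the new state, \<open>a\<close> and
\<open>w\<close> the time factors before and after the step, \<open>y\<close> the relative change of the time factor, and
\<open>e\<close> indicates a step beyond the end of the window. The product of the three factors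
is \<open>1\<close> plus the sum of their deviations from \<open>1\<close>, up to mixed terms, which are of third order in \<open>th\<close>.\<close>

lemma step_expansion:
  fixes th d k y w a X :: real and e :: real
  assumes th: "\<bar>th\<bar> \<le> 1" and d: "\<bar>d\<bar> \<le> 11 * X" and k: "\<bar>k\<bar> \<le> 850" and X: "1 \<le> X"
    and y: "0 \<le> y" "y \<le> th\<^sup>2 * X" and w: "\<bar>w\<bar> \<le> 1" and a: "\<bar>a\<bar> \<le> 1"
    and e: "0 \<le> e" and w1: "\<bar>w - a * (1 + y)\<bar> \<le> y\<^sup>2 + e * (2 * y)" and w2: "\<bar>w - a\<bar> \<le> y"
  shows "cmod (iexp (th * d) * (w * (1 - th\<^sup>2 / 2 * k)) - a * (1 + \<i> * (th * d) - (th * d)\<^sup>2 / 2 + y - th\<^sup>2 / 2 * k))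
      \<le> 200000 * (\<bar>th\<bar> ^ 3 * X ^ 4 + \<bar>th\<bar> * e * X ^ 3)"
    and "cmod (iexp (th * d) * (w * (1 - th\<^sup>2 / 2 * k)) - a) \<le> 6000 * \<bar>th\<bar> * X"
proof -
  let ?t = "\<bar>th\<bar>"
  define g where "g = th\<^sup>2 / 2 * k"
  define p where "p = \<i> * (th * d) - (th * d)\<^sup>2 / 2"
  define eE where "eE = iexp (th * d) - (1 + p)"
  define eW where "eW = w - a * (1 + y)"
  have t2: "th\<^sup>2 = ?t * ?t" by (simp add: power2_eq_square)
  have t: "0 \<le> ?t" "?t \<le> 1" using th by auto
  have td: "\<bar>th * d\<bar> \<le> ?t * (11 * X)" unfolding abs_mult using d by (intro mult_left_mono) auto
  have XX: "1 \<le> X ^ 2" "X \<le> X ^ 2" "X ^ 2 \<le> X ^ 3" "X ^ 3 \<le> X ^ 4" "X ^ 2 \<le> X ^ 4" "X \<le> X ^ 4" "X \<le> X ^ 3" "0 \<le> X"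
    using X power_increasing[of 1 2 X] power_increasing[of 2 3 X] power_increasing[of 3 4 X] power_increasing[of 2 4 X]
      power_increasing[of 1 4 X] power_increasing[of 1 3 X] power_increasing[of 0 2 X] by auto
  have tt: "?t * ?t \<le> ?t" "?t ^ 3 \<le> ?t * ?t" "?t ^ 4 \<le> ?t ^ 3" "?t ^ 5 \<le> ?t ^ 3" "?t * ?t \<le> 1" "0 \<le> ?t ^ 3"
    using t power_decreasing[of 1 2 ?t] power_decreasing[of 2 3 ?t] power_decreasing[of 3 4 ?t] power_decreasing[of 3 5 ?t] power_decreasing[of 0 2 ?t]
    by (auto simp: power2_eq_square)
  have g: "\<bar>g\<bar> \<le> 425 * (?t * ?t)"
  proof -
    have "(?t * ?t) / 2 * \<bar>k\<bar> \<le> (?t * ?t) / 2 * 850" using k t by (intro mult_left_mono) auto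
    moreover have "\<bar>g\<bar> = (?t * ?t) / 2 * \<bar>k\<bar>" by (simp add: g_def t2 abs_mult)
    ultimately show ?thesis by simp
  qed
  have g1: "\<bar>1 - g\<bar> \<le> 426" using g tt by linarith
  have pb: "cmod p \<le> 72 * ?t * X ^ 2"
  proof -
    have "cmod p \<le> cmod (\<i> * (th * d)) + cmod ((th * d)\<^sup>2 / 2)" unfolding p_def by (rule norm_triangle_ineq4)
    also have "\<dots> = \<bar>th * d\<bar> + \<bar>th * d\<bar>\<^sup>2 / 2" by (simp add: norm_mult norm_divide norm_power abs_mult power_mult_distrib)
    also have "\<dots> \<le> ?t * (11 * X) + (?t * (11 * X))\<^sup>2 / 2" using td by (intro add_mono divide_right_mono power_mono) auto
    also have "\<dots> = 11 * (?t * X) + 121/2 * ((?t * ?t) * X ^ 2)" by (simp add: power2_eq_square)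
    also have "\<dots> \<le> 11 * (?t * X ^ 2) + 121/2 * (?t * X ^ 2)"
      using tt t XX by (intro add_mono mult_left_mono mult_right_mono) auto
    also have "\<dots> \<le> 72 * (?t * X ^ 2)" using t XX by simp
    finally show ?thesis by simp
  qed
  have p1: "cmod (1 + p) \<le> 73 * X ^ 2"
  proof -
    have "?t * X ^ 2 \<le> 1 * X ^ 2" using t XX by (intro mult_right_mono) auto
    then show ?thesis using norm_triangle_ineq[of 1 p] pb XX by simp
  qed
  have eEb: "cmod eE \<le> 222 * (?t ^ 3 * X ^ 3)"
  proof -
    have "eE = iexp (th * d) - (1 + \<i> * (th * d) - (th * d)\<^sup>2 / 2)"
      by (simp add: eE_def p_def)
    then have "cmod eE \<le> \<bar>th * d\<bar> ^ 3 / 6"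
      using norm_iexp_Taylor2[of "th * d"] by simp
    also have "\<dots> \<le> (?t * (11 * X)) ^ 3 / 6" using td by (intro divide_right_mono power_mono) auto
    also have "\<dots> = 1331/6 * (?t ^ 3 * X ^ 3)" by (simp add: power_mult_distrib)
    also have "\<dots> \<le> 222 * (?t ^ 3 * X ^ 3)" using t XX by (intro mult_right_mono) auto
    finally show ?thesis .
  qed
  have yb: "y \<le> ?t * ?t * X" using y t2 by simp
  have eWb: "\<bar>eW\<bar> \<le> ?t ^ 4 * X ^ 2 + e * (2 * (?t * ?t * X))"
  proof -
    have "y\<^sup>2 \<le> (?t * ?t * X)\<^sup>2" using yb y by (intro power_mono) auto
    also have "\<dots> = ?t ^ 4 * X ^ 2" by (simp add: power_mult_distrib power2_eq_square power4_eq_xxxx)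
    finally have "y\<^sup>2 \<le> ?t ^ 4 * X ^ 2" .
    moreover have "e * (2 * y) \<le> e * (2 * (?t * ?t * X))" using yb e by (intro mult_left_mono) auto
    ultimately show ?thesis using w1 unfolding eW_def by linarith
  qed
  let ?R = "?t ^ 3 * X ^ 4" and ?S = "?t * e * X ^ 3"
  have R0: "0 \<le> ?R" "0 \<le> ?S" using t XX e by auto
  have G: "cmod (of_real (1 - g)) \<le> 426" using g1 by (simp only: norm_of_real)
  have A: "cmod (of_real a) \<le> 1" and W: "cmod (of_real w) \<le> 1" using a w by auto
  have T1: "cmod (eE * (w * (1 - g))) \<le> 94572 * ?R"
  proof -
    have "cmod (of_real w * of_real (1 - g)) \<le> 1 * 426" by (rule norm_mult_le[OF W G])
    then have "cmod (eE * (of_real w * of_real (1 - g))) \<le> (222 * (?t ^ 3 * X ^ 3)) * (1 * 426)" by (rule norm_mult_le[OF eEb])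
    also have "\<dots> \<le> 94572 * ?R" using XX(4) tt(6) by (simp add: mult_left_mono)
    finally show ?thesis by simp
  qed
  have T2: "cmod ((1 + p) * (eW * (1 - g))) \<le> 31098 * ?R + 62196 * ?S"
  proof -
    have "cmod (of_real eW) \<le> ?t ^ 4 * X ^ 2 + e * (2 * (?t * ?t * X))" using eWb by simp
    from norm_mult_le[OF p1 norm_mult_le[OF this G]]
    have "cmod ((1 + p) * (of_real eW * of_real (1 - g))) \<le> (73 * X ^ 2) * ((?t ^ 4 * X ^ 2 + e * (2 * (?t * ?t * X))) * 426)" .
    also have "\<dots> = 31098 * (?t ^ 4 * X ^ 4) + 62196 * ((?t * ?t) * e * X ^ 3)" by (simp add: algebra_simps eval_nat_numeral)
    also have "\<dots> \<le> 31098 * ?R + 62196 * ?S"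
      using tt XX e by (intro add_mono mult_left_mono mult_right_mono) auto
    finally show ?thesis by simp
  qed
  have T3: "cmod (a * (p * y)) \<le> 72 * ?R"
  proof -
    have "cmod (of_real y) \<le> ?t * ?t * X" using yb y by simp
    from norm_mult_le[OF A norm_mult_le[OF pb this]]
    have "cmod (of_real a * (p * of_real y)) \<le> 1 * ((72 * ?t * X ^ 2) * (?t * ?t * X))" .
    also have "\<dots> = 72 * (?t ^ 3 * X ^ 3)" by (simp add: eval_nat_numeral)
    also have "\<dots> \<le> 72 * ?R" using XX(4) tt(6) by (simp add: mult_left_mono)
    finally show ?thesis .
  qed
  have T4: "cmod (a * (p * g)) \<le> 30600 * ?R"
  proof -
    have "cmod (of_real g) \<le> 425 * (?t * ?t)" using g by simp
    from norm_mult_le[OF A norm_mult_le[OF pb this]]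
    have "cmod (of_real a * (p * of_real g)) \<le> 1 * ((72 * ?t * X ^ 2) * (425 * (?t * ?t)))" .
    also have "\<dots> = 30600 * (?t ^ 3 * X ^ 2)" by (simp add: eval_nat_numeral)
    also have "\<dots> \<le> 30600 * ?R" using XX(5) tt(6) by (simp add: mult_left_mono)
    finally show ?thesis .
  qed
  have T5: "cmod (a * ((1 + p) * (y * g))) \<le> 31025 * ?R"
  proof -
    have "cmod (of_real g) \<le> 425 * (?t * ?t)" "cmod (of_real y) \<le> ?t * ?t * X" using g yb y by auto
    from norm_mult_le[OF A norm_mult_le[OF p1 norm_mult_le[OF this(2,1)]]]
    have "cmod (of_real a * ((1 + p) * (of_real y * of_real g))) \<le> 1 * ((73 * X ^ 2) * (?t * ?t * X * (425 * (?t * ?t))))" .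
    also have "\<dots> = 31025 * (?t ^ 4 * X ^ 3)" by (simp add: eval_nat_numeral)
    also have "\<dots> \<le> 31025 * ?R" using XX tt t by (intro mult_left_mono mult_mono) auto
    finally show ?thesis by simp
  qed
  have "iexp (th * d) = 1 + p + eE" by (simp add: eE_def)
  moreover have "of_real w = of_real a * (1 + of_real y) + (of_real eW :: complex)" by (simp add: eW_def)
  ultimately have "iexp (th * d) * (w * (1 - g)) - a * (1 + p + y - g)
     = eE * (w * (1 - g)) + ((1 + p) * (eW * (1 - g)) + (a * (p * y) - (a * (p * g) + a * ((1 + p) * (y * g)))))"
    by (simp add: algebra_simps)
  then have "cmod (iexp (th * d) * (w * (1 - g)) - a * (1 + p + y - g))
    \<le> 94572 * ?R + (31098 * ?R + 62196 * ?S + (72 * ?R + (30600 * ?R + 31025 * ?R)))"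
    using T1 T2 T3 T4 T5
    by (simp only:) (intro norm_triangle_mono norm_triangle_le_diff order_trans[OF norm_triangle_ineq4 add_mono] ; assumption)
  also have "\<dots> \<le> 200000 * (?R + ?S)" using R0 unfolding distrib_left by linarith
  finally show "cmod (iexp (th * d) * (w * (1 - th\<^sup>2 / 2 * k)) - a * (1 + \<i> * (th * d) - (th * d)\<^sup>2 / 2 + y - th\<^sup>2 / 2 * k))
      \<le> 200000 * (\<bar>th\<bar> ^ 3 * X ^ 4 + \<bar>th\<bar> * e * X ^ 3)"
    by (simp add: g_def p_def algebra_simps)
  have E0: "cmod (iexp (th * d) - 1) \<le> ?t * (11 * X)" using norm_iexp_Taylor0[of "th * d"] td by linarith
  have "iexp (th * d) * (w * (1 - g)) - a = (iexp (th * d) - 1) * (w * (1 - g)) + (of_real w * of_real (- g) + of_real (w - a))"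
    by (simp add: algebra_simps)
  moreover have "cmod ((iexp (th * d) - 1) * (of_real w * of_real (1 - g))) \<le> (?t * (11 * X)) * (1 * 426)"
    by (rule norm_mult_le[OF E0 norm_mult_le[OF W G]])
  moreover have "cmod (of_real w * of_real (- g)) \<le> 1 * (425 * (?t * ?t))"
    using g by (intro norm_mult_le[OF W]) (simp only: norm_of_real abs_minus_cancel)
  moreover have "cmod (of_real (w - a)) \<le> y" using w2 by (simp only: norm_of_real)
  ultimately have "cmod (iexp (th * d) * (w * (1 - g)) - a) \<le> (?t * (11 * X)) * (1 * 426) + (1 * (425 * (?t * ?t)) + y)"
    by (simp only: of_real_mult) (intro norm_triangle_mono; assumption)
  also have "\<dots> \<le> 4686 * (?t * X) + (425 * (?t * X) + ?t * X)"
  proof (intro add_mono)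
    have "?t * ?t \<le> ?t * X" using t X by (intro mult_left_mono) auto
    then show "1 * (425 * (?t * ?t)) \<le> 425 * (?t * X)" by linarith
    have "?t * ?t * X \<le> ?t * X" using tt(1) XX by (intro mult_right_mono) auto
    then show "y \<le> ?t * X" using yb by linarith
  qed simp
  also have "\<dots> \<le> 6000 * ?t * X" using t XX by simp
  finally show "cmod (iexp (th * d) * (w * (1 - th\<^sup>2 / 2 * k)) - a) \<le> 6000 * \<bar>th\<bar> * X"
    by (simp add: g_def)
qed

lemma integral_norm_bound_AE:
  fixes f :: "'c \<Rightarrow> 'd::{banach,second_countable_topology}"
  assumes "integrable M f" "integrable M g" "AE x in M. norm (f x) \<le> g x"
  shows "norm (integral\<^sup>L M f) \<le> integral\<^sup>L M g"
  by (rule order_trans[OF integral_norm_bound integral_mono_AE]) (use assms in auto)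

text \<open>An approximate solution of the equation for the characteristic function: the Gaussian one, with a
corrector for the current conditional variance.\<close>

definition approx :: "real \<Rightarrow> nat \<Rightarrow> nat \<Rightarrow> real" where
  "approx th s u = exp (- (kappa * th\<^sup>2 * real s)) * (1 - th\<^sup>2 / 2 * (var_incr u - mean_var))"

lemma var_dev: "\<bar>var_incr u - mean_var\<bar> \<le> 850"
  using var_incr_bounds[of u] s5_bounds unfolding mean_var_def by (simp add: abs_le_iff)

lemma approx_0: "\<bar>approx th 0 u - 1\<bar> \<le> 425 * th\<^sup>2"
proof -
  have "th\<^sup>2 / 2 * \<bar>var_incr u - mean_var\<bar> \<le> th\<^sup>2 / 2 * 850" using var_dev by (intro mult_left_mono) auto
  then show ?thesis by (simp add: approx_def abs_mult)
qed

text \<open>In the expansion of one step the mean of the linear term is \<open>0\<close>; the mean of the second-order terms is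
\<open>- th\<^sup>2 / 2 * var_incr u0 + kappa * th\<^sup>2 * sqrt 5\<close>, the corrector being centred in the new state. As
\<open>2 * kappa * sqrt 5 = mean_var\<close>, this is the corrector in the old state. The term with \<open>(2/3) ^ s\<close> stems from the
conditioning and from steps beyond the window; it is summable in \<open>s\<close>.\<close>

lemma approx_step:
  obtains C where "0 \<le> C"
    "\<And>th s n u0. \<bar>th\<bar> \<le> 1 \<Longrightarrow> 0 < s \<Longrightarrow> s \<le> n \<Longrightarrow>
      cmod (EQ (\<lambda>b. dens n b *\<^sub>R (iexp (th * incr u0 b) * approx th (s - bsize b) (fst b))) - approx th s u0)
        \<le> C * (\<bar>th\<bar> ^ 3 + \<bar>th\<bar> * (2/3) ^ s)"
proof -
  define X where "X b = real (bsize b)" for b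
  have XQ: "integrable Q (\<lambda>b. X b ^ k * (3/2) ^ bsize b)" if "k \<le> 4" for k
  proof (rule integrable_Q'[of 1])
    fix b :: block assume "1 \<le> fst b"
    then have "X b ^ k \<le> real (bsize b) ^ 4" using that unfolding X_def by (intro bsize_power_mono) (auto simp: bsize_def)
    then show "norm (X b ^ k * (3/2) ^ bsize b) \<le> 1 * (real (bsize b) ^ 4 * (3/2) ^ bsize b)"
      by (simp add: mult_right_mono X_def)
  qed simp
  have X4: "integrable Q (\<lambda>b. X b ^ 4)" unfolding X_def by (rule integrable_bsize4)
  define c1 where "c1 = EQ (\<lambda>b. X b ^ 4)"
  define c2 where "c2 = EQ (\<lambda>b. X b ^ 3 * (3/2) ^ bsize b)"
  define c3 where "c3 = EQ (\<lambda>b. X b ^ 1 * (3/2) ^ bsize b)"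
  have c: "0 \<le> c1" "0 \<le> c2" "0 \<le> c3" unfolding c1_def c2_def c3_def X_def by (auto intro!: integral_nonneg_AE)
  show thesis
  proof (rule that[of "200000 * c1 + 200000 * c2 + 24000 * c3"])
    show "0 \<le> 200000 * c1 + 200000 * c2 + 24000 * c3" using c by simp
    fix th :: real and s n u0 :: nat
    assume th: "\<bar>th\<bar> \<le> 1" and s: "0 < s" "s \<le> n"
    let ?t = "\<bar>th\<bar>"
    define a where "a = exp (- (kappa * th\<^sup>2 * real s))"
    define xi where "xi b = iexp (th * incr u0 b) * approx th (s - bsize b) (fst b)" for b
    define y where "y b = kappa * th\<^sup>2 * X b" for b
    \<comment> \<open>The second-order expansion of \<open>xi\<close>; its mean is exactly \<open>approx\<close> at the old state.\<close>
    define lin where "lin b = of_real a * (1 + \<i> * (th * incr u0 b) - (th * incr u0 b)\<^sup>2 / 2 + y b - th\<^sup>2 / 2 * (var_incr (fst b) - mean_var))" for b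
    have a: "0 \<le> a" "a \<le> 1" using kappa_facts by (auto simp: a_def)
    have pt: "cmod (xi b - lin b) \<le> 200000 * (?t ^ 3 * X b ^ 4 + ?t * of_bool (s < bsize b) * X b ^ 3)"
      "cmod (xi b - a) \<le> 6000 * ?t * X b" if b: "1 \<le> bsize b" for b
    proof -
      have k0: "0 \<le> kappa * th\<^sup>2" using kappa_facts by simp
      have y: "0 \<le> y b" "y b \<le> th\<^sup>2 * X b"
        using kappa_facts by (auto simp: y_def X_def intro!: mult_right_mono mult_left_le_one_le)
      note e = exp_time_step[OF k0, of s "bsize b"]
      show "cmod (xi b - lin b) \<le> 200000 * (?t ^ 3 * X b ^ 4 + ?t * of_bool (s < bsize b) * X b ^ 3)"
        unfolding xi_def lin_def approx_def of_real_mult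
        using step_expansion(1)[of th "incr u0 b" "X b" "var_incr (fst b) - mean_var" "y b" "exp (- (kappa * th\<^sup>2 * real (s - bsize b)))" a "of_bool (s < bsize b)"]
          th incr_bound[OF b, of u0] var_dev[of "fst b"] b y a kappa_facts e
        by (simp add: X_def y_def a_def)
      show "cmod (xi b - a) \<le> 6000 * ?t * X b"
        unfolding xi_def approx_def of_real_mult
        using step_expansion(2)[of th "incr u0 b" "X b" "var_incr (fst b) - mean_var" "y b" "exp (- (kappa * th\<^sup>2 * real (s - bsize b)))" a "of_bool (s < bsize b)"]
          th incr_bound[OF b, of u0] var_dev[of "fst b"] b y a kappa_facts e
        by (simp add: X_def y_def a_def)
    qed
    have ob: "of_bool (s < x) \<le> (3/2::real) ^ x * (2/3) ^ s" for x :: nat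
    proof -
      have "(3/2::real) ^ s \<le> (3/2) ^ x" if "s < x" using that by (intro power_increasing) auto
      then have "s < x \<Longrightarrow> (3/2::real) ^ s * (2/3) ^ s \<le> (3/2) ^ x * (2/3) ^ s" by (intro mult_right_mono) auto
      then show ?thesis by (auto simp: power_mult_distrib[symmetric])
    qed
    have ixa: "integrable Q (\<lambda>b. xi b - a)"
    proof (rule integrable_Q_poly[of "6000 * ?t"])
      fix b :: block assume b: "1 \<le> bsize b"
      have "6000 * ?t * X b \<le> 6000 * ?t * X b ^ 4"
        using bsize_power_mono[OF b, of 1 4] by (intro mult_left_mono) (auto simp: X_def)
      then show "norm (xi b - a) \<le> 6000 * ?t * real (bsize b) ^ 4" using pt(2)[OF b] by (simp add: X_def)
    qed simp
    have ixi: "integrable Q xi"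
      using Bochner_Integration.integrable_add[OF ixa, of "\<lambda>_. of_real a"] by simp
    have lin_eq: "lin b = of_real (a * (1 - th\<^sup>2 / 2 * (incr u0 b)\<^sup>2 + kappa * th\<^sup>2 * real (bsize b) - th\<^sup>2 / 2 * (var_incr (fst b) - mean_var))) + of_real (incr u0 b) * (of_real a * \<i> * of_real th)" for b
      unfolding lin_def y_def X_def by (simp add: algebra_simps power_mult_distrib)
    have lin: "has_bochner_integral Q lin (of_real (a * (1 - th\<^sup>2 / 2 * var_incr u0 + kappa * th\<^sup>2 * s5 - th\<^sup>2 / 2 * (mean_var - mean_var))) + of_real 0 * (of_real a * \<i> * of_real th))"
      unfolding lin_eq
    proof (intro has_bochner_integral_add has_bochner_integral_of_real has_bochner_integral_mult_left has_bochner_integral_mult_right has_bochner_integral_diff)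
      show "has_bochner_integral Q (\<lambda>b. 1 :: real) 1" by (simp add: has_bochner_integral_iff)
      show "has_bochner_integral Q (\<lambda>b. (incr u0 b)\<^sup>2) (var_incr u0)"
        using integrable_incr by (simp add: has_bochner_integral_iff var_incr_def)
      show "has_bochner_integral Q (\<lambda>b. real (bsize b)) s5" by (rule bsize_moments)
      show "has_bochner_integral Q (\<lambda>b. var_incr (fst b)) mean_var" by (rule EQ_var_incr)
      show "has_bochner_integral Q (\<lambda>b. mean_var) mean_var" by (simp add: has_bochner_integral_iff)
      show "has_bochner_integral Q (incr u0) 0"
        using integrable_incr EQ_incr by (simp add: has_bochner_integral_iff)
    qed
    have kth: "kappa * th\<^sup>2 * s5 = th\<^sup>2 / 2 * mean_var" unfolding kappa_facts(3)[symmetric] by simp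
    have "1 - th\<^sup>2 / 2 * var_incr u0 + kappa * th\<^sup>2 * s5 - th\<^sup>2 / 2 * (mean_var - mean_var) = 1 - th\<^sup>2 / 2 * (var_incr u0 - mean_var)"
      unfolding kth right_diff_distrib by linarith
    then have "a * (1 - th\<^sup>2 / 2 * var_incr u0 + kappa * th\<^sup>2 * s5 - th\<^sup>2 / 2 * (mean_var - mean_var)) = approx th s u0"
      unfolding approx_def a_def by (simp only:)
    then have Elin: "EQ lin = of_real (approx th s u0)"
      using lin by (simp only: has_bochner_integral_iff of_real_0 mult_zero_left add_0_right)
    have ilin: "integrable Q lin" using lin by (simp add: has_bochner_integral_iff)
    have idx: "integrable Q (\<lambda>b. dens n b *\<^sub>R (xi b - a))" by (rule integrable_Q_dens)
    have n: "0 < n" using s by simp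
    have "EQ (\<lambda>b. dens n b *\<^sub>R xi b) = EQ (\<lambda>b. dens n b *\<^sub>R (xi b - a) + dens n b *\<^sub>R of_real a)"
      by (simp add: scaleR_diff_right)
    also have "\<dots> = EQ (\<lambda>b. dens n b *\<^sub>R (xi b - a)) + EQ (\<lambda>b. dens n b *\<^sub>R of_real a)"
      by (intro Bochner_Integration.integral_add integrable_Q_dens)
    also have "EQ (\<lambda>b. dens n b *\<^sub>R (of_real a :: complex)) = a"
      using EQ_dens[OF n] integrable_Q_dens[of n "\<lambda>_. 1::real"] by (simp add: integral_scaleR_left)
    also have "EQ (\<lambda>b. dens n b *\<^sub>R (xi b - a)) = EQ (\<lambda>b. xi b - a) + EQ (\<lambda>b. (dens n b - 1) *\<^sub>R (xi b - a))"
    proof -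
      have "EQ (\<lambda>b. (dens n b - 1) *\<^sub>R (xi b - a)) = EQ (\<lambda>b. dens n b *\<^sub>R (xi b - a) - (xi b - a))"
        by (simp add: scaleR_diff_left)
      also have "\<dots> = EQ (\<lambda>b. dens n b *\<^sub>R (xi b - a)) - EQ (\<lambda>b. xi b - a)"
        by (rule Bochner_Integration.integral_diff[OF idx ixa])
      finally show ?thesis by simp
    qed
    also have "EQ (\<lambda>b. xi b - a) = EQ (\<lambda>b. xi b - lin b) + EQ lin - a"
      using ixi ilin by simp
    finally have eq: "EQ (\<lambda>b. dens n b *\<^sub>R xi b) - approx th s u0
      = EQ (\<lambda>b. xi b - lin b) + EQ (\<lambda>b. (dens n b - 1) *\<^sub>R (xi b - a))" by (simp add: Elin)
    have b1: "cmod (EQ (\<lambda>b. xi b - lin b)) \<le> EQ (\<lambda>b. 200000 * (?t ^ 3 * X b ^ 4) + 200000 * (?t * (2/3) ^ s) * (X b ^ 3 * (3/2) ^ bsize b))"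
    proof (rule integral_norm_bound_AE)
    show "integrable Q (\<lambda>b. xi b - lin b)" using ixi ilin by simp
    show "integrable Q (\<lambda>b. 200000 * (?t ^ 3 * X b ^ 4) + 200000 * (?t * (2/3) ^ s) * (X b ^ 3 * (3/2) ^ bsize b))"
        using X4 XQ[of 3] by simp
      show "AE b in Q. norm (xi b - lin b) \<le> 200000 * (?t ^ 3 * X b ^ 4) + 200000 * (?t * (2/3) ^ s) * (X b ^ 3 * (3/2) ^ bsize b)"
      proof (rule AE_Q)
        fix b :: block assume b: "1 \<le> bsize b"
        have "?t * of_bool (s < bsize b) * X b ^ 3 \<le> ?t * ((3/2) ^ bsize b * (2/3) ^ s) * X b ^ 3"
          using ob[of "bsize b"] by (intro mult_right_mono mult_left_mono) (auto simp: X_def)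
        then show "norm (xi b - lin b) \<le> 200000 * (?t ^ 3 * X b ^ 4) + 200000 * (?t * (2/3) ^ s) * (X b ^ 3 * (3/2) ^ bsize b)"
          using pt(1)[OF b] by (simp add: mult_ac)
      qed
    qed
    also have "\<dots> = 200000 * (?t ^ 3 * c1) + 200000 * (?t * (2/3) ^ s) * c2"
      using X4 XQ[of 3] by (simp add: c1_def c2_def)
    finally have b1': "cmod (EQ (\<lambda>b. xi b - lin b)) \<le> 200000 * (?t ^ 3 * c1) + 200000 * (?t * (2/3) ^ s) * c2" .
    have b2: "cmod (EQ (\<lambda>b. (dens n b - 1) *\<^sub>R (xi b - a))) \<le> EQ (\<lambda>b. 24000 * (?t * (2/3) ^ s) * (X b ^ 1 * (3/2) ^ bsize b))"
    proof (rule integral_norm_bound_AE)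
      show "integrable Q (\<lambda>b. (dens n b - 1) *\<^sub>R (xi b - a))"
        using idx ixa by (simp add: scaleR_diff_left)
      show "integrable Q (\<lambda>b. 24000 * (?t * (2/3) ^ s) * (X b ^ 1 * (3/2) ^ bsize b))" using XQ[of 1] by simp
      show "AE b in Q. norm ((dens n b - 1) *\<^sub>R (xi b - a)) \<le> 24000 * (?t * (2/3) ^ s) * (X b ^ 1 * (3/2) ^ bsize b)"
      proof (rule AE_Q)
        fix b :: block assume b: "1 \<le> bsize b" "1 \<le> fst b"
        have "(2/3::real) ^ n \<le> (2/3) ^ s" using s by (intro power_decreasing) auto
        then have "4 * (3/2) ^ bsize b * (2/3::real) ^ n \<le> 4 * (3/2) ^ bsize b * (2/3) ^ s" by (intro mult_left_mono) auto
        moreover have "4 * (3/2) ^ bsize b / (3/2) ^ n = 4 * (3/2) ^ bsize b * (2/3::real) ^ n"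
          by (simp add: power_divide)
        ultimately have "\<bar>dens n b - 1\<bar> \<le> 4 * (3/2) ^ bsize b * (2/3) ^ s"
          using dens_close[OF b(2), of n] by linarith
        then have "\<bar>dens n b - 1\<bar> * cmod (xi b - a) \<le> (4 * (3/2) ^ bsize b * (2/3) ^ s) * (6000 * ?t * X b)"
          using pt(2)[OF b(1)] by (intro mult_mono) auto
        then show "norm ((dens n b - 1) *\<^sub>R (xi b - a)) \<le> 24000 * (?t * (2/3) ^ s) * (X b ^ 1 * (3/2) ^ bsize b)"
          by (simp add: mult_ac)
      qed
    qed
    also have "\<dots> = 24000 * (?t * (2/3) ^ s) * c3" by (simp add: c3_def)
    finally have "cmod (EQ (\<lambda>b. dens n b *\<^sub>R xi b) - approx th s u0)
      \<le> 200000 * (?t ^ 3 * c1) + 200000 * (?t * (2/3) ^ s) * c2 + 24000 * (?t * (2/3) ^ s) * c3"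
      unfolding eq using b1' norm_triangle_ineq[of "EQ (\<lambda>b. xi b - lin b)" "EQ (\<lambda>b. (dens n b - 1) *\<^sub>R (xi b - a))"] by linarith
    also have "\<dots> \<le> (200000 * c1 + 200000 * c2 + 24000 * c3) * (?t ^ 3 + ?t * (2/3) ^ s)"
      using c by (simp add: algebra_simps)
    finally show "cmod (EQ (\<lambda>b. dens n b *\<^sub>R (iexp (th * incr u0 b) * approx th (s - bsize b) (fst b))) - approx th s u0)
        \<le> (200000 * c1 + 200000 * c2 + 24000 * c3) * (?t ^ 3 + ?t * (2/3) ^ s)"
      by (simp add: xi_def)
  qed
qed

text \<open>The errors of the steps add up, because the one-step equation averages the error of the
remaining window. Along a trajectory the remaining areas are distinct, so at most the sum of the bounds of
\<open>approx_step\<close> over all \<open>m \<le> s\<close> occurs.\<close>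

lemma char_walk:
  obtains C where "0 \<le> C"
    "\<And>th s n u0. \<bar>th\<bar> \<le> 1 \<Longrightarrow> s \<le> n \<Longrightarrow>
      cmod (avg n (\<lambda>L. iexp (th * walk u0 L s)) - exp (- (kappa * th\<^sup>2 * real s))) \<le> C * (\<bar>th\<bar> ^ 3 * real s + \<bar>th\<bar>)"
proof -
  obtain C where C: "0 \<le> C" "\<And>th s n u0. \<bar>th\<bar> \<le> 1 \<Longrightarrow> 0 < s \<Longrightarrow> s \<le> n \<Longrightarrow>
      cmod (EQ (\<lambda>b. dens n b *\<^sub>R (iexp (th * incr u0 b) * approx th (s - bsize b) (fst b))) - approx th s u0)
        \<le> C * (\<bar>th\<bar> ^ 3 + \<bar>th\<bar> * (2/3) ^ s)"
    using approx_step by blast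
  show thesis
  proof (rule that[of "2 * C + 850"])
    fix th :: real and s n u0 :: nat
    assume th: "\<bar>th\<bar> \<le> 1" and s: "s \<le> n"
    let ?t = "\<bar>th\<bar>"
    define B where "B s = 425 * ?t + C * (\<Sum>m=1..s. ?t ^ 3 + ?t * (2/3) ^ m)" for s
    have tt: "th\<^sup>2 \<le> ?t" using th power_decreasing[of 1 2 ?t] by simp
    have Bmono: "B s \<le> B s'" if "s \<le> s'" for s s'
      unfolding B_def using C(1) that by (intro add_left_mono mult_left_mono sum_mono2) auto
    have main: "cmod (avg n (\<lambda>L. iexp (th * walk u0 L s)) - approx th s u0) \<le> B s" if "s \<le> n" for s n u0
      using that
    proof (induction s arbitrary: n u0 rule: less_induct)
      case (less s)
      show ?case
      proof (cases "s = 0")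
        case True
        have "cmod (1 - of_real (approx th 0 u0)) = \<bar>approx th 0 u0 - 1\<bar>"
          by (metis abs_minus_commute norm_of_real of_real_1 of_real_diff)
        then show ?thesis using True approx_0[of th u0] tt by (simp add: avg_const B_def)
      next
        case False
        then have s: "0 < s" and n: "0 < n" using less.prems by auto
        define r where "r b = avg (n - bsize b) (\<lambda>L. iexp (th * walk (fst b) L (s - bsize b)))" for b
        have "avg n (\<lambda>L. iexp (th * walk u0 L s)) = EQ (\<lambda>b. dens n b *\<^sub>R avg (n - bsize b) (\<lambda>L. iexp (th * walk u0 (b # L) s)))"
          by (rule avg_rec[OF n])
        also have "(\<lambda>b. avg (n - bsize b) (\<lambda>L. iexp (th * walk u0 (b # L) s))) = (\<lambda>b. iexp (th * incr u0 b) * r b)"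
        proof
          fix b
          have "avg (n - bsize b) (\<lambda>L. iexp (th * walk u0 (b # L) s)) = avg (n - bsize b) (\<lambda>L. iexp (th * incr u0 b) * iexp (th * walk (fst b) L (s - bsize b)))"
            using False by (intro avg_cong) (simp add: distrib_left exp_add)
          then show "avg (n - bsize b) (\<lambda>L. iexp (th * walk u0 (b # L) s)) = iexp (th * incr u0 b) * r b"
            by (simp add: r_def avg_def sum_distrib_left[symmetric])
        qed
        finally have 1: "avg n (\<lambda>L. iexp (th * walk u0 L s)) = EQ (\<lambda>b. dens n b *\<^sub>R (iexp (th * incr u0 b) * r b))" .
        let ?A = "\<lambda>b. of_real (approx th (s - bsize b) (fst b)) :: complex"
        have 2: "cmod (EQ (\<lambda>b. dens n b *\<^sub>R (iexp (th * incr u0 b) * r b)) - EQ (\<lambda>b. dens n b *\<^sub>R (iexp (th * incr u0 b) * ?A b))) \<le> B (s - 1)"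
        proof -
          have "EQ (\<lambda>b. dens n b *\<^sub>R (iexp (th * incr u0 b) * r b)) - EQ (\<lambda>b. dens n b *\<^sub>R (iexp (th * incr u0 b) * ?A b))
             = EQ (\<lambda>b. dens n b *\<^sub>R (iexp (th * incr u0 b) * (r b - ?A b)))"
            by (subst Bochner_Integration.integral_diff[symmetric]) (auto intro: integrable_Q_dens simp: scaleR_diff_right right_diff_distrib)
          also have "cmod \<dots> \<le> EQ (\<lambda>b. dens n b *\<^sub>R B (s - 1))"
          proof (rule integral_norm_bound_AE[OF integrable_Q_dens integrable_Q_dens], rule AE_Q)
            fix b :: block assume b: "1 \<le> bsize b"
            show "norm (dens n b *\<^sub>R (iexp (th * incr u0 b) * (r b - ?A b))) \<le> dens n b *\<^sub>R B (s - 1)"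
            proof (cases "b \<in> first_blocks n")
              case True
              have "cmod (r b - ?A b) \<le> B (s - bsize b)"
                unfolding r_def using less.IH[of "s - bsize b" "n - bsize b" "fst b"] b s less.prems by simp
              also have "\<dots> \<le> B (s - 1)" using b by (intro Bmono) auto
              finally show ?thesis using dens_bounds(1)[of n b] by (simp add: norm_mult mult_left_mono)
            next
              case False
              then show ?thesis by (simp add: dens_def)
            qed
          qed
          also have "\<dots> = B (s - 1)" using EQ_dens[OF n] integrable_Q_dens[of n "\<lambda>_. 1::real"] by simp
          finally show ?thesis .
        qed
        have "B s = B (s - 1) + C * (?t ^ 3 + ?t * (2/3) ^ s)"
          using s by (cases s) (auto simp: B_def algebra_simps)
        moreover have "cmod (x - z) \<le> cmod (x - y) + cmod (y - z)" for x y z :: complex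
          using norm_triangle_ineq[of "x - y" "y - z"] by simp
        note this[of "EQ (\<lambda>b. dens n b *\<^sub>R (iexp (th * incr u0 b) * r b))" "of_real (approx th s u0)" "EQ (\<lambda>b. dens n b *\<^sub>R (iexp (th * incr u0 b) * ?A b))"]
        ultimately show ?thesis
          using C(2)[OF th s less.prems, of u0] 2 unfolding 1 by linarith
      qed
    qed
    have "approx th s u0 - exp (- (kappa * th\<^sup>2 * real s)) = exp (- (kappa * th\<^sup>2 * real s)) * (- (th\<^sup>2 / 2 * (var_incr u0 - mean_var)))"
      unfolding approx_def right_diff_distrib[of "exp _" 1] by simp
    then have "\<bar>approx th s u0 - exp (- (kappa * th\<^sup>2 * real s))\<bar> = exp (- (kappa * th\<^sup>2 * real s)) * (th\<^sup>2 / 2 * \<bar>var_incr u0 - mean_var\<bar>)"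
      by (simp only: abs_mult abs_minus_cancel) simp
    also have "\<dots> \<le> 1 * (th\<^sup>2 / 2 * 850)" using var_dev kappa_facts by (intro mult_mono) auto
    finally have a: "\<bar>approx th s u0 - exp (- (kappa * th\<^sup>2 * real s))\<bar> \<le> 425 * ?t" using tt by simp
    have "(\<Sum>m=1..s. (2/3::real) ^ m) \<le> 2"
    proof -
      have "(\<Sum>m=1..s. (2/3::real) ^ m) = 2 - 2 * (2/3) ^ s" by (induction s) auto
      then show ?thesis by simp
    qed
    then have "?t * (\<Sum>m=1..s. (2/3::real) ^ m) \<le> ?t * 2" by (intro mult_left_mono) auto
    moreover have "(\<Sum>m=1..s. ?t ^ 3 + ?t * (2/3) ^ m) = real s * ?t ^ 3 + ?t * (\<Sum>m=1..s. (2/3::real) ^ m)"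
      by (simp add: sum.distrib sum_distrib_left)
    ultimately have "C * (\<Sum>m=1..s. ?t ^ 3 + ?t * (2/3) ^ m) \<le> C * (real s * ?t ^ 3 + 2 * ?t)" using C(1) by (intro mult_left_mono) auto
    then have Bs: "B s \<le> 425 * ?t + C * (real s * ?t ^ 3 + 2 * ?t)" by (simp add: B_def)
    have "cmod (avg n (\<lambda>L. iexp (th * walk u0 L s)) - exp (- (kappa * th\<^sup>2 * real s))) \<le> B s + \<bar>approx th s u0 - exp (- (kappa * th\<^sup>2 * real s))\<bar>"
    proof -
      have "cmod (x - of_real z) \<le> cmod (x - of_real y) + \<bar>y - z\<bar>" for x :: complex and y z
        using norm_triangle_ineq[of "x - of_real y" "of_real (y - z)"] unfolding norm_of_real by simp
      from this[of _ _ "approx th s u0"] show ?thesis using main[OF s, of u0] by (rule order_trans[OF _ add_right_mono])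
    qed
    also have "\<dots> \<le> 425 * ?t + C * (real s * ?t ^ 3 + 2 * ?t) + 425 * ?t" using a Bs by simp
    also have "\<dots> \<le> (2 * C + 850) * (?t ^ 3 * real s + ?t)" using C(1) by (simp add: algebra_simps)
    finally show "cmod (avg n (\<lambda>L. iexp (th * walk u0 L s)) - exp (- (kappa * th\<^sup>2 * real s))) \<le> (2 * C + 850) * (?t ^ 3 * real s + ?t)" .
  qed (use C(1) in simp)
qed

section \<open>Convergence of the walk over one window\<close>

definition word_pmf :: "nat \<Rightarrow> block list pmf" where "word_pmf n = pmf_of_set (words n)"

lemma expectation_word_pmf:
  fixes f :: "block list \<Rightarrow> 'a::{banach,second_countable_topology}"
  shows "measure_pmf.expectation (word_pmf n) f = avg n f"
proof -
  have "measure_pmf.expectation (word_pmf n) f = (\<Sum>L\<in>words n. pmf (word_pmf n) L *\<^sub>R f L)"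
    by (rule integral_measure_pmf) (auto simp: word_pmf_def finite_words words_nonempty set_pmf_of_set)
  also have "\<dots> = (\<Sum>L\<in>words n. f L /\<^sub>R real (card (words n)))"
    by (intro sum.cong refl) (simp add: word_pmf_def finite_words words_nonempty pmf_of_set divide_inverse)
  finally show ?thesis by (simp add: avg_def scaleR_sum_right)
qed

text \<open>The centred normal law with variance \<open>\<tau>\<close>, as an image measure, which makes sense for \<open>\<tau> = 0\<close> too.\<close>

definition gauss :: "real \<Rightarrow> real measure" where
  "gauss \<tau> = distr std_normal_distribution borel (\<lambda>x. sqrt \<tau> * x)"

interpretation std: real_distribution std_normal_distribution by (rule real_dist_normal_dist)

lemma real_distribution_gauss: "real_distribution (gauss \<tau>)"
  unfolding gauss_def by (rule std.real_distribution_distr) simp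

lemma prob_space_gauss: "prob_space (gauss \<tau>)"
  using real_distribution_gauss by (simp add: real_distribution_def)

lemma sets_gauss [simp]: "sets (gauss \<tau>) = sets borel" "space (gauss \<tau>) = UNIV"
  by (simp_all add: gauss_def)

lemma gauss_1: "gauss 1 = std_normal_distribution"
proof -
  have "(\<lambda>x::real. sqrt 1 * x) = (\<lambda>x. x)" by auto
  then show ?thesis unfolding gauss_def by (simp only:) (simp add: distr_id2)
qed

lemma char_gauss: "0 \<le> \<tau> \<Longrightarrow> char (gauss \<tau>) t = exp (- (\<tau> * t\<^sup>2) / 2)"
proof -
  assume t: "0 \<le> \<tau>"
  have "char (gauss \<tau>) t = char std_normal_distribution (t * sqrt \<tau>)"
    unfolding char_def gauss_def by (subst integral_distr) (auto simp: mult.assoc)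
  then show ?thesis using t by (simp add: char_std_normal_distribution power_mult_distrib mult.commute)
qed

definition scaled_path_law :: "nat \<Rightarrow> nat \<Rightarrow> nat \<Rightarrow> nat \<Rightarrow> real measure" where
  "scaled_path_law N n u s = distr (word_pmf n) borel (\<lambda>L. walk u L s / (sigma4 * sqrt (real N)))"

lemma real_distribution_path_law: "real_distribution (scaled_path_law N n u s)"
  unfolding scaled_path_law_def by (rule prob_space.real_distribution_distr) (auto simp: measure_pmf.prob_space_axioms)

lemma integral_path_law:
  fixes f :: "real \<Rightarrow> 'a::{banach,second_countable_topology}"
  assumes "f \<in> borel_measurable borel"
  shows "integral\<^sup>L (scaled_path_law N n u s) f = avg n (\<lambda>L. f (walk u L s / (sigma4 * sqrt (real N))))"
  unfolding scaled_path_law_def using assms by (subst integral_distr) (auto simp: expectation_word_pmf)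

text \<open>The words, states and windows may vary along the sequence; only the ratio of window and scale is
prescribed. This generality is what turns convergence into uniform convergence below.\<close>

lemma path_law_weak_conv:
  fixes N n s u :: "nat \<Rightarrow> nat"
  assumes \<tau>: "0 \<le> \<tau>" and N: "filterlim N at_top sequentially"
    and s: "\<And>k. s k \<le> n k" "(\<lambda>k. real (s k) / real (N k)) \<longlonglongrightarrow> \<tau>"
  shows "weak_conv_m (\<lambda>k. scaled_path_law (N k) (n k) (u k) (s k)) (gauss \<tau>)"
proof (rule levy_continuity[OF real_distribution_path_law real_distribution_gauss])
  fix t :: real
  obtain C where C: "0 \<le> C" "\<And>th s n u0. \<bar>th\<bar> \<le> 1 \<Longrightarrow> s \<le> n \<Longrightarrow>
      cmod (avg n (\<lambda>L. iexp (th * walk u0 L s)) - exp (- (kappa * th\<^sup>2 * real s))) \<le> C * (\<bar>th\<bar> ^ 3 * real s + \<bar>th\<bar>)"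
    using char_walk by blast
  define th where "th k = t / (sigma4 * sqrt (real (N k)))" for k
  have sq: "filterlim (\<lambda>k. sqrt (real (N k))) at_top sequentially"
    using filterlim_compose[OF sqrt_at_top filterlim_compose[OF filterlim_real_sequentially N]] .
  have inv: "(\<lambda>k. inverse (sqrt (real (N k)))) \<longlonglongrightarrow> 0"
    by (rule filterlim_compose[OF tendsto_inverse_0_at_top[OF filterlim_ident] sq])
  have "(\<lambda>k. t / sigma4 * inverse (sqrt (real (N k)))) \<longlonglongrightarrow> t / sigma4 * 0"
    by (intro tendsto_mult tendsto_const inv)
  then have th0: "th \<longlonglongrightarrow> 0" unfolding th_def by (simp add: divide_inverse mult_ac)
  have Npos: "\<forall>\<^sub>F k in sequentially. 0 < N k"
  proof -
    have "\<forall>\<^sub>F k in sequentially. 1 \<le> N k" using N unfolding filterlim_at_top by blast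
    then show ?thesis by eventually_elim simp
  qed
  have ths: "(\<lambda>k. (th k)\<^sup>2 * real (s k)) \<longlonglongrightarrow> t\<^sup>2 / sigma4\<^sup>2 * \<tau>"
  proof (rule Lim_transform_eventually)
    show "(\<lambda>k. t\<^sup>2 / sigma4\<^sup>2 * (real (s k) / real (N k))) \<longlonglongrightarrow> t\<^sup>2 / sigma4\<^sup>2 * \<tau>"
      by (intro tendsto_mult tendsto_const s)
    show "\<forall>\<^sub>F k in sequentially. t\<^sup>2 / sigma4\<^sup>2 * (real (s k) / real (N k)) = (th k)\<^sup>2 * real (s k)"
      using Npos by eventually_elim (simp add: th_def power_divide power_mult_distrib)
  qed
  have "(\<lambda>k. C * (\<bar>th k\<bar> * ((th k)\<^sup>2 * real (s k)) + \<bar>th k\<bar>)) \<longlonglongrightarrow> C * (\<bar>0\<bar> * (t\<^sup>2 / sigma4\<^sup>2 * \<tau>) + \<bar>0\<bar>)"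
    by (intro tendsto_intros th0 ths)
  then have e0: "(\<lambda>k. C * (\<bar>th k\<bar> ^ 3 * real (s k) + \<bar>th k\<bar>)) \<longlonglongrightarrow> 0"
  proof -
    have cube: "\<bar>x\<bar> ^ 3 * y = \<bar>x\<bar> * (x\<^sup>2 * y)" for x y :: real by (simp add: power3_eq_cube power2_eq_square)
    show "(\<lambda>k. C * (\<bar>th k\<bar> * ((th k)\<^sup>2 * real (s k)) + \<bar>th k\<bar>)) \<longlonglongrightarrow> C * (\<bar>0\<bar> * (t\<^sup>2 / sigma4\<^sup>2 * \<tau>) + \<bar>0\<bar>) \<Longrightarrow> ?thesis"
      by (simp only: cube) simp
  qed
  have ch: "char (scaled_path_law (N k) (n k) (u k) (s k)) t = avg (n k) (\<lambda>L. iexp (th k * walk (u k) L (s k)))" for k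
    unfolding char_def by (subst integral_path_law) (auto simp: th_def)
  have "\<forall>\<^sub>F k in sequentially. \<bar>th k\<bar> < 1" using order_tendstoD(2)[OF tendsto_rabs[OF th0], of 1] by simp
  then have "\<forall>\<^sub>F k in sequentially. cmod (char (scaled_path_law (N k) (n k) (u k) (s k)) t - exp (- (kappa * ((th k)\<^sup>2 * real (s k)))))
     \<le> C * (\<bar>th k\<bar> ^ 3 * real (s k) + \<bar>th k\<bar>)"
    unfolding ch by eventually_elim (use C(2) s(1) in \<open>auto simp: mult.assoc\<close>)
  then have d: "(\<lambda>k. char (scaled_path_law (N k) (n k) (u k) (s k)) t - exp (- (kappa * ((th k)\<^sup>2 * real (s k))))) \<longlonglongrightarrow> 0"
    using e0 by (rule Lim_null_comparison)
  have "(\<lambda>k. complex_of_real (exp (- (kappa * ((th k)\<^sup>2 * real (s k)))))) \<longlonglongrightarrow> complex_of_real (exp (- (kappa * (t\<^sup>2 / sigma4\<^sup>2 * \<tau>))))"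
    by (intro tendsto_intros ths)
  from tendsto_add[OF d this]
  have "(\<lambda>k. char (scaled_path_law (N k) (n k) (u k) (s k)) t) \<longlonglongrightarrow> complex_of_real (exp (- (kappa * (t\<^sup>2 / sigma4\<^sup>2 * \<tau>))))"
    by simp
  also have "kappa * (t\<^sup>2 / sigma4\<^sup>2 * \<tau>) = \<tau> * t\<^sup>2 / 2" using sigma4_pos by (simp add: kappa_def)
  finally show "(\<lambda>k. char (scaled_path_law (N k) (n k) (u k) (s k)) t) \<longlonglongrightarrow> char (gauss \<tau>) t"
    using \<tau> by (simp add: char_gauss)
qed

definition BL1 :: "(real \<Rightarrow> real) \<Rightarrow> bool" where
  "BL1 f \<longleftrightarrow> (\<forall>x. \<bar>f x\<bar> \<le> 1) \<and> (\<forall>x y. \<bar>f x - f y\<bar> \<le> \<bar>x - y\<bar>)"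

lemma BL1_measurable: "BL1 f \<Longrightarrow> f \<in> borel_measurable borel"
proof (rule borel_measurable_continuous_onI)
  assume f: "BL1 f"
  have "1-lipschitz_on UNIV f" using f by (intro lipschitz_onI) (auto simp: BL1_def dist_real_def)
  then show "continuous_on UNIV f" by (rule lipschitz_on_continuous_on)
qed

text \<open>On Skorohod's probability space the variables converge pointwise, and a common Lipschitz constant
makes the differences of the integrands converge irrespective of the functions.\<close>

lemma weak_conv_uniform_BL1:
  fixes \<mu> :: "nat \<Rightarrow> real measure"
  assumes "\<And>k. real_distribution (\<mu> k)" "real_distribution \<nu>" "weak_conv_m \<mu> \<nu>" and f: "\<And>k. BL1 (f k)"
  shows "(\<lambda>k. integral\<^sup>L (\<mu> k) (f k) - integral\<^sup>L \<nu> (f k)) \<longlonglongrightarrow> 0"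
proof -
  obtain \<Omega> :: "real measure" and Y Y' where \<Omega>: "prob_space \<Omega>" and Y: "\<And>k. Y k \<in> measurable \<Omega> borel" "\<And>k. distr \<Omega> borel (Y k) = \<mu> k"
    "Y' \<in> measurable \<Omega> lborel" "distr \<Omega> borel Y' = \<nu>" "\<And>x. x \<in> space \<Omega> \<Longrightarrow> (\<lambda>k. Y k x) \<longlonglongrightarrow> Y' x"
    using Skorohod[OF assms(1-3)] by blast
  interpret \<Omega>: prob_space \<Omega> by fact
  have Y'm: "Y' \<in> borel_measurable \<Omega>" using Y(3) by simp
  note fm = BL1_measurable[OF f]
  have b: "\<bar>f k x\<bar> \<le> 1" "\<bar>f k x - f k y\<bar> \<le> \<bar>x - y\<bar>" for k x y using f[of k] by (auto simp: BL1_def)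
  have m: "(\<lambda>x. f k (Y k x)) \<in> borel_measurable \<Omega>" "(\<lambda>x. f k (Y' x)) \<in> borel_measurable \<Omega>" for k
    using measurable_compose[OF Y(1) fm] measurable_compose[OF Y'm fm] by auto
  have i: "integrable \<Omega> (\<lambda>x. f k (Y k x))" "integrable \<Omega> (\<lambda>x. f k (Y' x))" for k
    using m b by (auto intro!: \<Omega>.integrable_const_bound[where B = 1])
  have eq: "integral\<^sup>L (\<mu> k) (f k) - integral\<^sup>L \<nu> (f k) = (\<integral>x. f k (Y k x) - f k (Y' x) \<partial>\<Omega>)" for k
    unfolding Y(2)[symmetric] Y(4)[symmetric] using Y(1) Y'm fm i by (simp add: integral_distr)
  have "(\<lambda>k. \<integral>x. f k (Y k x) - f k (Y' x) \<partial>\<Omega>) \<longlonglongrightarrow> (\<integral>x. 0 \<partial>\<Omega>)"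
  proof (rule integral_dominated_convergence[where w = "\<lambda>_. 2"])
    show "AE x in \<Omega>. (\<lambda>k. f k (Y k x) - f k (Y' x)) \<longlonglongrightarrow> 0"
    proof (rule AE_I2)
      fix x assume "x \<in> space \<Omega>"
      then have "(\<lambda>k. \<bar>Y k x - Y' x\<bar>) \<longlonglongrightarrow> 0" using Y(5) by (simp add: LIM_zero tendsto_rabs_zero)
      then show "(\<lambda>k. f k (Y k x) - f k (Y' x)) \<longlonglongrightarrow> 0"
        by (rule Lim_null_comparison[rotated]) (use b in auto)
    qed
    show "AE x in \<Omega>. norm (f k (Y k x) - f k (Y' x)) \<le> 2" for k
    proof (rule AE_I2)
      fix x show "norm (f k (Y k x) - f k (Y' x)) \<le> 2" using b(1)[of k "Y k x"] b(1)[of k "Y' x"] by (simp add: abs_le_iff)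
    qed
  qed (use m in auto)
  then show ?thesis unfolding eq by simp
qed

definition path_scale :: "nat \<Rightarrow> real" where "path_scale N = sigma4 * sqrt (real N)"

text \<open>By contradiction: counterexamples for every \<open>k\<close> would form a sequence to which \<open>path_law_weak_conv\<close> and
\<open>weak_conv_uniform_BL1\<close> apply.\<close>

lemma uniform_CLT:
  assumes "0 \<le> \<tau>" "0 < e"
  shows "\<exists>d>0. \<exists>N0. \<forall>N\<ge>N0. \<forall>n s u f. s \<le> n \<longrightarrow> \<bar>real s - \<tau> * real N\<bar> \<le> d * real N \<longrightarrow> BL1 f \<longrightarrow>
     \<bar>avg n (\<lambda>L. f (walk u L s / path_scale N)) - integral\<^sup>L (gauss \<tau>) f\<bar> < e"
proof (rule ccontr)
  assume neg: "\<not> ?thesis"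
  have "\<exists>N n s u f. k + 1 \<le> N \<and> s \<le> n \<and> \<bar>real s - \<tau> * real N\<bar> \<le> 1 / real (Suc k) * real N \<and> BL1 f \<and>
     e \<le> \<bar>avg n (\<lambda>L. f (walk u L s / path_scale N)) - integral\<^sup>L (gauss \<tau>) f\<bar>" for k :: nat
  proof -
    have "0 < 1 / real (Suc k)" by simp
    then have "\<not> (\<forall>N\<ge>k+1. \<forall>n s u f. s \<le> n \<longrightarrow> \<bar>real s - \<tau> * real N\<bar> \<le> 1 / real (Suc k) * real N \<longrightarrow> BL1 f \<longrightarrow>
     \<bar>avg n (\<lambda>L. f (walk u L s / path_scale N)) - integral\<^sup>L (gauss \<tau>) f\<bar> < e)"
      using neg by blast
    then show ?thesis by (meson not_less)
  qed
  then have "\<forall>k. \<exists>N n s u f. k + 1 \<le> N \<and> s \<le> n \<and> \<bar>real s - \<tau> * real N\<bar> \<le> 1 / real (Suc k) * real N \<and> BL1 f \<and>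
     e \<le> \<bar>avg n (\<lambda>L. f (walk u L s / path_scale N)) - integral\<^sup>L (gauss \<tau>) f\<bar>" by blast
  from choice[OF this] obtain N where "\<forall>k. \<exists>n s u f. k + 1 \<le> N k \<and> s \<le> n \<and> \<bar>real s - \<tau> * real (N k)\<bar> \<le> 1 / real (Suc k) * real (N k) \<and> BL1 f \<and>
     e \<le> \<bar>avg n (\<lambda>L. f (walk u L s / path_scale (N k))) - integral\<^sup>L (gauss \<tau>) f\<bar>" ..
  from choice[OF this] obtain n where "\<forall>k. \<exists>s u f. k + 1 \<le> N k \<and> s \<le> n k \<and> \<bar>real s - \<tau> * real (N k)\<bar> \<le> 1 / real (Suc k) * real (N k) \<and> BL1 f \<and>
     e \<le> \<bar>avg (n k) (\<lambda>L. f (walk u L s / path_scale (N k))) - integral\<^sup>L (gauss \<tau>) f\<bar>" ..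
  from choice[OF this] obtain s where "\<forall>k. \<exists>u f. k + 1 \<le> N k \<and> s k \<le> n k \<and> \<bar>real (s k) - \<tau> * real (N k)\<bar> \<le> 1 / real (Suc k) * real (N k) \<and> BL1 f \<and>
     e \<le> \<bar>avg (n k) (\<lambda>L. f (walk u L (s k) / path_scale (N k))) - integral\<^sup>L (gauss \<tau>) f\<bar>" ..
  from choice[OF this] obtain u where "\<forall>k. \<exists>f. k + 1 \<le> N k \<and> s k \<le> n k \<and> \<bar>real (s k) - \<tau> * real (N k)\<bar> \<le> 1 / real (Suc k) * real (N k) \<and> BL1 f \<and>
     e \<le> \<bar>avg (n k) (\<lambda>L. f (walk (u k) L (s k) / path_scale (N k))) - integral\<^sup>L (gauss \<tau>) f\<bar>" ..
  from choice[OF this] obtain f where X: "\<forall>k. k + 1 \<le> N k \<and> s k \<le> n k \<and> \<bar>real (s k) - \<tau> * real (N k)\<bar> \<le> 1 / real (Suc k) * real (N k) \<and> BL1 (f k) \<and>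
     e \<le> \<bar>avg (n k) (\<lambda>L. f k (walk (u k) L (s k) / path_scale (N k))) - integral\<^sup>L (gauss \<tau>) (f k)\<bar>" ..
  have X: "\<And>k. k + 1 \<le> N k" "\<And>k. s k \<le> n k"
    "\<And>k. \<bar>real (s k) - \<tau> * real (N k)\<bar> \<le> 1 / real (Suc k) * real (N k)" "\<And>k. BL1 (f k)"
    "\<And>k. e \<le> \<bar>avg (n k) (\<lambda>L. f k (walk (u k) L (s k) / path_scale (N k))) - integral\<^sup>L (gauss \<tau>) (f k)\<bar>"
    using X by auto
  have kN: "k \<le> N k" for k using X(1)[of k] by simp
  have N: "filterlim N at_top sequentially"
    by (rule filterlim_at_top_mono[OF filterlim_ident]) (simp add: kN)
  have "(\<lambda>k. real (s k) / real (N k) - \<tau>) \<longlonglongrightarrow> 0"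
  proof (rule Lim_null_comparison[OF always_eventually])
    show "\<forall>k. norm (real (s k) / real (N k) - \<tau>) \<le> 1 / real (Suc k)"
    proof
      fix k
      have p: "0 < real (N k)" using X(1)[of k] by simp
      have "real (s k) / real (N k) - \<tau> = (real (s k) - \<tau> * real (N k)) / real (N k)" using p by (simp add: diff_divide_distrib)
      then show "norm (real (s k) / real (N k) - \<tau>) \<le> 1 / real (Suc k)"
        using X(3)[of k] p by (simp add: pos_divide_le_eq)
    qed
    show "(\<lambda>k. 1 / real (Suc k)) \<longlonglongrightarrow> 0" by (rule LIMSEQ_Suc[OF lim_1_over_n])
  qed
  then have "(\<lambda>k. real (s k) / real (N k)) \<longlonglongrightarrow> \<tau>" by (rule LIM_zero_cancel)
  from weak_conv_uniform_BL1[OF real_distribution_path_law real_distribution_gauss path_law_weak_conv[OF assms(1) N X(2) this] X(4)]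
  have "(\<lambda>k. avg (n k) (\<lambda>L. f k (walk (u k) L (s k) / path_scale (N k))) - integral\<^sup>L (gauss \<tau>) (f k)) \<longlonglongrightarrow> 0"
    by (simp add: integral_path_law BL1_measurable[OF X(4)] path_scale_def)
  from order_tendstoD(2)[OF tendsto_rabs_zero[OF this] assms(2)] obtain k where
    "\<bar>avg (n k) (\<lambda>L. f k (walk (u k) L (s k) / path_scale (N k))) - integral\<^sup>L (gauss \<tau>) (f k)\<bar> < e"
    by (auto simp: eventually_sequentially)
  then show False using X(5)[of k] by simp
qed

section \<open>Convergence over several windows\<close>

text \<open>Functions of \<open>k\<close> variables bounded by \<open>1\<close> with Lipschitz constant \<open>1\<close> for the sum of the distances of the
coordinates. Fixing a coordinate, or integrating it out, leads to the same class for \<open>k - 1\<close> variables.\<close>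

definition BL :: "nat \<Rightarrow> (real list \<Rightarrow> real) \<Rightarrow> bool" where
  "BL k F \<longleftrightarrow> (\<forall>xs. length xs = k \<longrightarrow> \<bar>F xs\<bar> \<le> 1) \<and>
    (\<forall>xs ys. length xs = k \<longrightarrow> length ys = k \<longrightarrow> \<bar>F xs - F ys\<bar> \<le> (\<Sum>i<k. \<bar>xs ! i - ys ! i\<bar>))"

text \<open>The expectation of \<open>F\<close> for \<open>k\<close> independent variables with law \<open>gauss \<tau>\<close>, as an iterated integral.\<close>

fun gaussE :: "nat \<Rightarrow> real \<Rightarrow> (real list \<Rightarrow> real) \<Rightarrow> real" where
  "gaussE 0 \<tau> F = F []"
| "gaussE (Suc k) \<tau> F = (\<integral>x. gaussE k \<tau> (\<lambda>xs. F (x # xs)) \<partial>gauss \<tau>)"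

lemma BL_Cons: "BL (Suc k) F \<Longrightarrow> BL k (\<lambda>xs. F (x # xs))"
  unfolding BL_def
proof (intro conjI allI impI; elim conjE)
  fix xs :: "real list" assume "length xs = k" "\<forall>xs. length xs = Suc k \<longrightarrow> \<bar>F xs\<bar> \<le> 1"
  then show "\<bar>F (x # xs)\<bar> \<le> 1" by simp
next
  fix xs ys :: "real list" assume l: "length xs = k" "length ys = k"
    and F: "\<forall>xs ys. length xs = Suc k \<longrightarrow> length ys = Suc k \<longrightarrow> \<bar>F xs - F ys\<bar> \<le> (\<Sum>i<Suc k. \<bar>xs ! i - ys ! i\<bar>)"
  have "\<bar>F (x # xs) - F (x # ys)\<bar> \<le> (\<Sum>i<Suc k. \<bar>(x # xs) ! i - (x # ys) ! i\<bar>)" using F l by simp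
  then show "\<bar>F (x # xs) - F (x # ys)\<bar> \<le> (\<Sum>i<k. \<bar>xs ! i - ys ! i\<bar>)" unfolding sum.lessThan_Suc_shift by simp
qed

lemma BL_head: "BL (Suc k) F \<Longrightarrow> length xs = k \<Longrightarrow> \<bar>F (x # xs) - F (y # xs)\<bar> \<le> \<bar>x - y\<bar>"
proof -
  assume F: "BL (Suc k) F" and l: "length xs = k"
  have "\<bar>F (x # xs) - F (y # xs)\<bar> \<le> (\<Sum>i<Suc k. \<bar>(x # xs) ! i - (y # xs) ! i\<bar>)" using F l unfolding BL_def by simp
  then show ?thesis unfolding sum.lessThan_Suc_shift by simp
qed

text \<open>Boundedness and stability are proved together, as stability provides the Lipschitz property, hence
the measurability, of the inner integral in the next step.\<close>

lemma gaussE_BL: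
  "(BL k F \<longrightarrow> \<bar>gaussE k \<tau> F\<bar> \<le> 1) \<and>
   (BL k F \<longrightarrow> BL k G \<longrightarrow> (\<forall>xs. length xs = k \<longrightarrow> \<bar>F xs - G xs\<bar> \<le> c) \<longrightarrow> \<bar>gaussE k \<tau> F - gaussE k \<tau> G\<bar> \<le> c)"
proof (induction k arbitrary: F G c)
  case 0
  then show ?case by (auto simp: BL_def)
next
  case (Suc k)
  interpret g: prob_space "gauss \<tau>" by (rule prob_space_gauss)
  have bl: "BL1 (\<lambda>x. gaussE k \<tau> (\<lambda>xs. F (x # xs)))" if F: "BL (Suc k) F" for F
    unfolding BL1_def using Suc BL_Cons[OF F] BL_head[OF F] by blast
  have i: "integrable (gauss \<tau>) (\<lambda>x. gaussE k \<tau> (\<lambda>xs. F (x # xs)))" if F: "BL (Suc k) F" for F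
    using bl[OF F] BL1_measurable[OF bl[OF F]]
    by (intro g.integrable_const_bound[where B = 1]) (auto simp: BL1_def measurable_cong_sets[OF sets_gauss(1) refl])
  show ?case
  proof (intro conjI impI)
    assume F: "BL (Suc k) F"
    have "norm (gaussE (Suc k) \<tau> F) \<le> (\<integral>x. 1 \<partial>gauss \<tau>)"
      unfolding gaussE.simps using bl[OF F] i[OF F] by (intro integral_norm_bound_AE AE_I2) (auto simp: BL1_def)
    then show "\<bar>gaussE (Suc k) \<tau> F\<bar> \<le> 1" by (simp add: g.prob_space[simplified])
  next
    assume F: "BL (Suc k) F" and G: "BL (Suc k) G" and c: "\<forall>xs. length xs = Suc k \<longrightarrow> \<bar>F xs - G xs\<bar> \<le> c"
    have "norm (\<integral>x. gaussE k \<tau> (\<lambda>xs. F (x # xs)) - gaussE k \<tau> (\<lambda>xs. G (x # xs)) \<partial>gauss \<tau>) \<le> (\<integral>x. c \<partial>gauss \<tau>)"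
    proof (intro integral_norm_bound_AE AE_I2)
      fix x
      show "norm (gaussE k \<tau> (\<lambda>xs. F (x # xs)) - gaussE k \<tau> (\<lambda>xs. G (x # xs))) \<le> c"
        using Suc[of "\<lambda>xs. F (x # xs)" "\<lambda>xs. G (x # xs)" c] BL_Cons[OF F] BL_Cons[OF G] c by simp
    qed (use i[OF F] i[OF G] in auto)
    then show "\<bar>gaussE (Suc k) \<tau> F - gaussE (Suc k) \<tau> G\<bar> \<le> c"
      using i[OF F] i[OF G] by (simp add: g.prob_space[simplified])
  qed
qed

lemma gaussE_BL1: "BL (Suc k) F \<Longrightarrow> BL1 (\<lambda>x. gaussE k \<tau> (\<lambda>xs. F (x # xs)))"
  unfolding BL1_def using gaussE_BL BL_Cons BL_head by blast

text \<open>The increments over consecutive windows of areas \<open>as\<close>, where the first \<open>v\<close> cells of the first window were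
already used by the block straddling its start.\<close>

fun incs :: "nat list \<Rightarrow> nat \<Rightarrow> nat \<Rightarrow> block list \<Rightarrow> real list" where
  "incs [] u v L = []"
| "incs (a # as) u v L = walk u L (a - v) # incs as (cut_u u L (a - v)) (cut_over L (a - v) + (v - a)) (cut_rest L (a - v))"

lemma length_incs [simp]: "length (incs as u v L) = length as"
  by (induction as arbitrary: u v L) auto

lemma avg_over_large:
  assumes "0 < r" "\<And>n r. 0 < r \<Longrightarrow> avg n (\<lambda>L. of_bool (\<exists>b\<in>set L. r < real (bsize b))) \<le> C * real n / r ^ 4"
  shows "avg n (\<lambda>L. of_bool (r < real (cut_over L s))) \<le> C * real n / r ^ 4"
proof -
  have "\<exists>b\<in>set L. r < real (bsize b)" if "r < real (cut_over L s)" for L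
  proof -
    have 1: "nat \<lfloor>r\<rfloor> < cut_over L s" using that assms(1) by linarith
    obtain b where "b \<in> set L" "nat \<lfloor>r\<rfloor> < bsize b" using cut_over_le[OF 1] by blast
    moreover then have "r < real (bsize b)" using assms(1) by linarith
    ultimately show ?thesis by blast
  qed
  then have "avg n (\<lambda>L. of_bool (r < real (cut_over L s))) \<le> avg n (\<lambda>L. of_bool (\<exists>b\<in>set L. r < real (bsize b)) :: real)"
    by (intro avg_mono) (auto simp: of_bool_def)
  then show ?thesis using assms(2)[OF assms(1), of n] by linarith
qed

text \<open>Induction on the number of windows. The Markov property at the end of the first window and the
induction hypothesis replace the other increments by Gaussian variables, uniformly in the
first increment; then \<open>uniform_CLT\<close> is applied to the remaining function of one variable. The overshoot
into the next window is negligible except on an event that requires a large block.\<close>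

lemma fidi_CLT:
  assumes \<tau>: "0 < \<tau>" "\<tau> \<le> 1"
  shows "0 < e \<Longrightarrow> \<exists>d>0. \<exists>N0. \<forall>N\<ge>N0. \<forall>n u v as F. length as = k \<longrightarrow> (\<forall>a\<in>set as. \<bar>real a - \<tau> * real N\<bar> \<le> d * real N) \<longrightarrow>
     real v \<le> d * real N \<longrightarrow> n \<le> N \<longrightarrow> sum_list as \<le> n + v \<longrightarrow> BL k F \<longrightarrow>
     \<bar>avg n (\<lambda>L. F (map (\<lambda>m. m / path_scale N) (incs as u v L))) - gaussE k \<tau> F\<bar> < e"
proof (induction k arbitrary: e)
  case 0
  then show ?case by (intro exI[of _ 1] conjI exI[of _ 0]) (auto simp: avg_const)
next
  case (Suc k)
  obtain C where C: "0 \<le> C" "\<And>n r. 0 < r \<Longrightarrow> avg n (\<lambda>L. of_bool (\<exists>b\<in>set L. r < real (bsize b))) \<le> C * real n / r ^ 4"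
    using avg_large_block by blast
  have e4: "0 < e / 4" using Suc.prems by simp
  obtain d1 N1 where 1: "0 < d1" "\<And>N n u v as F. N1 \<le> N \<Longrightarrow> length as = k \<Longrightarrow> (\<forall>a\<in>set as. \<bar>real a - \<tau> * real N\<bar> \<le> d1 * real N) \<Longrightarrow>
     real v \<le> d1 * real N \<Longrightarrow> n \<le> N \<Longrightarrow> sum_list as \<le> n + v \<Longrightarrow> BL k F \<Longrightarrow>
     \<bar>avg n (\<lambda>L. F (map (\<lambda>m. m / path_scale N) (incs as u v L))) - gaussE k \<tau> F\<bar> < e / 4"
    using Suc.IH[OF e4] by blast
  obtain d2 N2 where 2: "0 < d2" "\<And>N n s u f. N2 \<le> N \<Longrightarrow> s \<le> n \<Longrightarrow> \<bar>real s - \<tau> * real N\<bar> \<le> d2 * real N \<Longrightarrow> BL1 f \<Longrightarrow>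
     \<bar>avg n (\<lambda>L. f (walk u L s / path_scale N)) - integral\<^sup>L (gauss \<tau>) f\<bar> < e / 4"
    using uniform_CLT[OF less_imp_le[OF \<tau>(1)] e4] by blast
  \<comment> \<open>The overshoot shortens the first window by up to \<open>d * N\<close>, hence \<open>d2 / 2\<close>; \<open>\<tau> / 4\<close> keeps it from being used up.\<close>
  define d where "d = min (min d1 (d2 / 2)) (\<tau> / 4)"
  have d: "0 < d" "d \<le> d1" "2 * d \<le> d2" "d \<le> \<tau> / 4" using 1(1) 2(1) \<tau> by (auto simp: d_def)
  define N3 where "N3 = Suc (nat \<lceil>8 * C / (d1 ^ 4 * e)\<rceil>)"
  show ?case
  proof (rule exI[of _ d], intro conjI d(1) exI[of _ "max N3 (max N1 N2)"] allI impI)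
    fix N n u v as F
    assume N: "max N3 (max N1 N2) \<le> N" and len: "length as = Suc k"
      and as: "\<forall>a\<in>set as. \<bar>real a - \<tau> * real N\<bar> \<le> d * real N"
      and v: "real v \<le> d * real N" and n: "n \<le> N" and sum: "sum_list as \<le> n + v" and F: "BL (Suc k) F"
    obtain a bs where ab: "as = a # bs" "length bs = k" using len by (cases as) auto
    have N0: "0 < real N" using N by (simp add: N3_def)
    have dN: "d * real N \<le> d1 * real N" "2 * d * real N \<le> d2 * real N" "d * real N \<le> \<tau> * real N / 4"
      using d N0 by (auto simp: mult_right_mono)
    have a: "\<bar>real a - \<tau> * real N\<bar> \<le> d * real N" using as ab by simp
    have dp: "0 < d * real N" using d N0 by simp
    have va: "v \<le> a" using a v dN(3) dp by linarith
    define s where "s = a - v"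
    have sn: "s \<le> n" using sum va ab by (simp add: s_def)
    have sr: "\<bar>real s - \<tau> * real N\<bar> \<le> d2 * real N" using a v dN(2) va by (simp add: s_def of_nat_diff)
    define F' where "F' m w v' L = F (m / path_scale N # map (\<lambda>m. m / path_scale N) (incs bs w v' L))" for m w v' L
    define \<phi> where "\<phi> x = gaussE k \<tau> (\<lambda>xs. F (x # xs))" for x
    have \<phi>: "BL1 \<phi>" unfolding \<phi>_def[abs_def] by (rule gaussE_BL1[OF F])
    have "avg n (\<lambda>L. F (map (\<lambda>m. m / path_scale N) (incs as u v L))) = avg n (\<lambda>L. F' (walk u L s) (cut_u u L s) (cut_over L s) (cut_rest L s))"
      using va by (simp add: ab F'_def s_def)
    also have "\<dots> = avg n (\<lambda>L. avg (n - s - cut_over L s) (F' (walk u L s) (cut_u u L s) (cut_over L s)))" by (rule avg_cut[OF sn])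
    finally have eq: "avg n (\<lambda>L. F (map (\<lambda>m. m / path_scale N) (incs as u v L))) = avg n (\<lambda>L. avg (n - s - cut_over L s) (F' (walk u L s) (cut_u u L s) (cut_over L s)))" .
    have Fb: "\<bar>F' m w v' L\<bar> \<le> 1" for m w v' L using F ab by (simp add: BL_def F'_def)
    have inner: "\<bar>avg (n - s - cut_over L s) (F' (walk u L s) (cut_u u L s) (cut_over L s)) - \<phi> (walk u L s / path_scale N)\<bar> \<le> e / 4 + 2 * of_bool (d1 * real N < real (cut_over L s))" for L
    proof (cases "d1 * real N < real (cut_over L s)")
      case True
      have "norm (avg (n - s - cut_over L s) (F' (walk u L s) (cut_u u L s) (cut_over L s))) \<le> 1" by (rule avg_bound) (use Fb in auto)
      moreover have "\<bar>\<phi> (walk u L s / path_scale N)\<bar> \<le> 1" using \<phi> by (simp add: BL1_def)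
      ultimately show ?thesis using True e4 by (simp add: abs_le_iff)
    next
      case False
      have "\<bar>avg (n - s - cut_over L s) (\<lambda>L'. (\<lambda>xs. F (walk u L s / path_scale N # xs)) (map (\<lambda>m. m / path_scale N) (incs bs (cut_u u L s) (cut_over L s) L')))
         - gaussE k \<tau> (\<lambda>xs. F (walk u L s / path_scale N # xs))\<bar> < e / 4"
      proof (rule 1(2))
        show "N1 \<le> N" using N by simp
        show "\<forall>a\<in>set bs. \<bar>real a - \<tau> * real N\<bar> \<le> d1 * real N" using as ab dN(1) by fastforce
        show "real (cut_over L s) \<le> d1 * real N" using False by simp
        show "n - s - cut_over L s \<le> N" using n by simp
        show "sum_list bs \<le> n - s - cut_over L s + cut_over L s" using sum va ab by (simp add: s_def)
        show "BL k (\<lambda>xs. F (walk u L s / path_scale N # xs))" by (rule BL_Cons[OF F])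
      qed (use ab in auto)
      then show ?thesis using False unfolding F'_def \<phi>_def by simp
    qed
    have "\<bar>avg n (\<lambda>L. avg (n - s - cut_over L s) (F' (walk u L s) (cut_u u L s) (cut_over L s))) - avg n (\<lambda>L. \<phi> (walk u L s / path_scale N))\<bar>
       \<le> avg n (\<lambda>L. e / 4 + 2 * of_bool (d1 * real N < real (cut_over L s)))"
    proof -
      have "norm (avg n (\<lambda>L. avg (n - s - cut_over L s) (F' (walk u L s) (cut_u u L s) (cut_over L s)) - \<phi> (walk u L s / path_scale N)))
        \<le> avg n (\<lambda>L. norm (avg (n - s - cut_over L s) (F' (walk u L s) (cut_u u L s) (cut_over L s)) - \<phi> (walk u L s / path_scale N)))"
        by (rule avg_norm)
      also have "\<dots> \<le> avg n (\<lambda>L. e / 4 + 2 * of_bool (d1 * real N < real (cut_over L s)))"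
        using inner by (intro avg_mono) simp
      finally show ?thesis by (simp add: avg_diff)
    qed
    also have "\<dots> = e / 4 + 2 * avg n (\<lambda>L. of_bool (d1 * real N < real (cut_over L s)))"
      by (simp add: avg_add avg_mult avg_const)
    also have "avg n (\<lambda>L. of_bool (d1 * real N < real (cut_over L s))) \<le> e / 8"
    proof -
      have p: "0 < d1 * real N" using 1(1) N0 by simp
      have "avg n (\<lambda>L. of_bool (d1 * real N < real (cut_over L s))) \<le> C * real n / (d1 * real N) ^ 4"
        by (rule avg_over_large[OF p C(2)])
      also have "\<dots> \<le> C * real N / (d1 * real N) ^ 4" using C(1) n p by (intro divide_right_mono mult_left_mono) auto
      also have "\<dots> = C / d1 ^ 4 / real N ^ 3" using N0 by (simp add: power_mult_distrib field_simps eval_nat_numeral)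
      also have "\<dots> \<le> C / d1 ^ 4 / real N" 
      proof -
        have "real N ^ 1 \<le> real N ^ 3" using N0 by (intro power_increasing) (auto simp: Suc_leI)
        then show ?thesis using C(1) 1(1) N0 by (intro divide_left_mono) auto
      qed
      also have "\<dots> \<le> e / 8"
      proof -
        have "8 * C / (d1 ^ 4 * e) \<le> real N" using N unfolding N3_def by linarith
        then show ?thesis using 1(1) Suc.prems N0 by (simp add: field_simps)
      qed
      finally show ?thesis .
    qed
    finally have "\<bar>avg n (\<lambda>L. avg (n - s - cut_over L s) (F' (walk u L s) (cut_u u L s) (cut_over L s))) - avg n (\<lambda>L. \<phi> (walk u L s / path_scale N))\<bar> \<le> e / 4 + 2 * (e / 8)" by simp
    moreover have "\<bar>avg n (\<lambda>L. \<phi> (walk u L s / path_scale N)) - integral\<^sup>L (gauss \<tau>) \<phi>\<bar> < e / 4"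
      by (rule 2(2)[OF _ sn sr \<phi>]) (use N in simp)
    moreover have "gaussE (Suc k) \<tau> F = integral\<^sup>L (gauss \<tau>) \<phi>" by (simp add: \<phi>_def[abs_def])
    ultimately show "\<bar>avg n (\<lambda>L. F (map (\<lambda>m. m / path_scale N) (incs as u v L))) - gaussE (Suc k) \<tau> F\<bar> < e"
      unfolding eq using Suc.prems by linarith
  qed
qed

section \<open>Step functions and distances in the Skorokhod space\<close>

text \<open>The linear term covers the centring of the perimeter process.\<close>

lemma floor_step_D01:
  fixes g :: "nat \<Rightarrow> real" and c :: real
  shows "(\<lambda>t\<in>{0..1}. g (nat \<lfloor>real k * t\<rfloor>) + c * t) \<in> D01"
  unfolding D01_def
proof (intro CollectI conjI ballI)
  let ?f = "\<lambda>t\<in>{0..1}. g (nat \<lfloor>real k * t\<rfloor>) + c * t"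
  show "?f \<in> extensional {0..1}" by simp
  fix t :: real assume t: "t \<in> {0..<1}"
  define b where "b = (if k = 0 then 1 else min 1 ((of_int \<lfloor>real k * t\<rfloor> + 1) / real k))"
  have b: "t < b"
  proof (cases "k = 0")
    case False
    have "real k * t < of_int \<lfloor>real k * t\<rfloor> + 1" by linarith
    then show ?thesis using False t by (simp add: b_def less_divide_eq mult.commute)
  qed (use t in \<open>simp add: b_def\<close>)
  have eq: "?f u = g (nat \<lfloor>real k * t\<rfloor>) + c * u" if u: "t < u" "u < b" for u
  proof -
    have "\<lfloor>real k * u\<rfloor> = \<lfloor>real k * t\<rfloor>"
    proof (cases "k = 0")
      case False
      have "real k * u < of_int \<lfloor>real k * t\<rfloor> + 1" using u False by (simp add: b_def less_divide_eq mult.commute)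
      moreover have "real k * t \<le> real k * u" using u by (intro mult_left_mono) auto
      ultimately show ?thesis by (intro floor_unique) linarith+
    qed simp
    moreover have "u \<in> {0..1}" using u t by (auto simp: b_def split: if_splits)
    ultimately show ?thesis by simp
  qed
  show "continuous (at_right t) ?f"
    unfolding continuous_within
  proof (rule Lim_transform_eventually)
    have "((\<lambda>u. g (nat \<lfloor>real k * t\<rfloor>) + c * u) \<longlongrightarrow> g (nat \<lfloor>real k * t\<rfloor>) + c * t) (at_right t)" by (intro tendsto_intros)
    then show "((\<lambda>u. g (nat \<lfloor>real k * t\<rfloor>) + c * u) \<longlongrightarrow> ?f t) (at_right t)" using t by simp
    show "\<forall>\<^sub>F u in at_right t. g (nat \<lfloor>real k * t\<rfloor>) + c * u = ?f u"
      unfolding eventually_at_right_field using b eq by (intro exI[of _ b]) auto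
  qed
next
  let ?f = "\<lambda>t\<in>{0..1}. g (nat \<lfloor>real k * t\<rfloor>) + c * t"
  fix t :: real assume t: "t \<in> {0<..1}"
  define m where "m = \<lceil>real k * t\<rceil> - 1"
  define b where "b = (if k = 0 then 0 else max 0 (of_int m / real k))"
  have b: "b < t"
  proof (cases "k = 0")
    case False
    have "of_int m < real k * t" unfolding m_def by linarith
    then show ?thesis using False t by (simp add: b_def divide_less_eq mult.commute)
  qed (use t in \<open>simp add: b_def\<close>)
  define v where "v = (if k = 0 then 0 else m)"
  have eq: "?f u = g (nat v) + c * u" if u: "b < u" "u < t" for u
  proof -
    have "\<lfloor>real k * u\<rfloor> = v"
    proof (cases "k = 0")
      case False
      have "of_int m < real k * u" using u False by (simp add: b_def divide_less_eq mult.commute)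
      moreover have "real k * u < real k * t" using u False by simp
      ultimately have "\<lfloor>real k * u\<rfloor> = m" unfolding m_def by linarith
      then show ?thesis using False by (simp add: v_def)
    qed (simp add: v_def)
    moreover have "u \<in> {0..1}" using u t by (auto simp: b_def split: if_splits)
    ultimately show ?thesis by simp
  qed
  show "\<exists>l. (?f \<longlongrightarrow> l) (at_left t)"
  proof (rule exI, rule Lim_transform_eventually)
    show "((\<lambda>u. g (nat v) + c * u) \<longlongrightarrow> g (nat v) + c * t) (at_left t)" by (intro tendsto_intros)
    show "\<forall>\<^sub>F u in at_left t. g (nat v) + c * u = ?f u"
      unfolding eventually_at_left_field using b eq by (intro exI[of _ b]) auto
  qed
qed

lemma perimeter_process_D01: "perimeter_process n P \<in> D01"
proof -
  let ?d = "sqrt (real n) * sigma4"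
  have "perimeter_process n P = (\<lambda>t\<in>{0..1}. of_int (Rbar P (nat \<lfloor>real n * t\<rfloor>)) / ?d + (- mu4 * real n / ?d) * t)"
    unfolding perimeter_process_def by (intro restrict_ext) (simp add: diff_divide_distrib)
  then show ?thesis using floor_step_D01[of "\<lambda>m. of_int (Rbar P m) / ?d" n "- mu4 * real n / ?d"] by simp
qed

definition stepf :: "nat \<Rightarrow> (nat \<Rightarrow> real) \<Rightarrow> real \<Rightarrow> real" where
  "stepf k v = (\<lambda>t\<in>{0..1}. v (nat \<lfloor>real k * t\<rfloor>))"

lemma stepf_D01: "stepf k v \<in> D01"
  using floor_step_D01[of v k 0] by (simp add: stepf_def)

lemma skorokhod_dist_le_sup:
  assumes "x \<in> D01" "y \<in> D01" "\<And>t. t \<in> {0..1} \<Longrightarrow> \<bar>x t - y t\<bar> \<le> e"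
  shows "skorokhod_dist x y \<le> e"
proof (rule field_le_epsilon)
  fix d :: real assume d: "0 < d"
  have e: "0 \<le> e" using assms(3)[of 0] by simp
  have "skorokhod_close (e + d / 2) x y"
  proof -
    have "\<bar>x t - y t\<bar> \<le> e + d / 2" if "t \<in> {0..1}" for t using assms(3)[OF that] d by linarith
    then show ?thesis unfolding skorokhod_close_def using e d
      by (intro bexI[OF _ id_time_change]) auto
  qed
  then have "skorokhod_dist x y < e + d"
    unfolding skorokhod_dist_less_iff[OF assms(1,2)] using e d by (intro exI[of _ "e + d / 2"]) auto
  then show "skorokhod_dist x y \<le> e + d" by simp
qed

lemma nat_floor_le: "t \<in> {0..1} \<Longrightarrow> nat \<lfloor>real k * t\<rfloor> \<le> k"
proof -
  assume "t \<in> {0..1}"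
  then have "real k * t \<le> real k * 1" by (intro mult_left_mono) auto
  then show ?thesis by linarith
qed

section \<open>Bounded Lipschitz functions determine weak convergence\<close>

text \<open>The quantification over all Lipschitz constants makes the class closed under scaling.\<close>

definition BL_D01 :: "((real \<Rightarrow> real) \<Rightarrow> real) \<Rightarrow> bool" where
  "BL_D01 g \<longleftrightarrow> (\<exists>B. \<forall>x\<in>D01. \<bar>g x\<bar> \<le> B) \<and> (\<exists>K\<ge>0. \<forall>x\<in>D01. \<forall>y\<in>D01. \<bar>g x - g y\<bar> \<le> K * skorokhod_dist x y)"

text \<open>Used in two ways: with \<open>h = 0\<close> it is the distance from a set, and with \<open>h = f\<close> and growing \<open>m\<close> it
approximates a continuous function \<open>f\<close> from below.\<close>

lemma inf_convolution_Lipschitz: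
  assumes A: "A \<subseteq> D01" "A \<noteq> {}" and m: "0 \<le> m" and h: "\<And>y. y \<in> A \<Longrightarrow> - B \<le> h y"
    and x: "x \<in> D01" "x' \<in> D01"
  shows "\<bar>(INF y\<in>A. h y + m * skorokhod_dist x y) - (INF y\<in>A. h y + m * skorokhod_dist x' y)\<bar> \<le> m * skorokhod_dist x x'"
proof -
  have bdd: "bdd_below ((\<lambda>y. h y + m * skorokhod_dist x y) ` A)" for x
    using h m skorokhod_dist_nonneg by (intro bdd_belowI2[of _ "- B"]) (simp add: add_increasing2)
  have 1: "(INF y\<in>A. h y + m * skorokhod_dist x y) - m * skorokhod_dist x x' \<le> (INF y\<in>A. h y + m * skorokhod_dist x' y)"
    if x: "x \<in> D01" "x' \<in> D01" for x x'
  proof (rule cINF_greatest[OF A(2)])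
    fix y assume y: "y \<in> A"
    have "(INF y\<in>A. h y + m * skorokhod_dist x y) \<le> h y + m * skorokhod_dist x y" by (rule cINF_lower[OF bdd y])
    also have "\<dots> \<le> h y + m * (skorokhod_dist x x' + skorokhod_dist x' y)"
      using skorokhod.triangle[OF x, of y] y A m by (intro add_left_mono mult_left_mono) auto
    finally show "(INF y\<in>A. h y + m * skorokhod_dist x y) - m * skorokhod_dist x x' \<le> h y + m * skorokhod_dist x' y"
      by (simp add: distrib_left)
  qed
  show ?thesis using 1[OF x] 1[OF x(2,1)] skorokhod.commute[of x x'] by (simp add: abs_le_iff)
qed

text \<open>A bounded continuous \<open>f\<close> is the increasing limit of its inf-convolutions with \<open>m\<close> times the distance, which
are bounded and Lipschitz. This bounds the limit inferior of the integrals of \<open>f\<close> from below, and the same holds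
for \<open>- f\<close>. Measurability of the limit variable follows in the same spirit: an open set is where the truncated
distance from its complement is positive.\<close>

lemma converges_in_distribution_Lipschitz:
  fixes p :: "nat \<Rightarrow> 'a pmf" and X :: "nat \<Rightarrow> 'a \<Rightarrow> real \<Rightarrow> real" and Y :: "'b \<Rightarrow> real \<Rightarrow> real"
  assumes M: "prob_space M"
    and X: "\<And>n \<omega>. X n \<omega> \<in> D01" and Y: "\<And>\<omega>. \<omega> \<in> space M \<Longrightarrow> Y \<omega> \<in> D01"
    and meas: "\<And>g. BL_D01 g \<Longrightarrow> (\<lambda>\<omega>. g (Y \<omega>)) \<in> borel_measurable M"
    and conv: "\<And>g. BL_D01 g \<Longrightarrow> (\<lambda>n. measure_pmf.expectation (p n) (\<lambda>\<omega>. g (X n \<omega>))) \<longlonglongrightarrow> (\<integral>\<omega>. g (Y \<omega>) \<partial>M)"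
  shows "converges_in_distribution skorokhod_topology (\<lambda>n. measure_pmf (p n)) X M Y"
proof -
  interpret prob_space M by fact
  have sub: "{U. openin skorokhod_topology U} \<subseteq> Pow D01"
    using openin_subset[of skorokhod_topology] by auto
  have Xm: "X n \<in> measurable (measure_pmf (p n)) (borel_on skorokhod_topology)" for n
    using X sub by (simp add: borel_on_def)
  have Ym: "Y \<in> measurable M (borel_on skorokhod_topology)"
    unfolding borel_on_def skorokhod.topspace_mtopology
  proof (rule measurable_measure_of[OF sub])
    show "Y \<in> space M \<rightarrow> D01" using Y by auto
    fix U assume "U \<in> {U. openin skorokhod_topology U}"
    then have U: "U \<subseteq> D01" "\<And>x. x \<in> U \<Longrightarrow> \<exists>r>0. skorokhod.mball x r \<subseteq> U"
      by (auto simp: skorokhod.openin_mtopology)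
    show "Y -` U \<inter> space M \<in> sets M"
    proof (cases "D01 - U = {}")
      case True
      then have "Y -` U \<inter> space M = space M" using Y by auto
      then show ?thesis by simp
    next
      case C: False
      let ?I = "\<lambda>x. INF y\<in>D01 - U. 0 + 1 * skorokhod_dist x y"
      let ?g = "\<lambda>x. min 1 (?I x)"
      have bdd: "bdd_below ((\<lambda>y. 0 + 1 * skorokhod_dist x y) ` (D01 - U))" for x
        using skorokhod_dist_nonneg by (intro bdd_belowI2[of _ 0]) simp
      have I0: "0 \<le> ?I x" for x by (rule cINF_greatest[OF C]) (simp add: skorokhod_dist_nonneg)
      have lip: "\<bar>?I x - ?I y\<bar> \<le> 1 * skorokhod_dist x y" if "x \<in> D01" "y \<in> D01" for x y
        by (rule inf_convolution_Lipschitz[OF _ C, of 1 0 "\<lambda>_. 0"]) (use that in auto)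
      have "BL_D01 ?g"
        unfolding BL_D01_def
      proof (intro conjI exI[of _ 1] ballI)
        fix x show "\<bar>?g x\<bar> \<le> 1" using I0[of x] by (simp add: min_def)
      next
        fix x y assume "x \<in> D01" "y \<in> D01"
        from lip[OF this] show "\<bar>?g x - ?g y\<bar> \<le> 1 * skorokhod_dist x y" unfolding min_def by (simp split: if_splits) linarith
      qed simp
      then have "(\<lambda>\<omega>. ?g (Y \<omega>)) \<in> borel_measurable M" by (rule meas)
      then have "{\<omega> \<in> space M. 0 < ?g (Y \<omega>)} \<in> sets M" by measurable
      also have "{\<omega> \<in> space M. 0 < ?g (Y \<omega>)} = Y -` U \<inter> space M"
      proof -
        have "0 < ?I x \<longleftrightarrow> x \<in> U" if x: "x \<in> D01" for x
        proof
          assume pos: "0 < ?I x"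
          show "x \<in> U"
          proof (rule ccontr)
            assume "x \<notin> U"
            then have "?I x \<le> 0 + 1 * skorokhod_dist x x" using x by (intro cINF_lower[OF bdd]) auto
            also have "\<dots> = 0" using skorokhod.zero[OF x x] by simp
            finally show False using pos by simp
          qed
        next
          assume "x \<in> U"
          then obtain r where r: "r > 0" "skorokhod.mball x r \<subseteq> U" using U(2) by blast
          have "r \<le> ?I x"
          proof (rule cINF_greatest[OF C])
            fix y assume "y \<in> D01 - U"
            then have "\<not> skorokhod_dist x y < r" using r(2) x by (auto simp: skorokhod.in_mball)
            then show "r \<le> 0 + 1 * skorokhod_dist x y" by simp
          qed
          then show "0 < ?I x" using r(1) by simp
        qed
        then show ?thesis using Y by auto
      qed
      finally show ?thesis .
    qed
  qed
  have main: "(\<lambda>\<omega>. f (Y \<omega>)) \<in> borel_measurable M \<and>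
     (\<forall>e>0. \<exists>n0. \<forall>n\<ge>n0. (\<integral>\<omega>. f (Y \<omega>) \<partial>M) - e < measure_pmf.expectation (p n) (\<lambda>\<omega>. f (X n \<omega>)))"
    if f: "continuous_map skorokhod_topology euclideanreal f" and B: "\<And>x. x \<in> D01 \<Longrightarrow> \<bar>f x\<bar> \<le> B" for f B
  proof -
    define I where "I m x = (INF y\<in>D01. f y + real m * skorokhod_dist x y)" for m x
    have ne: "D01 \<noteq> {}" using stepf_D01 by blast
    have fB: "- B \<le> f y" if "y \<in> D01" for y using B[OF that] by (simp add: abs_le_iff)
    have bdd: "bdd_below ((\<lambda>y. f y + real m * skorokhod_dist x y) ` D01)" for x m
      using fB skorokhod_dist_nonneg by (intro bdd_belowI2[of _ "- B"]) (simp add: add_increasing2)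
    have I_le: "I m x \<le> f x" if x: "x \<in> D01" for m x
    proof -
      have "I m x \<le> f x + real m * skorokhod_dist x x" unfolding I_def by (rule cINF_lower[OF bdd x])
      then show ?thesis using skorokhod.zero[OF x x] by simp
    qed
    have I_ge: "- B \<le> I m x" for m x unfolding I_def
      using fB skorokhod_dist_nonneg by (intro cINF_greatest[OF ne]) (simp add: add_increasing2)
    have I_abs: "\<bar>I m x\<bar> \<le> B" if "x \<in> D01" for m x
      using I_le[OF that, of m] I_ge[of m x] B[OF that] by (simp add: abs_le_iff)
    have I_BL_D01: "BL_D01 (I m)" for m
      unfolding BL_D01_def
    proof (rule conjI)
      show "\<exists>B. \<forall>x\<in>D01. \<bar>I m x\<bar> \<le> B" using I_abs by blast
      have "\<bar>I m x - I m y\<bar> \<le> real m * skorokhod_dist x y" if xy: "x \<in> D01" "y \<in> D01" for x y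
        unfolding I_def by (rule inf_convolution_Lipschitz[OF order_refl ne _ fB xy]) simp
      then show "\<exists>K\<ge>0. \<forall>x\<in>D01. \<forall>y\<in>D01. \<bar>I m x - I m y\<bar> \<le> K * skorokhod_dist x y"
        by (intro exI[of _ "real m"]) simp
    qed
    have I_lim: "(\<lambda>m. I m x) \<longlonglongrightarrow> f x" if x: "x \<in> D01" for x
    proof (rule LIMSEQ_I)
      fix e :: real assume e: "0 < e"
      have "openin skorokhod_topology {y \<in> topspace skorokhod_topology. f y \<in> ball (f x) (e / 2)}"
        by (rule openin_continuous_map_preimage[OF f]) simp
      moreover have "x \<in> {y \<in> topspace skorokhod_topology. f y \<in> ball (f x) (e / 2)}" using x e by simp
      ultimately obtain r where r: "r > 0" "skorokhod.mball x r \<subseteq> {y \<in> topspace skorokhod_topology. f y \<in> ball (f x) (e / 2)}"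
        unfolding skorokhod.openin_mtopology by blast
      obtain m0 :: nat where m0: "2 * B / r < real m0" using reals_Archimedean2 by blast
      have "norm (I m x - f x) < e" if m: "m0 \<le> m" for m
      proof -
        have "f x - e / 2 \<le> I m x"
          unfolding I_def
        proof (rule cINF_greatest[OF ne])
          fix y assume y: "y \<in> D01"
          show "f x - e / 2 \<le> f y + real m * skorokhod_dist x y"
          proof (cases "skorokhod_dist x y < r")
            case True
            then have "y \<in> skorokhod.mball x r" using x y by (simp add: skorokhod.in_mball)
            then have "dist (f x) (f y) < e / 2" using r(2) by auto
            moreover have "0 \<le> real m * skorokhod_dist x y" using skorokhod_dist_nonneg by simp
            ultimately show ?thesis unfolding dist_real_def by linarith
          next
            case False
            have "2 * B < real m0 * r" using m0 r(1) by (simp add: divide_less_eq)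
            also have "\<dots> \<le> real m * skorokhod_dist x y" using m False r(1) by (intro mult_mono) auto
            finally show ?thesis using B[OF x] B[OF y] e unfolding abs_le_iff by linarith
          qed
        qed
        then show ?thesis using I_le[OF x, of m] e by simp
      qed
      then show "\<exists>m0. \<forall>m\<ge>m0. norm (I m x - f x) < e" by blast
    qed
    have fm: "(\<lambda>\<omega>. f (Y \<omega>)) \<in> borel_measurable M"
      by (rule borel_measurable_LIMSEQ_real[where u = "\<lambda>m \<omega>. I m (Y \<omega>)"]) (use I_lim Y meas[OF I_BL_D01] in auto)
    have dct: "(\<lambda>m. \<integral>\<omega>. I m (Y \<omega>) \<partial>M) \<longlonglongrightarrow> (\<integral>\<omega>. f (Y \<omega>) \<partial>M)"
      by (rule integral_dominated_convergence[where w = "\<lambda>_. B"]) (use I_lim Y meas[OF I_BL_D01] fm I_abs in auto)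
    have "\<exists>n0. \<forall>n\<ge>n0. (\<integral>\<omega>. f (Y \<omega>) \<partial>M) - e < measure_pmf.expectation (p n) (\<lambda>\<omega>. f (X n \<omega>))" if e: "0 < e" for e
    proof -
      obtain m where m: "(\<integral>\<omega>. f (Y \<omega>) \<partial>M) - e / 2 < (\<integral>\<omega>. I m (Y \<omega>) \<partial>M)"
        using order_tendstoD(1)[OF dct, of "(\<integral>\<omega>. f (Y \<omega>) \<partial>M) - e / 2"] e by (auto simp: eventually_sequentially)
      obtain n0 where n0: "\<And>n. n \<ge> n0 \<Longrightarrow> (\<integral>\<omega>. I m (Y \<omega>) \<partial>M) - e / 2 < measure_pmf.expectation (p n) (\<lambda>\<omega>. I m (X n \<omega>))"
        using order_tendstoD(1)[OF conv[OF I_BL_D01[of m]], of "(\<integral>\<omega>. I m (Y \<omega>) \<partial>M) - e / 2"] e by (auto simp: eventually_sequentially)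
      have "measure_pmf.expectation (p n) (\<lambda>\<omega>. I m (X n \<omega>)) \<le> measure_pmf.expectation (p n) (\<lambda>\<omega>. f (X n \<omega>))" for n
        by (rule integral_mono) (use I_abs I_le X B in \<open>auto intro!: measure_pmf.integrable_const_bound[where B = B]\<close>)
      then show ?thesis using m n0 by (intro exI[of _ n0]) (smt (verit) field_sum_of_halves)
    qed
    then show ?thesis using fm by blast
  qed
  have "(\<lambda>n. measure_pmf.expectation (p n) (\<lambda>\<omega>. f (X n \<omega>))) \<longlonglongrightarrow> (\<integral>\<omega>. f (Y \<omega>) \<partial>M)"
    if f: "continuous_map skorokhod_topology euclideanreal f" "bounded (f ` D01)" for f
  proof (rule LIMSEQ_I)
    fix e :: real assume e: "0 < e"
    obtain B where B: "\<And>x. x \<in> D01 \<Longrightarrow> \<bar>f x\<bar> \<le> B" using f(2) unfolding bounded_iff by auto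
    have g: "continuous_map skorokhod_topology euclideanreal (\<lambda>x. - f x)" using f(1) by (rule continuous_map_minus)
    obtain n1 where 1: "\<And>n. n \<ge> n1 \<Longrightarrow> (\<integral>\<omega>. f (Y \<omega>) \<partial>M) - e < measure_pmf.expectation (p n) (\<lambda>\<omega>. f (X n \<omega>))"
      using main[OF f(1) B] e by blast
    have "\<exists>n2. \<forall>n\<ge>n2. - (\<integral>\<omega>. f (Y \<omega>) \<partial>M) - e < - measure_pmf.expectation (p n) (\<lambda>\<omega>. f (X n \<omega>))"
      using main[OF g, of B] B e by simp
    then obtain n2 where 2: "\<And>n. n \<ge> n2 \<Longrightarrow> - (\<integral>\<omega>. f (Y \<omega>) \<partial>M) - e < - measure_pmf.expectation (p n) (\<lambda>\<omega>. f (X n \<omega>))"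
      by blast
    show "\<exists>n0. \<forall>n\<ge>n0. norm (measure_pmf.expectation (p n) (\<lambda>\<omega>. f (X n \<omega>)) - (\<integral>\<omega>. f (Y \<omega>) \<partial>M)) < e"
    proof (intro exI[of _ "max n1 n2"] allI impI)
      fix n assume n: "max n1 n2 \<le> n"
      show "norm (measure_pmf.expectation (p n) (\<lambda>\<omega>. f (X n \<omega>)) - (\<integral>\<omega>. f (Y \<omega>) \<partial>M)) < e"
        using 1[of n] 2[of n] n by (simp add: abs_less_iff)
    qed
  qed
  then show ?thesis unfolding converges_in_distribution_def using Xm Ym by simp
qed

section \<open>Gaussian vectors and Brownian motion on a grid\<close>

text \<open>A function on sequences with this Lipschitz property is continuous for the product topology.\<close>

lemma measurable_finite_Lipschitz:
  fixes \<Phi> :: "(nat \<Rightarrow> real) \<Rightarrow> real" and V :: "nat \<Rightarrow> 'b \<Rightarrow> real"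
  assumes lip: "\<And>v w. \<bar>\<Phi> v - \<Phi> w\<bar> \<le> K * (\<Sum>j<k. \<bar>v j - w j\<bar>)"
    and V: "\<And>j. j < k \<Longrightarrow> V j \<in> borel_measurable M"
  shows "(\<lambda>\<omega>. \<Phi> (\<lambda>j. V j \<omega>)) \<in> borel_measurable M"
proof -
  let ?W = "\<lambda>\<omega> j. if j < k then V j \<omega> else 0"
  have "continuous_on UNIV \<Phi>"
    unfolding continuous_on_def
  proof
    fix v :: "nat \<Rightarrow> real"
    have c: "((\<lambda>w. w j) \<longlongrightarrow> v j) (at v)" for j
    proof -
      have "continuous_on UNIV (\<lambda>w :: nat \<Rightarrow> real. w j)" by (rule continuous_on_product_coordinates)
      then show ?thesis by (simp add: continuous_on_def)
    qed
    have "((\<lambda>w. K * (\<Sum>j<k. \<bar>w j - v j\<bar>)) \<longlongrightarrow> K * (\<Sum>j<k. \<bar>v j - v j\<bar>)) (at v)"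
      by (intro tendsto_intros c)
    then have "((\<lambda>w. K * (\<Sum>j<k. \<bar>w j - v j\<bar>)) \<longlongrightarrow> 0) (at v)" by simp
    then have "((\<lambda>w. \<Phi> w - \<Phi> v) \<longlongrightarrow> 0) (at v)"
      by (rule Lim_null_comparison[rotated]) (use lip in auto)
    then show "(\<Phi> \<longlongrightarrow> \<Phi> v) (at v within UNIV)" by (simp add: LIM_zero_iff)
  qed
  then have "\<Phi> \<in> borel_measurable borel" by (rule borel_measurable_continuous_onI)
  moreover have "?W \<in> borel_measurable M"
  proof (rule measurable_coordinatewise_then_product)
    fix j show "(\<lambda>\<omega>. ?W \<omega> j) \<in> borel_measurable M" by (cases "j < k") (use V in simp_all)
  qed
  ultimately have "(\<lambda>\<omega>. \<Phi> (?W \<omega>)) \<in> borel_measurable M" by (rule measurable_compose[rotated])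
  moreover have "\<Phi> (?W \<omega>) = \<Phi> (\<lambda>j. V j \<omega>)" for \<omega>
    using lip[of "?W \<omega>" "\<lambda>j. V j \<omega>"] by simp
  ultimately show ?thesis by simp
qed

text \<open>The definition of \<open>gaussE\<close> integrates the first variable last, whereas products over \<open>{..<Suc k}\<close> are built by
adding the last coordinate.\<close>

lemma gaussE_snoc: "gaussE (Suc k) \<tau> F = gaussE k \<tau> (\<lambda>xs. \<integral>x. F (xs @ [x]) \<partial>gauss \<tau>)"
proof (induction k arbitrary: F)
  case (Suc k)
  have "gaussE (Suc (Suc k)) \<tau> F = (\<integral>y. gaussE (Suc k) \<tau> (\<lambda>xs. F (y # xs)) \<partial>gauss \<tau>)" by simp
  also have "\<dots> = (\<integral>y. gaussE k \<tau> (\<lambda>xs. \<integral>x. F (y # xs @ [x]) \<partial>gauss \<tau>) \<partial>gauss \<tau>)" unfolding Suc ..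
  finally show ?case by simp
qed simp

lemma BL_snoc_BL1: "BL (Suc k) F \<Longrightarrow> length xs = k \<Longrightarrow> BL1 (\<lambda>x. F (xs @ [x]))"
  unfolding BL1_def
proof (intro conjI allI)
  assume F: "BL (Suc k) F" and l: "length xs = k"
  fix x y
  show "\<bar>F (xs @ [x])\<bar> \<le> 1" using F l by (simp add: BL_def)
  have "\<bar>F (xs @ [x]) - F (xs @ [y])\<bar> \<le> (\<Sum>i<Suc k. \<bar>(xs @ [x]) ! i - (xs @ [y]) ! i\<bar>)"
    using F l unfolding BL_def by simp
  also have "\<dots> = \<bar>x - y\<bar>" using l by (simp add: nth_append)
  finally show "\<bar>F (xs @ [x]) - F (xs @ [y])\<bar> \<le> \<bar>x - y\<bar>" .
qed

lemma integrable_gauss_BL1: "BL1 f \<Longrightarrow> integrable (gauss \<tau>) f"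
proof -
  interpret g: prob_space "gauss \<tau>" by (rule prob_space_gauss)
  assume f: "BL1 f"
  show "integrable (gauss \<tau>) f"
    using f BL1_measurable[OF f]
    by (intro g.integrable_const_bound[where B = 1]) (auto simp: BL1_def measurable_cong_sets[OF sets_gauss(1) refl])
qed

lemma BL_integrate_last:
  assumes F: "BL (Suc k) F"
  shows "BL k (\<lambda>xs. \<integral>x. F (xs @ [x]) \<partial>gauss \<tau>)"
  unfolding BL_def
proof (intro conjI allI impI)
  interpret g: prob_space "gauss \<tau>" by (rule prob_space_gauss)
  have one: "(\<integral>x. c \<partial>gauss \<tau>) = c" for c :: real using g.prob_space by simp
  fix xs ys :: "real list" assume l: "length xs = k"
  have "norm (\<integral>x. F (xs @ [x]) \<partial>gauss \<tau>) \<le> (\<integral>x. 1 \<partial>gauss \<tau>)"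
    using BL_snoc_BL1[OF F l] integrable_gauss_BL1[OF BL_snoc_BL1[OF F l]]
    by (intro integral_norm_bound_AE AE_I2) (auto simp: BL1_def)
  then show "\<bar>\<integral>x. F (xs @ [x]) \<partial>gauss \<tau>\<bar> \<le> 1" by (simp only: one real_norm_def)
  assume l': "length ys = k"
  have i: "integrable (gauss \<tau>) (\<lambda>x. F (xs @ [x]))" "integrable (gauss \<tau>) (\<lambda>x. F (ys @ [x]))"
    using integrable_gauss_BL1 BL_snoc_BL1[OF F] l l' by auto
  have "norm (\<integral>x. F (xs @ [x]) - F (ys @ [x]) \<partial>gauss \<tau>) \<le> (\<integral>x. (\<Sum>i<k. \<bar>xs ! i - ys ! i\<bar>) \<partial>gauss \<tau>)"
  proof (intro integral_norm_bound_AE AE_I2)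
    fix x
    have "\<bar>F (xs @ [x]) - F (ys @ [x])\<bar> \<le> (\<Sum>i<Suc k. \<bar>(xs @ [x]) ! i - (ys @ [x]) ! i\<bar>)"
      using F l l' unfolding BL_def by simp
    also have "\<dots> = (\<Sum>i<k. \<bar>xs ! i - ys ! i\<bar>)" using l l' by (simp add: nth_append)
    finally show "norm (F (xs @ [x]) - F (ys @ [x])) \<le> (\<Sum>i<k. \<bar>xs ! i - ys ! i\<bar>)" by simp
  qed (use i in auto)
  then have "\<bar>\<integral>x. F (xs @ [x]) - F (ys @ [x]) \<partial>gauss \<tau>\<bar> \<le> (\<Sum>i<k. \<bar>xs ! i - ys ! i\<bar>)" by (simp only: one real_norm_def)
  then show "\<bar>(\<integral>x. F (xs @ [x]) \<partial>gauss \<tau>) - (\<integral>x. F (ys @ [x]) \<partial>gauss \<tau>)\<bar> \<le> (\<Sum>i<k. \<bar>xs ! i - ys ! i\<bar>)"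
    using i by simp
qed

lemma BL_map_Lipschitz: "BL k F \<Longrightarrow> \<bar>F (map v [0..<k]) - F (map w [0..<k])\<bar> \<le> 1 * (\<Sum>j<k. \<bar>v j - w j\<bar>)"
proof -
  assume F: "BL k F"
  have "\<bar>F (map v [0..<k]) - F (map w [0..<k])\<bar> \<le> (\<Sum>j<k. \<bar>map v [0..<k] ! j - map w [0..<k] ! j\<bar>)"
    by (rule F[unfolded BL_def, THEN conjunct2, rule_format]) auto
  then show ?thesis by simp
qed

lemma gaussE_PiM: "BL k F \<Longrightarrow> (\<integral>x. F (map x [0..<k]) \<partial>Pi\<^sub>M {..<k} (\<lambda>_. gauss \<tau>)) = gaussE k \<tau> F"
proof (induction k arbitrary: F)
  case 0
  interpret P: prob_space "Pi\<^sub>M {..<0::nat} (\<lambda>_. gauss \<tau>)" by (rule prob_space_PiM) (rule prob_space_gauss)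
  show ?case using P.prob_space by simp
next
  case (Suc k)
  interpret g: prob_space "gauss \<tau>" by (rule prob_space_gauss)
  interpret product_prob_space "\<lambda>_. gauss \<tau>" "{..<Suc k}" ..
  interpret P: prob_space "Pi\<^sub>M {..<Suc k} (\<lambda>_. gauss \<tau>)" by (rule prob_space_PiM) (rule prob_space_gauss)
  have eq: "insert k {..<k} = {..<Suc k}" by auto
  have V: "(\<lambda>x. x j) \<in> borel_measurable (Pi\<^sub>M {..<Suc k} (\<lambda>_. gauss \<tau>))" if "j < Suc k" for j
  proof -
    have "(\<lambda>x. x j) \<in> measurable (Pi\<^sub>M {..<Suc k} (\<lambda>_. gauss \<tau>)) (gauss \<tau>)"
      by (rule measurable_component_singleton) (use that in simp)
    then show ?thesis using measurable_cong_sets[OF refl sets_gauss(1)] by blast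
  qed
  have m: "(\<lambda>x. F (map x [0..<Suc k])) \<in> borel_measurable (Pi\<^sub>M {..<Suc k} (\<lambda>_. gauss \<tau>))"
    using measurable_finite_Lipschitz[of "\<lambda>v. F (map v [0..<Suc k])" 1 "Suc k" "\<lambda>j x. x j", OF BL_map_Lipschitz[OF Suc.prems] V] by simp
  have i: "integrable (Pi\<^sub>M (insert k {..<k}) (\<lambda>_. gauss \<tau>)) (\<lambda>x. F (map x [0..<Suc k]))"
    unfolding eq using m Suc.prems by (intro P.integrable_const_bound[where B = 1]) (auto simp: BL_def)
  have "(\<integral>x. F (map x [0..<Suc k]) \<partial>Pi\<^sub>M {..<Suc k} (\<lambda>_. gauss \<tau>))
     = (\<integral>x. (\<integral>y. F (map (x(k := y)) [0..<Suc k]) \<partial>gauss \<tau>) \<partial>Pi\<^sub>M {..<k} (\<lambda>_. gauss \<tau>))"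
    unfolding eq[symmetric] by (rule product_integral_insert[OF _ _ i]) auto
  also have "\<dots> = (\<integral>x. (\<lambda>xs. \<integral>y. F (xs @ [y]) \<partial>gauss \<tau>) (map x [0..<k]) \<partial>Pi\<^sub>M {..<k} (\<lambda>_. gauss \<tau>))"
  proof -
    have "map (x(k := y)) [0..<Suc k] = map x [0..<k] @ [y]" for x :: "nat \<Rightarrow> real" and y by simp
    then show ?thesis by (simp only:)
  qed
  also have "\<dots> = gaussE k \<tau> (\<lambda>xs. \<integral>y. F (xs @ [y]) \<partial>gauss \<tau>)"
    by (rule Suc.IH[OF BL_integrate_last[OF Suc.prems]])
  finally show ?case unfolding gaussE_snoc .
qed

lemma (in prob_space) expectation_indep_gauss:
  assumes rv: "\<And>i. i < k \<Longrightarrow> random_variable borel (\<Delta> i)" and ind: "indep_vars (\<lambda>_. borel) \<Delta> {..<k}"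
    and law: "\<And>i. i < k \<Longrightarrow> distr M borel (\<Delta> i) = gauss \<tau>" and F: "BL k F" and k: "0 < k"
  shows "expectation (\<lambda>\<omega>. F (map (\<lambda>i. \<Delta> i \<omega>) [0..<k])) = gaussE k \<tau> F"
proof -
  have "distr M (\<Pi>\<^sub>M i\<in>{..<k}. borel) (\<lambda>x. \<lambda>i\<in>{..<k}. \<Delta> i x) = (\<Pi>\<^sub>M i\<in>{..<k}. distr M borel (\<Delta> i))"
    using ind k rv by (subst indep_vars_iff_distr_eq_PiM'[symmetric]) auto
  also have "\<dots> = (\<Pi>\<^sub>M i\<in>{..<k}. gauss \<tau>)" by (rule PiM_cong) (use law in auto)
  finally have d: "distr M (\<Pi>\<^sub>M i\<in>{..<k}. borel) (\<lambda>x. \<lambda>i\<in>{..<k}. \<Delta> i x) = (\<Pi>\<^sub>M i\<in>{..<k}. gauss \<tau>)" .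
  have V: "(\<lambda>x. x j) \<in> borel_measurable (\<Pi>\<^sub>M i\<in>{..<k}. borel :: real measure)" if "j < k" for j
    by (rule measurable_component_singleton) (use that in simp)
  have m: "(\<lambda>x. F (map x [0..<k])) \<in> borel_measurable (\<Pi>\<^sub>M i\<in>{..<k}. borel)"
    using measurable_finite_Lipschitz[of "\<lambda>v. F (map v [0..<k])" 1 k "\<lambda>j x. x j", OF BL_map_Lipschitz[OF F] V] by simp
  have mm: "(\<lambda>x. \<lambda>i\<in>{..<k}. \<Delta> i x) \<in> measurable M (\<Pi>\<^sub>M i\<in>{..<k}. borel)"
    using rv by (intro measurable_restrict) auto
  have "gaussE k \<tau> F = (\<integral>x. F (map x [0..<k]) \<partial>Pi\<^sub>M {..<k} (\<lambda>_. gauss \<tau>))" by (rule gaussE_PiM[OF F, symmetric])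
  also have "\<dots> = expectation (\<lambda>\<omega>. F (map (\<lambda>i\<in>{..<k}. \<Delta> i \<omega>) [0..<k]))"
    unfolding d[symmetric] by (rule integral_distr[OF mm m])
  also have "\<dots> = expectation (\<lambda>\<omega>. F (map (\<lambda>i. \<Delta> i \<omega>) [0..<k]))"
  proof -
    have "map (\<lambda>i\<in>{..<k}. \<Delta> i \<omega>) [0..<k] = map (\<lambda>i. \<Delta> i \<omega>) [0..<k]" for \<omega> by auto
    then show ?thesis by (simp only:)
  qed
  finally show ?thesis ..
qed

lemma distr_normal_gauss:
  assumes "distributed M lborel X (normal_density 0 (sqrt \<tau>))" "0 < \<tau>"
  shows "distr M borel X = gauss \<tau>"
proof -
  have a: "distributed std_normal_distribution lborel (\<lambda>x. x) std_normal_density"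
    unfolding distributed_def by (auto simp: distr_id2)
  have "distributed std_normal_distribution lborel (\<lambda>x. 0 + sqrt \<tau> * x) (normal_density (0 + sqrt \<tau> * 0) (\<bar>sqrt \<tau>\<bar> * 1))"
    using assms(2) by (intro std.normal_density_affine[OF a]) auto
  then have "distr std_normal_distribution lborel (\<lambda>x. sqrt \<tau> * x) = density lborel (normal_density 0 (sqrt \<tau>))"
    using assms(2) by (simp add: distributed_def)
  moreover have "distr M lborel X = density lborel (normal_density 0 (sqrt \<tau>))"
    using assms(1) by (simp add: distributed_def)
  moreover have "distr M lborel X = distr M borel X" "distr std_normal_distribution lborel (\<lambda>x. sqrt \<tau> * x) = gauss \<tau>"
    unfolding gauss_def by (rule distr_cong; simp)+
  ultimately show ?thesis by simp
qed

lemma BL_D01_stepf_Lipschitz: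
  assumes "\<And>x y. x \<in> D01 \<Longrightarrow> y \<in> D01 \<Longrightarrow> \<bar>g x - g y\<bar> \<le> K * skorokhod_dist x y" "0 \<le> K"
  shows "\<bar>g (stepf k v) - g (stepf k w)\<bar> \<le> K * (\<Sum>j<Suc k. \<bar>v j - w j\<bar>)"
proof -
  have "skorokhod_dist (stepf k v) (stepf k w) \<le> (\<Sum>j<Suc k. \<bar>v j - w j\<bar>)"
  proof (rule skorokhod_dist_le_sup[OF stepf_D01 stepf_D01])
    fix t :: real assume t: "t \<in> {0..1}"
    have "\<bar>v (nat \<lfloor>real k * t\<rfloor>) - w (nat \<lfloor>real k * t\<rfloor>)\<bar> \<le> (\<Sum>j<Suc k. \<bar>v j - w j\<bar>)"
      using nat_floor_le[OF t, of k] by (intro member_le_sum) auto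
    then show "\<bar>stepf k v t - stepf k w t\<bar> \<le> (\<Sum>j<Suc k. \<bar>v j - w j\<bar>)" using t by (simp add: stepf_def)
  qed
  then show ?thesis using assms(1)[OF stepf_D01 stepf_D01, of k v k w] assms(2) by (meson mult_left_mono order_trans)
qed

definition path_of :: "(real \<Rightarrow> 'b \<Rightarrow> real) \<Rightarrow> 'b \<Rightarrow> real \<Rightarrow> real" where
  "path_of B \<omega> = (\<lambda>t\<in>{0..1}. B t \<omega>)"

definition grid :: "nat \<Rightarrow> (real \<Rightarrow> 'b \<Rightarrow> real) \<Rightarrow> 'b \<Rightarrow> nat \<Rightarrow> real" where
  "grid k B \<omega> j = B (real j / real k) \<omega>"

lemma path_of_D01:
  assumes "continuous_on {0..1} (\<lambda>t. B t \<omega>)" shows "path_of B \<omega> \<in> D01"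
  unfolding D01_def
proof (intro CollectI conjI ballI)
  let ?f = "path_of B \<omega>"
  show "?f \<in> extensional {0..1}" by (simp add: path_of_def)
  have c: "continuous_on {0..1} ?f"
    using assms by (subst continuous_on_cong[where g = "\<lambda>t. B t \<omega>"]) (auto simp: path_of_def)
  fix t :: real assume t: "t \<in> {0..<1}"
  have "(?f \<longlongrightarrow> ?f t) (at t within {0..1})" using c t by (simp add: continuous_on_def)
  then have "(?f \<longlongrightarrow> ?f t) (at t within {t..1})" by (rule tendsto_within_subset) (use t in auto)
  then show "continuous (at_right t) ?f" using t
    by (simp add: continuous_within at_within_Icc_at_right)
next
  let ?f = "path_of B \<omega>"
  have c: "continuous_on {0..1} ?f"
    using assms by (subst continuous_on_cong[where g = "\<lambda>t. B t \<omega>"]) (auto simp: path_of_def)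
  fix t :: real assume t: "t \<in> {0<..1}"
  have "(?f \<longlongrightarrow> ?f t) (at t within {0..1})" using c t by (simp add: continuous_on_def)
  then have "(?f \<longlongrightarrow> ?f t) (at t within {0..t})" by (rule tendsto_within_subset) (use t in auto)
  then show "\<exists>l. (?f \<longlongrightarrow> l) (at_left t)" using t by (auto simp: at_within_Icc_at_left)
qed

lemma stepf_grid_tendsto:
  assumes "continuous_on {0..1} (\<lambda>t. B t \<omega>)"
    and g: "\<And>x y. x \<in> D01 \<Longrightarrow> y \<in> D01 \<Longrightarrow> \<bar>g x - g y\<bar> \<le> K * skorokhod_dist x y" "0 \<le> K"
  shows "(\<lambda>k. g (stepf k (grid k B \<omega>))) \<longlonglongrightarrow> g (path_of B \<omega>)"
proof -
  have pD: "path_of B \<omega> \<in> D01" by (rule path_of_D01) (rule assms(1))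
  have "(\<lambda>k. skorokhod_dist (stepf k (grid k B \<omega>)) (path_of B \<omega>)) \<longlonglongrightarrow> 0"
  proof (rule LIMSEQ_I)
    fix e :: real assume e: "0 < e"
    have "uniformly_continuous_on {0..1} (\<lambda>t. B t \<omega>)"
      by (rule compact_uniformly_continuous[OF assms(1)]) simp
    then obtain d where d: "0 < d" "\<And>s t. s \<in> {0..1} \<Longrightarrow> t \<in> {0..1} \<Longrightarrow> dist s t < d \<Longrightarrow> dist (B s \<omega>) (B t \<omega>) < e / 2"
      unfolding uniformly_continuous_on_def using half_gt_zero[OF e] by metis
    obtain k0 :: nat where k0: "1 / d < real k0" using reals_Archimedean2 by blast
    have "norm (skorokhod_dist (stepf k (grid k B \<omega>)) (path_of B \<omega>) - 0) < e" if k: "k0 \<le> k" for k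
    proof -
      have "1 / d < real k" using k k0 by linarith
      moreover have "0 < 1 / d" using d by simp
      ultimately have kp0: "0 < real k" and "1 < d * real k" using d by (linarith, simp add: divide_less_eq mult.commute)
      then have kp: "0 < real k" "1 / real k < d" by (simp_all add: divide_less_eq)
      have "skorokhod_dist (stepf k (grid k B \<omega>)) (path_of B \<omega>) \<le> e / 2"
      proof (rule skorokhod_dist_le_sup[OF stepf_D01 pD])
        fix t :: real assume t: "t \<in> {0..1}"
        define j where "j = nat \<lfloor>real k * t\<rfloor>"
        have "0 \<le> real k * t" using t by simp
        then have j: "real j \<le> real k * t" "real k * t < real j + 1" unfolding j_def by linarith+
        have "real j / real k \<le> t" "t < real j / real k + 1 / real k"
          using j kp by (auto simp: field_simps)
        then have "dist (real j / real k) t < d" "real j / real k \<le> 1" using kp t unfolding dist_real_def atLeastAtMost_iff by linarith+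
        moreover have "0 \<le> real j / real k" by simp
        ultimately have "dist (real j / real k) t < d" "real j / real k \<in> {0..1}" by (simp_all only: atLeastAtMost_iff)
        from d(2)[OF this(2) t this(1)]
        show "\<bar>stepf k (grid k B \<omega>) t - path_of B \<omega> t\<bar> \<le> e / 2" using t
          by (simp add: stepf_def path_of_def grid_def j_def dist_real_def)
      qed
      then show ?thesis using e skorokhod_dist_nonneg[of "stepf k (grid k B \<omega>)" "path_of B \<omega>"] by simp
    qed
    then show "\<exists>k0. \<forall>k\<ge>k0. norm (skorokhod_dist (stepf k (grid k B \<omega>)) (path_of B \<omega>) - 0) < e" by blast
  qed
  then have "(\<lambda>k. K * skorokhod_dist (stepf k (grid k B \<omega>)) (path_of B \<omega>)) \<longlonglongrightarrow> 0" by (rule tendsto_mult_right_zero)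
  then have "(\<lambda>k. g (stepf k (grid k B \<omega>)) - g (path_of B \<omega>)) \<longlonglongrightarrow> 0"
    by (rule Lim_null_comparison[rotated]) (use g(1)[OF stepf_D01 pD] in auto)
  then show ?thesis by (rule LIM_zero_cancel)
qed

definition psums :: "real list \<Rightarrow> nat \<Rightarrow> real" where "psums xs j = sum_list (take j xs)"

lemma psums_diff: "length xs = length ys \<Longrightarrow> \<bar>psums xs j - psums ys j\<bar> \<le> (\<Sum>i<length xs. \<bar>xs ! i - ys ! i\<bar>)"
proof -
  assume l: "length xs = length ys"
  have "psums xs j - psums ys j = (\<Sum>i<min j (length xs). xs ! i - ys ! i)"
    using l by (simp add: psums_def sum_list_sum_nth sum_subtractf min.commute atLeast0LessThan)
  also have "\<bar>\<dots>\<bar> \<le> (\<Sum>i<min j (length xs). \<bar>xs ! i - ys ! i\<bar>)" by (rule sum_abs)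
  also have "\<dots> \<le> (\<Sum>i<length xs. \<bar>xs ! i - ys ! i\<bar>)" by (rule sum_mono2) auto
  finally show ?thesis .
qed

text \<open>Changing the increments of a step function changes it uniformly by at most the sum of the changes.\<close>

lemma BL_stepf:
  assumes "\<And>x y. x \<in> D01 \<Longrightarrow> y \<in> D01 \<Longrightarrow> \<bar>g x - g y\<bar> \<le> skorokhod_dist x y" "\<And>x. x \<in> D01 \<Longrightarrow> \<bar>g x\<bar> \<le> 1"
  shows "BL k (\<lambda>xs. g (stepf k (psums xs)))"
  unfolding BL_def
proof (intro conjI allI impI)
  fix xs ys :: "real list" assume l: "length xs = k"
  show "\<bar>g (stepf k (psums xs))\<bar> \<le> 1" by (rule assms(2)[OF stepf_D01])
  assume l': "length ys = k"
  have "skorokhod_dist (stepf k (psums xs)) (stepf k (psums ys)) \<le> (\<Sum>i<k. \<bar>xs ! i - ys ! i\<bar>)"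
    by (rule skorokhod_dist_le_sup[OF stepf_D01 stepf_D01]) (use psums_diff[of xs ys] l l' in \<open>auto simp: stepf_def\<close>)
  then show "\<bar>g (stepf k (psums xs)) - g (stepf k (psums ys))\<bar> \<le> (\<Sum>i<k. \<bar>xs ! i - ys ! i\<bar>)"
    using assms(1)[OF stepf_D01 stepf_D01, of k "psums xs" k "psums ys"] by linarith
qed

text \<open>Step functions sampled on finer and finer grids converge uniformly to a continuous path. So the
functional of the path is a limit of functions of finitely many values, which are measurable, and
their expectations are Gaussian integrals because of the independent increments.\<close>

lemma Brownian_Lipschitz:
  fixes M :: "'b measure"
  assumes B: "standard_brownian_motion M B"
    and g: "\<And>x y. x \<in> D01 \<Longrightarrow> y \<in> D01 \<Longrightarrow> \<bar>g x - g y\<bar> \<le> skorokhod_dist x y" "\<And>x. x \<in> D01 \<Longrightarrow> \<bar>g x\<bar> \<le> 1"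
  shows "(\<lambda>\<omega>. g (path_of B \<omega>)) \<in> borel_measurable M"
    and "(\<lambda>k. gaussE (Suc k) (1 / real (Suc k)) (\<lambda>xs. g (stepf (Suc k) (psums xs)))) \<longlonglongrightarrow> (\<integral>\<omega>. g (path_of B \<omega>) \<partial>M)"
proof -
  interpret prob_space M using B by (simp add: standard_brownian_motion_def)
  have rvB: "B t \<in> borel_measurable M" if "t \<in> {0..1}" for t using B that by (simp add: standard_brownian_motion_def)
  have cont: "continuous_on {0..1} (\<lambda>t. B t \<omega>)" if "\<omega> \<in> space M" for \<omega> using B that by (simp add: standard_brownian_motion_def)
  have lim: "(\<lambda>k. g (stepf k (grid k B \<omega>))) \<longlonglongrightarrow> g (path_of B \<omega>)" if "\<omega> \<in> space M" for \<omega>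
    by (rule stepf_grid_tendsto[where B = B and \<omega> = \<omega> and g = g and K = 1, OF cont[OF that]]) (use g in auto)
  have lim': "(\<lambda>k. g (stepf (Suc k) (grid (Suc k) B \<omega>))) \<longlonglongrightarrow> g (path_of B \<omega>)" if "\<omega> \<in> space M" for \<omega>
    by (rule LIMSEQ_Suc[OF lim[OF that]])
  have m: "(\<lambda>\<omega>. g (stepf (Suc k) (grid (Suc k) B \<omega>))) \<in> borel_measurable M" for k
  proof -
    have "(\<lambda>\<omega>. g (stepf (Suc k) (\<lambda>j. grid (Suc k) B \<omega> j))) \<in> borel_measurable M"
    proof (rule measurable_finite_Lipschitz[where \<Phi> = "\<lambda>v. g (stepf (Suc k) v)" and V = "\<lambda>j \<omega>. grid (Suc k) B \<omega> j" and K = 1 and k = "Suc (Suc k)"])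
      show "\<bar>g (stepf (Suc k) v) - g (stepf (Suc k) w)\<bar> \<le> 1 * (\<Sum>j<Suc (Suc k). \<bar>v j - w j\<bar>)" for v w
        by (rule BL_D01_stepf_Lipschitz) (use g in auto)
      fix j assume "j < Suc (Suc k)"
      then show "(\<lambda>\<omega>. grid (Suc k) B \<omega> j) \<in> borel_measurable M" unfolding grid_def by (intro rvB) (auto simp: field_simps)
    qed
    then show ?thesis by simp
  qed
  show gm: "(\<lambda>\<omega>. g (path_of B \<omega>)) \<in> borel_measurable M"
    by (rule borel_measurable_LIMSEQ_real[OF lim' m])
  have conv: "(\<lambda>k. \<integral>\<omega>. g (stepf (Suc k) (grid (Suc k) B \<omega>)) \<partial>M) \<longlonglongrightarrow> (\<integral>\<omega>. g (path_of B \<omega>) \<partial>M)"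
    by (rule integral_dominated_convergence[where w = "\<lambda>_. 1"]) (use lim' m gm g(2)[OF stepf_D01] in auto)
  have "(\<integral>\<omega>. g (stepf (Suc k) (grid (Suc k) B \<omega>)) \<partial>M) = gaussE (Suc k) (1 / real (Suc k)) (\<lambda>xs. g (stepf (Suc k) (psums xs)))" for k
  proof -
    let ?n = "Suc k"
    define \<tau> where "\<tau> i = real (min i ?n) / real ?n" for i
    define \<Delta> where "\<Delta> i \<omega> = B (\<tau> (Suc i)) \<omega> - B (\<tau> i) \<omega>" for i \<omega>
    have \<tau>01: "\<tau> i \<in> {0..1}" for i by (auto simp: \<tau>_def field_simps)
    have mono: "mono_on {..?n} \<tau>" unfolding \<tau>_def by (intro mono_onI divide_right_mono) auto
    have ind: "indep_vars (\<lambda>_. borel) \<Delta> {..<?n}"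
    proof -
      have "\<forall>k (\<tau> :: nat \<Rightarrow> real). mono_on {..k} \<tau> \<and> \<tau> ` {..k} \<subseteq> {0..1} \<longrightarrow>
        indep_vars (\<lambda>_. borel) (\<lambda>i \<omega>. B (\<tau> (Suc i)) \<omega> - B (\<tau> i) \<omega>) {..<k}"
        using B by (simp add: standard_brownian_motion_def)
      moreover have "\<tau> ` {..?n} \<subseteq> {0..1}" using \<tau>01 by blast
      ultimately show ?thesis using mono unfolding \<Delta>_def[abs_def] by blast
    qed
    have law: "distr M borel (\<Delta> i) = gauss (1 / real ?n)" if i: "i < ?n" for i
    proof -
      have d: "\<tau> (Suc i) - \<tau> i = 1 / real ?n" using i by (simp add: \<tau>_def min_def add_divide_distrib)
      then have "\<tau> i < \<tau> (Suc i)" by (metis diff_gt_0_iff_gt of_nat_0_less_iff zero_less_Suc zero_less_divide_1_iff)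
      then have "distributed M lborel (\<Delta> i) (normal_density 0 (sqrt (\<tau> (Suc i) - \<tau> i)))"
        using B \<tau>01[of i] \<tau>01[of "Suc i"] unfolding standard_brownian_motion_def \<Delta>_def[abs_def] by auto
      then show ?thesis unfolding d by (rule distr_normal_gauss) simp
    qed
    have rv: "\<Delta> i \<in> borel_measurable M" for i unfolding \<Delta>_def using rvB[OF \<tau>01] by measurable
    have "gaussE ?n (1 / real ?n) (\<lambda>xs. g (stepf ?n (psums xs))) = expectation (\<lambda>\<omega>. g (stepf ?n (psums (map (\<lambda>i. \<Delta> i \<omega>) [0..<?n]))))"
      by (rule expectation_indep_gauss[OF rv ind law BL_stepf[OF g], symmetric]) auto
    also have "\<dots> = expectation (\<lambda>\<omega>. g (stepf ?n (grid ?n B \<omega>)))"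
    proof (rule integral_cong_AE)
      have "AE \<omega> in M. B 0 \<omega> = 0" using B by (simp add: standard_brownian_motion_def)
      then show "AE \<omega> in M. g (stepf ?n (psums (map (\<lambda>i. \<Delta> i \<omega>) [0..<?n]))) = g (stepf ?n (grid ?n B \<omega>))"
      proof eventually_elim
        case (elim \<omega>)
        have "psums (map (\<lambda>i. \<Delta> i \<omega>) [0..<?n]) j = grid ?n B \<omega> j" if j: "j \<le> ?n" for j
        proof -
          have "psums (map (\<lambda>i. \<Delta> i \<omega>) [0..<?n]) j = (\<Sum>i<j. B (\<tau> (Suc i)) \<omega> - B (\<tau> i) \<omega>)"
            using j by (simp add: psums_def take_map \<Delta>_def interv_sum_list_conv_sum_set_nat atLeast0LessThan del: upt_Suc)
          also have "\<dots> = B (\<tau> j) \<omega> - B (\<tau> 0) \<omega>" by (rule sum_lessThan_telescope)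
          also have "\<dots> = grid ?n B \<omega> j" using j elim by (simp add: grid_def \<tau>_def min_def)
          finally show ?thesis .
        qed
        then have "stepf ?n (psums (map (\<lambda>i. \<Delta> i \<omega>) [0..<?n])) = stepf ?n (grid ?n B \<omega>)"
          unfolding stepf_def using nat_floor_le[of _ ?n] by (intro restrict_ext) blast
        then show ?case by simp
      qed
      show "(\<lambda>\<omega>. g (stepf ?n (psums (map (\<lambda>i. \<Delta> i \<omega>) [0..<?n])))) \<in> borel_measurable M"
        using measurable_finite_Lipschitz[of "\<lambda>v. g (stepf ?n (psums (map v [0..<?n])))" 1 ?n \<Delta>, OF BL_map_Lipschitz[OF BL_stepf[OF g]] rv] by simp
    qed (rule m)
    finally show ?thesis ..
  qed
  then show "(\<lambda>k. gaussE (Suc k) (1 / real (Suc k)) (\<lambda>xs. g (stepf (Suc k) (psums xs)))) \<longlonglongrightarrow> (\<integral>\<omega>. g (path_of B \<omega>) \<partial>M)"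
    using conv by simp
qed

section \<open>Polyominoes as words of blocks\<close>

definition base :: "block list \<Rightarrow> nat \<Rightarrow> int" where
  "base L i = (\<Sum>j<i. int (snd (L ! j)))"

text \<open>The leftmost column is column \<open>0\<close> with base cell at height \<open>0\<close>, so that the result is anchored.\<close>

definition polyomino_of :: "block list \<Rightarrow> cell set" where
  "polyomino_of L = Sigma {0..<int (length L)} (\<lambda>i. {base L (nat i)..base L (nat i) + int (bsize (L ! nat i)) - 1})"

lemma base_0 [simp]: "base L 0 = 0" and base_Suc: "base L (Suc i) = base L i + int (snd (L ! i))"
  by (simp_all add: base_def)

context
  fixes L :: "block list"
  assumes ne: "L \<noteq> []" and pos: "\<And>b. b \<in> set L \<Longrightarrow> 1 \<le> fst b" and last0: "snd (last L) = 0"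
begin

lemma bpos: "i < length L \<Longrightarrow> 1 \<le> fst (L ! i)" "i < length L \<Longrightarrow> 1 \<le> bsize (L ! i)"
  using pos[OF nth_mem] by (auto simp: bsize_def intro: trans_le_add1)

lemma fst_polyomino_of: "fst ` polyomino_of L = {0..int (length L) - 1}"
proof -
  have "fst ` polyomino_of L = {0..<int (length L)}"
  proof (intro set_eqI iffI)
    fix i assume i: "i \<in> {0..<int (length L)}"
    then have "nat i < length L" by auto
    then have "(i, base L (nat i)) \<in> polyomino_of L" using bpos(2)[of "nat i"] i by (simp add: polyomino_of_def)
    then show "i \<in> fst ` polyomino_of L" by (rule image_eqI[rotated]) simp
  qed (auto simp: polyomino_of_def)
  then show ?thesis by auto
qed

lemma column_at_polyomino_of: "i < length L \<Longrightarrow> column_at (polyomino_of L) (int i) = {base L i..base L i + int (bsize (L ! i)) - 1}"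
  by (auto simp: column_at_def polyomino_of_def)

lemma Min_fst_polyomino_of: "Min (fst ` polyomino_of L) = 0"
  unfolding fst_polyomino_of using ne by (intro Min_eqI) (auto simp: Suc_le_eq)

lemma width_polyomino_of: "width (polyomino_of L) = length L"
  unfolding width_def fst_polyomino_of by simp

lemma column_polyomino_of: "i < length L \<Longrightarrow> column (polyomino_of L) (Suc i) = {base L i..base L i + int (bsize (L ! i)) - 1}"
  unfolding column_def Min_fst_polyomino_of using column_at_polyomino_of[of i] by simp

lemma lower_polyomino_of: "i < length L \<Longrightarrow> lower (polyomino_of L) (Suc i) = base L i"
  and upper_polyomino_of: "i < length L \<Longrightarrow> upper (polyomino_of L) (Suc i) = base L i + int (bsize (L ! i)) - 1"
  and column_size_polyomino_of: "i < length L \<Longrightarrow> column_size (polyomino_of L) (Suc i) = bsize (L ! i)"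
  using bpos(2)[of i] unfolding lower_def upper_def column_size_def
  by (auto simp: column_polyomino_of intro!: Min_eqI Max_eqI)

lemma z_step_polyomino_of: "i < length L \<Longrightarrow> z_step (polyomino_of L) (Suc i) = int (snd (L ! i))"
proof -
  assume i: "i < length L"
  show ?thesis
  proof (cases "Suc i < length L")
    case True
    then show ?thesis by (simp add: z_step_def width_polyomino_of lower_polyomino_of base_Suc)
  next
    case False
    then have "i = length L - 1" using i by simp
    then have "L ! i = last L" using ne by (simp add: last_conv_nth)
    then show ?thesis using False last0 by (simp add: z_step_def width_polyomino_of)
  qed
qed

lemma w_step_polyomino_of: "i < length L \<Longrightarrow> w_step (polyomino_of L) (Suc i) = (if i = 0 then 0 else int (bsize (L ! i)) - int (fst (L ! (i - 1))))"
proof (cases i)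
  case (Suc j)
  assume i: "i < length L"
  have "w_step (polyomino_of L) (Suc i) = upper (polyomino_of L) (Suc i) - upper (polyomino_of L) (Suc j)"
    using i by (simp add: w_step_def width_polyomino_of Suc)
  also have "\<dots> = int (bsize (L ! i)) - int (fst (L ! j))"
    using i by (simp add: upper_polyomino_of Suc base_Suc bsize_def)
  finally show ?thesis by (simp add: Suc)
qed (simp add: w_step_def)

lemma card_polyomino_of: "card (polyomino_of L) = sum_list (map bsize L)"
proof -
  have "card (polyomino_of L) = (\<Sum>i\<in>{0..<int (length L)}. bsize (L ! nat i))"
    unfolding polyomino_of_def by (subst card_SigmaI) auto
  also have "\<dots> = (\<Sum>i<length L. bsize (L ! i))"
    by (rule sum.reindex_bij_witness[of _ int nat]) auto
  finally show ?thesis by (simp add: sum_list_sum_nth atLeast0LessThan)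
qed

lemma dcc_polyomino_of: "dcc (polyomino_of L)"
  unfolding dcc_def
proof (intro conjI ballI impI)
  show "\<exists>a b. a \<le> b \<and> fst ` polyomino_of L = {a..b}"
    unfolding fst_polyomino_of using ne by (intro exI[of _ 0] exI[of _ "int (length L) - 1"]) (auto simp: Suc_le_eq)
next
  fix i assume i: "i \<in> fst ` polyomino_of L"
  define k where "k = nat i"
  have k: "i = int k" "k < length L" using i unfolding fst_polyomino_of by (auto simp: k_def)
  then show "\<exists>l h. l \<le> h \<and> column_at (polyomino_of L) i = {l..h}"
    using bpos(2)[of k] unfolding k(1) column_at_polyomino_of[OF k(2)]
    by (intro exI[of _ "base L k"] exI[of _ "base L k + int (bsize (L ! k)) - 1"]) auto
  assume "i - 1 \<in> fst ` polyomino_of L"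
  then obtain j where j: "k = Suc j" using k unfolding fst_polyomino_of by (cases k) auto
  have "Min (column_at (polyomino_of L) i) = base L k"
    using lower_polyomino_of[OF k(2)] unfolding lower_def column_def Min_fst_polyomino_of by (simp add: k(1))
  moreover have "i - 1 = int j" using k j by simp
  moreover have "base L k \<in> column_at (polyomino_of L) (int j)"
    using k j bpos(1)[of j] by (subst column_at_polyomino_of) (auto simp: base_Suc bsize_def)
  ultimately show "\<exists>j\<in>column_at (polyomino_of L) (i - 1). adjacent (i, Min (column_at (polyomino_of L) i)) (i - 1, j)"
    by (intro bexI[of _ "base L k"]) (auto simp: adjacent_def)
qed

lemma anchored_polyomino_of: "anchored (polyomino_of L)"
  using ne lower_polyomino_of[of 0] by (simp add: anchored_def Min_fst_polyomino_of)

end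

lemma words_pos:
  assumes "L \<in> words n" "0 < n"
  shows "L \<noteq> []" "\<And>b. b \<in> set L \<Longrightarrow> 1 \<le> fst b" "snd (last L) = 0" "sum_list (map bsize L) = n"
  using assms by (auto simp: words_def)

lemma polyomino_of_in_dccs: "L \<in> words n \<Longrightarrow> 0 < n \<Longrightarrow> polyomino_of L \<in> dccs n"
  using words_pos[of L n] dcc_polyomino_of[of L] anchored_polyomino_of[of L] card_polyomino_of[of L] by (simp add: dccs_def)

lemma inj_polyomino_of: "0 < n \<Longrightarrow> inj_on polyomino_of (words n)"
proof (rule inj_onI)
  fix L L' assume n: "0 < n" and L: "L \<in> words n" "L' \<in> words n" and eq: "polyomino_of L = polyomino_of L'"
  note w = words_pos[OF L(1) n] and w' = words_pos[OF L(2) n]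
  have len: "length L = length L'"
    using width_polyomino_of[OF w(1,2)] width_polyomino_of[OF w'(1,2)] eq w(3) w'(3) by simp
  show "L = L'"
  proof (rule nth_equalityI[OF len])
    fix i assume i: "i < length L"
    then have i': "i < length L'" using len by simp
    have "bsize (L ! i) = bsize (L' ! i)" 
      using column_size_polyomino_of[OF w(1-3) i] column_size_polyomino_of[OF w'(1-3) i'] eq by simp
    moreover have "snd (L ! i) = snd (L' ! i)"
      using z_step_polyomino_of[OF w(1-3) i] z_step_polyomino_of[OF w'(1-3) i'] eq by simp
    ultimately show "L ! i = L' ! i" by (simp add: bsize_def prod_eq_iff)
  qed
qed

text \<open>The word is read off from the column sizes and the shifts \<open>z\<close> of the base cells. Adjacency of the base
cell to the preceding column says exactly that \<open>0 \<le> z\<close> and \<open>z\<close> is less than the size of that column,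
hence \<open>u \<ge> 1\<close>.\<close>

lemma surj_polyomino_of:
  assumes P: "P \<in> dccs n" and n: "0 < n"
  shows "P \<in> polyomino_of ` words n"
proof -
  have d: "dcc P" "anchored P" "card P = n" using P by (auto simp: dccs_def)
  obtain a b where ab: "a \<le> b" "fst ` P = {a..b}" using d by (auto simp: dcc_def)
  have "Min (fst ` P) = a" using ab by (auto intro: Min_eqI)
  then have a0: "a = 0" "Min (fst ` P) = 0" using d(2) by (auto simp: anchored_def)
  define m where "m = width P"
  have m: "int m = b + 1" using ab a0 by (simp add: m_def width_def)
  have fP: "fst ` P = {0..<int m}" using ab a0 m by auto
  have m1: "1 \<le> m" using width_pos[OF d(1)] by (simp add: m_def)
  have col: "column P (Suc i) = column_at P (int i)" for i by (simp add: column_def a0)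
  define lo where "lo i = lower P (Suc i)" for i
  define sz where "sz i = column_size P (Suc i)" for i
  have colI: "column_at P (int i) = {lo i..lo i + int (sz i) - 1} \<and> 1 \<le> sz i" if i: "i < m" for i
  proof -
    have "int i \<in> fst ` P" using i fP by simp
    then obtain l h where lh: "l \<le> h" "column_at P (int i) = {l..h}" using d(1) unfolding dcc_def by blast
    have "lo i = l" unfolding lo_def lower_def col lh(2) using lh(1) by (intro Min_eqI) auto
    moreover have "sz i = nat (h - l + 1)" unfolding sz_def column_size_def col lh(2) by simp
    ultimately show ?thesis using lh by auto
  qed
  define z where "z i = (if Suc i < m then lo (Suc i) - lo i else 0)" for i
  have z: "0 \<le> z i \<and> z i < int (sz i)" if i: "i < m" for i
  proof (cases "Suc i < m")
    case True
    have "int (Suc i) \<in> fst ` P" "int (Suc i) - 1 \<in> fst ` P" using True fP by auto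
    then have "\<exists>j\<in>column_at P (int (Suc i) - 1). adjacent (int (Suc i), Min (column_at P (int (Suc i)))) (int (Suc i) - 1, j)"
      by (rule d(1)[unfolded dcc_def, THEN conjunct2, THEN conjunct2, rule_format])
    moreover have "int (Suc i) - 1 = int i" by simp
    ultimately obtain j where j: "j \<in> column_at P (int i)" "adjacent (int (Suc i), Min (column_at P (int (Suc i)))) (int i, j)"
      unfolding \<open>int (Suc i) - 1 = int i\<close> by blast
    have "Min (column_at P (int (Suc i))) = lo (Suc i)" unfolding lo_def lower_def col ..
    then have "j = lo (Suc i)" using j(2) by (simp add: adjacent_def)
    then show ?thesis using j(1) colI[OF i] True by (simp add: z_def)
  next
    case False
    then show ?thesis using colI[OF i] by (simp add: z_def)
  qed
  define L where "L = map (\<lambda>i. (sz i - nat (z i), nat (z i))) [0..<m]"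
  have len: "length L = m" by (simp add: L_def)
  have Li: "L ! i = (sz i - nat (z i), nat (z i))" if "i < m" for i using that by (simp add: L_def)
  have ne: "L \<noteq> []" using m1 len by auto
  have pos: "1 \<le> fst c" if c: "c \<in> set L" for c
  proof -
    obtain i where i: "i < m" "c = L ! i" using c len by (metis in_set_conv_nth)
    then show ?thesis using z[OF i(1)] Li[OF i(1)] by auto
  qed
  have last0: "snd (last L) = 0"
    using ne len m1 Li[of "m - 1"] by (simp add: last_conv_nth z_def)
  have size: "bsize (L ! i) = sz i" if "i < m" for i
  proof -
    have "nat (z i) \<le> sz i" using z[OF that] by linarith
    then show ?thesis by (simp add: Li[OF that] bsize_def)
  qed
  have base: "i < m \<Longrightarrow> base L i = lo i" for i
  proof (induction i)
    case 0
    then show ?case using d(2) by (simp add: lo_def anchored_def)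
  next
    case (Suc i)
    then show ?case using z[of i] by (simp add: base_Suc Li z_def)
  qed
  have "polyomino_of L = P"
  proof (intro set_eqI)
    fix c :: cell
    obtain i j where c: "c = (i, j)" by (cases c)
    show "c \<in> polyomino_of L \<longleftrightarrow> c \<in> P"
    proof (cases "i \<in> {0..<int m}")
      case True
      then have "nat i < m" "int (nat i) = i" by auto
      then have "column_at P i = {base L (nat i)..base L (nat i) + int (bsize (L ! nat i)) - 1}"
        using colI[of "nat i"] size base by simp
      then have "j \<in> column_at P i \<longleftrightarrow> (i, j) \<in> polyomino_of L" using True by (simp add: polyomino_of_def len)
      then show ?thesis by (simp add: c column_at_def)
    next
      case False
      then have "c \<notin> P" using fP c by (metis fst_conv image_eqI)
      moreover have "c \<notin> polyomino_of L" using False unfolding c polyomino_of_def len by blast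
      ultimately show ?thesis by simp
    qed
  qed
  moreover have "L \<in> words n"
    using card_polyomino_of[OF ne pos last0] \<open>polyomino_of L = P\<close> d(3) pos last0 by (simp add: words_def)
  ultimately show ?thesis by blast
qed

theorem random_dcc_words: "0 < n \<Longrightarrow> random_dcc n = map_pmf polyomino_of (word_pmf n)"
proof -
  assume n: "0 < n"
  have "bij_betw polyomino_of (words n) (dccs n)"
    unfolding bij_betw_def using inj_polyomino_of[OF n] polyomino_of_in_dccs[OF _ n] surj_polyomino_of[OF _ n] by blast
  then show ?thesis
    unfolding random_dcc_def word_pmf_def
    by (intro map_pmf_of_set_bij_betw[symmetric] words_nonempty finite_words)
qed

section \<open>The perimeter process of a word\<close>

text \<open>In contrast to \<open>walk\<close>, only blocks that end at area \<open>s\<close> or before are counted, as in \<open>Rbar\<close>.\<close>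

fun word_perimeter :: "nat \<Rightarrow> block list \<Rightarrow> nat \<Rightarrow> int" where
  "word_perimeter u0 [] s = 0"
| "word_perimeter u0 (b # L) s = (if bsize b \<le> s then \<bar>int (bsize b) - int u0\<bar> + int (snd b) + 2 + word_perimeter (fst b) L (s - bsize b) else 0)"

definition blocks_within :: "block list \<Rightarrow> nat \<Rightarrow> nat" where
  "blocks_within L s = Max {d. d \<le> length L \<and> (\<Sum>i<d. bsize (L ! i)) \<le> s}"

lemma blocks_within_Nil [simp]: "blocks_within [] s = 0"
  unfolding blocks_within_def by (intro Max_eqI) auto

lemma blocks_within_Cons: "blocks_within (b # L) s = (if bsize b \<le> s then Suc (blocks_within L (s - bsize b)) else 0)"
proof -
  let ?A = "\<lambda>L s. {d. d \<le> length L \<and> (\<Sum>i<d. bsize (L ! i)) \<le> s}"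
  have fin: "finite (?A L s)" for L s by (rule finite_subset[of _ "{..length L}"]) auto
  have memS: "Suc d \<in> ?A (b # L) s \<longleftrightarrow> bsize b \<le> s \<and> d \<in> ?A L (s - bsize b)" for d
    by (auto simp: sum.lessThan_Suc_shift simp del: sum.lessThan_Suc)
  show ?thesis
  proof (cases "bsize b \<le> s")
    case True
    have "0 \<in> ?A L (s - bsize b)" by simp
    then have M: "Max (?A L (s - bsize b)) \<in> ?A L (s - bsize b)" using fin Max_in by blast
    have "Max (?A (b # L) s) = Suc (Max (?A L (s - bsize b)))"
    proof (rule Max_eqI[OF fin])
      fix y assume y: "y \<in> ?A (b # L) s"
      show "y \<le> Suc (Max (?A L (s - bsize b)))"
      proof (cases y)
        case (Suc d)
        then have "d \<in> ?A L (s - bsize b)" using y memS[of d] by (simp only:)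
        then have "d \<le> Max (?A L (s - bsize b))" by (rule Max_ge[OF fin])
        then show ?thesis using Suc by simp
      qed simp
    next
      show "Suc (Max (?A L (s - bsize b))) \<in> ?A (b # L) s" unfolding memS using M True by (rule conjI[rotated])
    qed
    then show ?thesis using True by (simp add: blocks_within_def)
  next
    case False
    have "Max (?A (b # L) s) = 0"
    proof (rule Max_eqI[OF fin])
      fix y assume y: "y \<in> ?A (b # L) s"
      show "y \<le> 0"
      proof (cases y)
        case (Suc d)
        have "bsize b \<le> s" using y[unfolded Suc memS] by (rule conjunct1)
        then show ?thesis using False by simp
      qed simp
    qed simp
    then show ?thesis using False by (simp add: blocks_within_def)
  qed
qed

lemma word_perimeter_eq_sum:
  "word_perimeter u0 L s = (\<Sum>i<blocks_within L s. \<bar>int (bsize (L ! i)) - int (if i = 0 then u0 else fst (L ! (i - 1)))\<bar> + int (snd (L ! i)) + 2)"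
proof (induction L arbitrary: u0 s)
  case (Cons b L)
  show ?case
  proof (cases "bsize b \<le> s")
    case True
    have e: "(if Suc i = 0 then u0 else fst ((b # L) ! (Suc i - 1))) = (if i = 0 then fst b else fst (L ! (i - 1)))" for i
      by (cases i) auto
    show ?thesis using True
      by (simp add: blocks_within_Cons sum.lessThan_Suc_shift Cons nth_Cons' if_distrib[of fst] cong: sum.cong del: sum.lessThan_Suc)
  qed (simp add: blocks_within_Cons)
qed simp

text \<open>The convention \<open>w\<^sub>1 = 0\<close> amounts to a fictitious block before the first column with \<open>u\<close> equal to the
size of that column.\<close>

lemma Rbar_polyomino_of:
  assumes L: "L \<in> words n" and n: "0 < n"
  shows "Rbar (polyomino_of L) s = word_perimeter (bsize (hd L)) L s"
proof -
  note w = words_pos[OF L n]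
  have cw: "columns_within (polyomino_of L) s = blocks_within L s"
  proof -
    have "(\<Sum>i=1..d. column_size (polyomino_of L) i) = (\<Sum>i<d. bsize (L ! i))" if "d \<le> length L" for d
    proof -
      have "(\<Sum>i=1..d. column_size (polyomino_of L) i) = (\<Sum>i<d. column_size (polyomino_of L) (Suc i))"
        by (rule sum.reindex_bij_witness[of _ Suc "\<lambda>i. i - 1"]) auto
      also have "\<dots> = (\<Sum>i<d. bsize (L ! i))" using that column_size_polyomino_of[OF w(1-3)] by (intro sum.cong) auto
      finally show ?thesis .
    qed
    then have "{d. d \<le> length L \<and> (\<Sum>i=1..d. column_size (polyomino_of L) i) \<le> s} = {d. d \<le> length L \<and> (\<Sum>i<d. bsize (L ! i)) \<le> s}"
      by (intro Collect_cong conj_cong) auto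
    moreover have "width (polyomino_of L) = length L" by (rule width_polyomino_of) (use w in auto)
    ultimately have "{d. d \<le> width (polyomino_of L) \<and> (\<Sum>i=1..d. column_size (polyomino_of L) i) \<le> s} = {d. d \<le> length L \<and> (\<Sum>i<d. bsize (L ! i)) \<le> s}"
      by (simp only:)
    then show ?thesis by (simp add: columns_within_def blocks_within_def)
  qed
  have le: "blocks_within L s \<le> length L"
  proof -
    have fin: "finite {d. d \<le> length L \<and> (\<Sum>i<d. bsize (L ! i)) \<le> s}" by (rule finite_subset[of _ "{..length L}"]) auto
    have "0 \<in> {d. d \<le> length L \<and> (\<Sum>i<d. bsize (L ! i)) \<le> s}" by simp
    then have "blocks_within L s \<in> {d. d \<le> length L \<and> (\<Sum>i<d. bsize (L ! i)) \<le> s}" unfolding blocks_within_def using fin Max_in by blast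
    then show ?thesis by simp
  qed
  let ?K = "blocks_within L s"
  have "(\<Sum>d=1..?K. T_step (polyomino_of L) d) = (\<Sum>i<?K. T_step (polyomino_of L) (Suc i))"
    by (rule sum.reindex_bij_witness[of _ Suc "\<lambda>i. i - 1"]) auto
  also have "\<dots> = (\<Sum>i<?K. \<bar>int (bsize (L ! i)) - int (if i = 0 then bsize (hd L) else fst (L ! (i - 1)))\<bar> + int (snd (L ! i)))"
  proof (rule sum.cong[OF refl])
    fix i assume "i \<in> {..<?K}"
    then have i: "i < length L" using le by simp
    show "T_step (polyomino_of L) (Suc i) = \<bar>int (bsize (L ! i)) - int (if i = 0 then bsize (hd L) else fst (L ! (i - 1)))\<bar> + int (snd (L ! i))"
      using w(1) by (simp add: T_step_def w_step_polyomino_of[OF w(1-3) i] z_step_polyomino_of[OF w(1-3) i] hd_conv_nth)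
  qed
  finally show ?thesis
    unfolding Rbar_def cw word_perimeter_eq_sum by (simp add: sum.distrib)
qed

text \<open>The boundary terms \<open>pdist\<close> telescope; what is left is the last of them and the contribution of the
straddling block.\<close>

lemma word_perimeter_close_walk:
  assumes R: "1 \<le> R" "real u0 \<le> R" "\<And>b. b \<in> set L \<Longrightarrow> 1 \<le> fst b \<and> real (bsize b) \<le> R" and s: "s \<le> sum_list (map bsize L)"
  shows "\<bar>of_int (word_perimeter u0 L s) - mu4 * real s - walk u0 L s - pdist u0\<bar> \<le> 20 * R"
  using assms(2-)
proof (induction L arbitrary: u0 s)
  case Nil
  then show ?case using pdist_bounds[of u0] R(1) by simp
next
  case (Cons b L)
  have p: "0 \<le> pdist u0" "pdist u0 \<le> 4 * R" using pdist_bounds[of u0] R(1) Cons.prems(1) by linarith+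
  have b: "1 \<le> fst b" "real (bsize b) \<le> R" "1 \<le> bsize b" using Cons.prems(2)[of b] by (auto simp: bsize_def)
  have fR: "real (fst b) \<le> R" using b(2) by (simp add: bsize_def)
  show ?case
  proof (cases "bsize b \<le> s")
    case True
    then have s0: "s \<noteq> 0" using b(3) by simp
    have IH: "\<bar>of_int (word_perimeter (fst b) L (s - bsize b)) - mu4 * real (s - bsize b) - walk (fst b) L (s - bsize b) - pdist (fst b)\<bar> \<le> 20 * R"
      using Cons.prems fR True by (intro Cons.IH) auto
    have "of_int (word_perimeter u0 (b # L) s) - mu4 * real s - walk u0 (b # L) s - pdist u0
       = of_int (word_perimeter (fst b) L (s - bsize b)) - mu4 * real (s - bsize b) - walk (fst b) L (s - bsize b) - pdist (fst b)"
      using True s0 by (simp add: incr_def block_part_def of_nat_diff algebra_simps)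
    then show ?thesis using IH by simp
  next
    case False
    show ?thesis
    proof (cases "s = 0")
      case True
      then show ?thesis using False p R(1) by simp
    next
      case s0: False
      have "\<bar>incr u0 b\<bar> \<le> 11 * R" using incr_bound[OF b(3), of u0] b(2) by linarith
      moreover have "0 \<le> mu4 * real s" "mu4 * real s \<le> 2 * R"
        using mu4_bounds False b(2) by (auto intro!: mult_mono)
      ultimately show ?thesis using False s0 p by simp
    qed
  qed
qed

lemma Rbar_close_walk:
  assumes L: "L \<in> words n" and n: "0 < n" and R: "1 \<le> R" "\<And>b. b \<in> set L \<Longrightarrow> real (bsize b) \<le> R" and s: "s \<le> n"
  shows "\<bar>of_int (Rbar (polyomino_of L) s) - mu4 * real s - walk 0 L s\<bar> \<le> 50 * R"
proof -
  note w = words_pos[OF L n]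
  let ?u = "bsize (hd L)"
  have h: "hd L \<in> set L" "L = hd L # tl L" using w(1) by auto
  have u: "real ?u \<le> R" "1 \<le> ?u" using R(2)[OF h(1)] w(2)[OF h(1)] by (auto simp: bsize_def)
  have 1: "\<bar>of_int (word_perimeter ?u L s) - mu4 * real s - walk ?u L s - pdist ?u\<bar> \<le> 20 * R"
  proof (rule word_perimeter_close_walk[OF R(1) u(1)])
    show "1 \<le> fst b \<and> real (bsize b) \<le> R" if "b \<in> set L" for b using w(2)[OF that] R(2)[OF that] ..
    show "s \<le> sum_list (map bsize L)" using s w(4) by simp
  qed
  have "walk ?u L s - walk 0 L s = (if s = 0 then 0 else incr ?u (hd L) - incr 0 (hd L))"
    by (subst (1 2) h(2)) simp
  moreover have "\<bar>incr v (hd L)\<bar> \<le> 11 * R" for v using incr_bound[OF u(2), of v] u(1) by linarith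
  note this[of ?u] this[of 0]
  ultimately have "\<bar>walk ?u L s - walk 0 L s\<bar> \<le> 22 * R" using R(1) by (auto simp: abs_le_iff)
  moreover have "0 \<le> pdist ?u" "pdist ?u \<le> 4 * R" using pdist_bounds[of ?u] R(1) u(1) by linarith+
  ultimately show ?thesis using 1 R(1) unfolding Rbar_polyomino_of[OF L n] by linarith
qed

section \<open>The limit theorems\<close>

lemma cut_add_all:
  "cut_u (cut_u u L s) (cut_rest L s) (a - cut_over L s) = cut_u u L (s + a) \<and>
   cut_rest (cut_rest L s) (a - cut_over L s) = cut_rest L (s + a) \<and>
   cut_over (cut_rest L s) (a - cut_over L s) + (cut_over L s - a) = cut_over L (s + a)"
proof (induction L arbitrary: u s)
  case (Cons b L)
  show ?case
  proof (cases "s < bsize b")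
    case True
    then have "s + a - bsize b = a - (bsize b - s)" by simp
    then show ?thesis using True by (cases "s = 0") auto
  next
    case False
    show ?thesis
    proof (cases "s = bsize b")
      case True
      then show ?thesis by (cases "a = 0") auto
    next
      case ne: False
      then have "s + a - bsize b = (s - bsize b) + a" using False by simp
      then show ?thesis using False ne Cons[of "fst b" "s - bsize b"] by auto
    qed
  qed
qed simp

lemmas cut_add = cut_add_all[THEN conjunct1] cut_add_all[THEN conjunct2, THEN conjunct1] cut_add_all[THEN conjunct2, THEN conjunct2]

lemma sum_incs:
  "j \<le> length as \<Longrightarrow> sum_list (take j (incs as (cut_u u L s) (cut_over L s) (cut_rest L s))) = walk u L (s + sum_list (take j as)) - walk u L s"
proof (induction as arbitrary: s j)
  case (Cons a as)
  show ?case
  proof (cases j)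
    case (Suc i)
    have "sum_list (take j (incs (a # as) (cut_u u L s) (cut_over L s) (cut_rest L s)))
       = walk (cut_u u L s) (cut_rest L s) (a - cut_over L s) + sum_list (take i (incs as (cut_u u L (s + a)) (cut_over L (s + a)) (cut_rest L (s + a))))"
      by (simp add: Suc cut_add)
    also have "\<dots> = walk (cut_u u L s) (cut_rest L s) (a - cut_over L s) + (walk u L (s + a + sum_list (take i as)) - walk u L (s + a))"
      using Cons.IH[of i "s + a"] Cons.prems Suc by simp
    also have "\<dots> = walk u L (s + sum_list (take j (a # as))) - walk u L s"
      unfolding walk_add[of u L s a] by (simp add: Suc add.assoc)
    finally show ?thesis .
  qed simp
qed simp

text \<open>The partial sums of the increments over the windows are the values of the walk at the grid points.\<close>

lemma psums_incs: "j \<le> length as \<Longrightarrow> psums (map (\<lambda>m. m / c) (incs as u 0 L)) j = walk u L (sum_list (take j as)) / c"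
proof -
  assume j: "j \<le> length as"
  have "sum_list (map (\<lambda>m. m / c) xs) = sum_list xs / c" for xs :: "real list"
    by (induction xs) (auto simp: add_divide_distrib)
  then show ?thesis using sum_incs[OF j, of u L 0] by (simp add: psums_def take_map)
qed

text \<open>The ends of \<open>k\<close> windows of nearly equal integer areas that partition \<open>N\<close>.\<close>

definition gridpt :: "nat \<Rightarrow> nat \<Rightarrow> nat \<Rightarrow> nat" where "gridpt k N j = N * j div k"

definition windows :: "nat \<Rightarrow> nat \<Rightarrow> nat list" where
  "windows k N = map (\<lambda>j. gridpt k N (Suc j) - gridpt k N j) [0..<k]"

lemma gridpt_mono: "gridpt k N j \<le> gridpt k N (Suc j)"
  unfolding gridpt_def by (intro div_le_mono mult_le_mono2) simp

lemma gridpt_real: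
  assumes "0 < k" shows "real (gridpt k N j) \<le> real N * real j / real k" "real N * real j / real k < real (gridpt k N j) + 1"
proof -
  have "real (gridpt k N j) = of_int \<lfloor>real (N * j) / real k\<rfloor>"
    unfolding gridpt_def by (metis floor_divide_of_nat_eq of_int_of_nat_eq)
  then show "real (gridpt k N j) \<le> real N * real j / real k" "real N * real j / real k < real (gridpt k N j) + 1"
    by (simp_all add: of_nat_mult)
qed

lemma sum_windows: "j \<le> k \<Longrightarrow> sum_list (take j (windows k N)) = gridpt k N j"
proof (induction j)
  case (Suc j)
  then have "take (Suc j) (windows k N) = take j (windows k N) @ [windows k N ! j]"
    by (intro take_Suc_conv_app_nth) (simp add: windows_def)
  then show ?case using Suc gridpt_mono[of k N j] by (simp add: windows_def)
qed (simp add: gridpt_def)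

lemma window_size:
  assumes k: "0 < k" and a: "a \<in> set (windows k N)"
  shows "\<bar>real a - 1 / real k * real N\<bar> \<le> 1"
proof -
  obtain j where j: "j < k" "a = gridpt k N (Suc j) - gridpt k N j" using a by (auto simp: windows_def)
  have "real a = real (gridpt k N (Suc j)) - real (gridpt k N j)" using j gridpt_mono[of k N j] by (simp add: of_nat_diff)
  moreover have "real N * real (Suc j) / real k = real N * real j / real k + 1 / real k * real N"
    by (simp add: add_divide_distrib algebra_simps)
  ultimately show ?thesis using gridpt_real[OF k, of N j] gridpt_real[OF k, of N "Suc j"] by (simp only: abs_le_iff) linarith
qed

text \<open>The rescaled walk, frozen between the grid points.\<close>

definition coarse :: "nat \<Rightarrow> nat \<Rightarrow> block list \<Rightarrow> real \<Rightarrow> real" where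
  "coarse k N L = stepf k (\<lambda>j. walk 0 L (gridpt k N j) / path_scale N)"

lemma coarse_limit:
  assumes k: "0 < k" and g: "\<And>x y. x \<in> D01 \<Longrightarrow> y \<in> D01 \<Longrightarrow> \<bar>g x - g y\<bar> \<le> skorokhod_dist x y" "\<And>x. x \<in> D01 \<Longrightarrow> \<bar>g x\<bar> \<le> 1"
  shows "(\<lambda>N. avg N (\<lambda>L. g (coarse k N L))) \<longlonglongrightarrow> gaussE k (1 / real k) (\<lambda>xs. g (stepf k (psums xs)))"
proof (rule LIMSEQ_I)
  fix e :: real assume e: "0 < e"
  let ?F = "\<lambda>xs. g (stepf k (psums xs))"
  have \<tau>: "0 < 1 / real k" "1 / real k \<le> 1" using k by auto
  obtain d N0 where d: "0 < d" "\<And>N n u v as F. N0 \<le> N \<Longrightarrow> length as = k \<Longrightarrow> (\<forall>a\<in>set as. \<bar>real a - 1 / real k * real N\<bar> \<le> d * real N) \<Longrightarrow>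
     real v \<le> d * real N \<Longrightarrow> n \<le> N \<Longrightarrow> sum_list as \<le> n + v \<Longrightarrow> BL k F \<Longrightarrow>
     \<bar>avg n (\<lambda>L. F (map (\<lambda>m. m / path_scale N) (incs as u v L))) - gaussE k (1 / real k) F\<bar> < e"
    using fidi_CLT[OF \<tau> e, of k] by blast
  obtain N1 :: nat where N1: "1 / d < real N1" using reals_Archimedean2 by blast
  show "\<exists>N0. \<forall>N\<ge>N0. norm (avg N (\<lambda>L. g (coarse k N L)) - gaussE k (1 / real k) ?F) < e"
  proof (intro exI[of _ "max N0 N1"] allI impI)
    fix N assume N: "max N0 N1 \<le> N"
    have "1 / d < real N" using N N1 by linarith
    then have dN: "1 \<le> d * real N" using d(1) by (simp add: divide_less_eq mult.commute)
    have len: "length (windows k N) = k" by (simp add: windows_def)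
    have total: "sum_list (windows k N) = N"
      using sum_windows[of k k N] len k by (simp add: gridpt_def)
    have "\<bar>avg N (\<lambda>L. ?F (map (\<lambda>m. m / path_scale N) (incs (windows k N) 0 0 L))) - gaussE k (1 / real k) ?F\<bar> < e"
    proof (rule d(2))
      show "\<forall>a\<in>set (windows k N). \<bar>real a - 1 / real k * real N\<bar> \<le> d * real N"
        using window_size[OF k, of _ N] dN by fastforce
      show "BL k ?F" by (rule BL_stepf[OF g])
    qed (use N len total d(1) in auto)
    moreover have "stepf k (psums (map (\<lambda>m. m / path_scale N) (incs (windows k N) 0 0 L))) = coarse k N L" for L
      unfolding coarse_def stepf_def
    proof (rule restrict_ext)
      fix t :: real assume "t \<in> {0..1}"
      from nat_floor_le[OF this, of k]
      show "psums (map (\<lambda>m. m / path_scale N) (incs (windows k N) 0 0 L)) (nat \<lfloor>real k * t\<rfloor>) = walk 0 L (gridpt k N (nat \<lfloor>real k * t\<rfloor>)) / path_scale N"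
        by (subst psums_incs) (simp_all add: len sum_windows)
    qed
    ultimately show "norm (avg N (\<lambda>L. g (coarse k N L)) - gaussE k (1 / real k) ?F) < e" by simp
  qed
qed

text \<open>The windows are closed on the right, since a time \<open>t\<close> in \<open>[j / k, (j + 1) / k)\<close> may be rounded to the next
grid point.\<close>

definition oscillates :: "nat \<Rightarrow> nat \<Rightarrow> real \<Rightarrow> block list \<Rightarrow> bool" where
  "oscillates k N l L \<longleftrightarrow> (\<exists>j<k. \<exists>t\<le>gridpt k N (Suc j) - gridpt k N j. l \<le> \<bar>walk 0 L (gridpt k N j + t) - walk 0 L (gridpt k N j)\<bar>)"

lemma process_close_coarse:
  assumes L: "L \<in> words N" and N: "0 < N" and k: "0 < k" and R: "1 \<le> R" "\<And>b. b \<in> set L \<Longrightarrow> real (bsize b) \<le> R"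
    and osc: "\<not> oscillates k N l L" and l: "0 < l"
  shows "skorokhod_dist (perimeter_process N (polyomino_of L)) (coarse k N L) \<le> (50 * R + 2 + l) / path_scale N"
proof (rule skorokhod_dist_le_sup)
  show "perimeter_process N (polyomino_of L) \<in> D01" by (rule perimeter_process_D01)
  show "coarse k N L \<in> D01" unfolding coarse_def by (rule stepf_D01)
  fix t :: real assume t: "t \<in> {0..1}"
  define s where "s = nat \<lfloor>real N * t\<rfloor>"
  define j where "j = nat \<lfloor>real k * t\<rfloor>"
  have Nt: "0 \<le> real N * t" "0 \<le> real k * t" using t by auto
  have s: "s \<le> N" "real s \<le> real N * t" "real N * t < real s + 1"
    using nat_floor_le[OF t, of N] Nt unfolding s_def by (simp, linarith+)
  have j: "j \<le> k" "real j \<le> real k * t" "real k * t < real j + 1"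
    using nat_floor_le[OF t, of k] Nt unfolding j_def by (simp, linarith+)
  have sc: "0 < path_scale N" using N sigma4_pos by (simp add: path_scale_def)
  have 1: "\<bar>of_int (Rbar (polyomino_of L) s) - mu4 * real s - walk 0 L s\<bar> \<le> 50 * R" by (rule Rbar_close_walk[OF L N R s(1)])
  have 2: "\<bar>walk 0 L s - walk 0 L (gridpt k N j)\<bar> \<le> l"
  proof (cases "j < k")
    case True
    have lo: "gridpt k N j \<le> s"
    proof -
      have "real N * real j / real k \<le> real N * t"
        using j(2) k by (simp add: divide_le_eq mult.assoc mult.commute[of t] mult_left_mono)
      then have "real (gridpt k N j) < real s + 1" using gridpt_real(1)[OF k, of N j] s(3) by linarith
      then show ?thesis by linarith
    qed
    have hi: "s \<le> gridpt k N (Suc j)"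
    proof -
      have "real N * t \<le> real N * real (Suc j) / real k"
        using j(3) k by (simp add: le_divide_eq mult.assoc mult.commute[of t] mult_left_mono)
      then have "real s < real (gridpt k N (Suc j)) + 1" using gridpt_real(2)[OF k, of N "Suc j"] s(2) by linarith
      then show ?thesis by linarith
    qed
    have "gridpt k N j + (s - gridpt k N j) = s" "s - gridpt k N j \<le> gridpt k N (Suc j) - gridpt k N j" using lo hi by auto
    then have "\<not> l \<le> \<bar>walk 0 L s - walk 0 L (gridpt k N j)\<bar>" using osc True unfolding oscillates_def by metis
    then show ?thesis by simp
  next
    case False
    then have "j = k" using j(1) by simp
    then have "1 \<le> t" using j(2) k by simp
    then have "t = 1" using t by simp
    then have "s = N" "gridpt k N j = N" using k by (simp_all add: s_def \<open>j = k\<close> gridpt_def)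
    then show ?thesis using l by simp
  qed
  have 3: "\<bar>mu4 * (real N * t) - mu4 * real s\<bar> \<le> 2"
  proof -
    have "mu4 * (real N * t - real s) \<le> 2 * 1" using mu4_bounds s by (intro mult_mono) auto
    moreover have "0 \<le> mu4 * (real N * t - real s)" using mu4_bounds s by simp
    ultimately show ?thesis by (simp add: right_diff_distrib)
  qed
  have "perimeter_process N (polyomino_of L) t - coarse k N L t = ((of_int (Rbar (polyomino_of L) s) - mu4 * (real N * t)) - walk 0 L (gridpt k N j)) / path_scale N"
    using t by (simp add: perimeter_process_def coarse_def stepf_def path_scale_def s_def j_def diff_divide_distrib mult.commute)
  moreover have "\<bar>(of_int (Rbar (polyomino_of L) s) - mu4 * (real N * t)) - walk 0 L (gridpt k N j)\<bar> \<le> 50 * R + 2 + l"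
    using 1 2 3 by linarith
  ultimately show "\<bar>perimeter_process N (polyomino_of L) t - coarse k N L t\<bar> \<le> (50 * R + 2 + l) / path_scale N"
    using sc by (simp add: divide_right_mono)
qed

text \<open>The maximal inequality after a cut at the start of each window, with \<open>\<theta> = sqrt (k / N)\<close>. As the
windows have area about \<open>N / k\<close>, the quadratic term stays bounded, while the linear one is
\<open>d * sqrt k\<close>; this beats the number \<open>k\<close> of windows.\<close>

lemma avg_oscillates:
  obtains C where "0 \<le> C"
    "\<And>k N d. 0 < k \<Longrightarrow> 44 * 44 * k \<le> N \<Longrightarrow> avg N (\<lambda>L. of_bool (oscillates k N (d * sqrt (real N)) L)) \<le> real k * (8 * exp (2 * C - d * sqrt (real k)))"
proof -
  obtain C where C: "0 \<le> C" "\<And>\<theta> n a u0 l. 0 \<le> \<theta> \<Longrightarrow> \<theta> \<le> 1/44 \<Longrightarrow>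
      avg n (\<lambda>L. of_bool (\<exists>s\<le>a. l \<le> \<bar>walk u0 L s\<bar>)) \<le> 8 * exp (C * \<theta>\<^sup>2 * real a - \<theta> * l)"
    using maximal_inequality by blast
  show thesis
  proof (rule that[OF C(1)])
    fix k N :: nat and d :: real assume k: "0 < k" and N: "44 * 44 * k \<le> N"
    define \<theta> where "\<theta> = sqrt (real k) / sqrt (real N)"
    have Np: "0 < real N" using k N by simp
    have "real (44 * 44 * k) \<le> real N" using N by (simp only: of_nat_le_iff)
    then have "real k / real N \<le> (1/44)\<^sup>2" using Np by (simp add: divide_le_eq power2_eq_square)
    then have \<theta>: "0 \<le> \<theta>" "\<theta> \<le> 1/44" "\<theta>\<^sup>2 = real k / real N"
      unfolding \<theta>_def real_sqrt_divide[symmetric] using real_le_lsqrt[of "1/44" "real k / real N"] by (auto intro: real_le_lsqrt)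
    define a where "a j = gridpt k N (Suc j) - gridpt k N j" for j
    let ?l = "d * sqrt (real N)"
    let ?E = "8 * exp (2 * C - d * sqrt (real k))"
    have one: "avg N (\<lambda>L. of_bool (\<exists>t\<le>a j. ?l \<le> \<bar>walk 0 L (gridpt k N j + t) - walk 0 L (gridpt k N j)\<bar>)) \<le> ?E" if j: "j < k" for j
    proof -
      let ?s = "gridpt k N j"
      let ?P = "\<lambda>m u v L. of_bool (\<exists>t\<le>a j. ?l \<le> \<bar>walk u L t\<bar>) :: real"
      have sN: "?s \<le> N" 
      proof -
        have "N * j div k \<le> N * k div k" using j by (intro div_le_mono mult_le_mono2) simp
        then show ?thesis using k by (simp add: gridpt_def)
      qed
      have aj: "real (a j) \<le> 1 / real k * real N + 1"
        using window_size[OF k, of "a j" N] j by (auto simp: windows_def a_def abs_le_iff)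
      have ex: "8 * exp (C * \<theta>\<^sup>2 * real (a j) - \<theta> * ?l) \<le> ?E"
      proof -
        have "\<theta>\<^sup>2 * real (a j) \<le> real k / real N * (1 / real k * real N + 1)" unfolding \<theta> using aj by (intro mult_left_mono) auto
        also have "\<dots> = 1 + real k / real N" using k Np by (simp add: field_simps)
        also have "\<dots> \<le> 2" using N Np by (simp add: divide_le_eq)
        finally have "C * (\<theta>\<^sup>2 * real (a j)) \<le> C * 2" using C(1) by (intro mult_left_mono)
        moreover have "\<theta> * ?l = d * sqrt (real k)" using Np by (simp add: \<theta>_def)
        ultimately have "C * \<theta>\<^sup>2 * real (a j) - \<theta> * ?l \<le> 2 * C - d * sqrt (real k)"
          unfolding mult.assoc[of C] by linarith
        then show ?thesis by simp
      qed
      have "avg N (\<lambda>L. of_bool (\<exists>t\<le>a j. ?l \<le> \<bar>walk 0 L (?s + t) - walk 0 L ?s\<bar>)) \<le> avg N (\<lambda>L. ?P (walk 0 L ?s) (cut_u 0 L ?s) (cut_over L ?s) (cut_rest L ?s))"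
      proof (rule avg_mono)
        fix L
        have "\<exists>t'\<le>a j. ?l \<le> \<bar>walk (cut_u 0 L ?s) (cut_rest L ?s) t'\<bar>" if "t \<le> a j" "?l \<le> \<bar>walk 0 L (?s + t) - walk 0 L ?s\<bar>" for t
          using that by (intro exI[of _ "t - cut_over L ?s"]) (simp add: walk_add)
        then show "of_bool (\<exists>t\<le>a j. ?l \<le> \<bar>walk 0 L (?s + t) - walk 0 L ?s\<bar>) \<le> ?P (walk 0 L ?s) (cut_u 0 L ?s) (cut_over L ?s) (cut_rest L ?s)"
          by (auto simp: of_bool_def)
      qed
      also have "\<dots> = avg N (\<lambda>L. avg (N - ?s - cut_over L ?s) (?P (walk 0 L ?s) (cut_u 0 L ?s) (cut_over L ?s)))"
        by (rule avg_cut[OF sN])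
      also have "\<dots> \<le> avg N (\<lambda>_. ?E)"
        by (intro avg_mono order_trans[OF C(2)[OF \<theta>(1,2)] ex])
      finally show ?thesis by (simp add: avg_const)
    qed
    have "avg N (\<lambda>L. of_bool (oscillates k N ?l L)) \<le> avg N (\<lambda>L. \<Sum>j<k. of_bool (\<exists>t\<le>a j. ?l \<le> \<bar>walk 0 L (gridpt k N j + t) - walk 0 L (gridpt k N j)\<bar>) :: real)"
    proof (rule avg_mono)
      fix L
      let ?q = "\<lambda>j. of_bool (\<exists>t\<le>a j. ?l \<le> \<bar>walk 0 L (gridpt k N j + t) - walk 0 L (gridpt k N j)\<bar>) :: real"
      show "of_bool (oscillates k N ?l L) \<le> (\<Sum>j<k. ?q j)"
      proof (cases "oscillates k N ?l L")
        case True
        then obtain j where j: "j < k" "?q j = 1" unfolding oscillates_def a_def by auto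
        have "?q j \<le> (\<Sum>j<k. ?q j)" using j by (intro member_le_sum) auto
        then show ?thesis using j True by simp
      next
        case False
        then show ?thesis by (simp add: sum_nonneg)
      qed
    qed
    also have "\<dots> = (\<Sum>j<k. avg N (\<lambda>L. of_bool (\<exists>t\<le>a j. ?l \<le> \<bar>walk 0 L (gridpt k N j + t) - walk 0 L (gridpt k N j)\<bar>)))"
      by (rule avg_sum)
    also have "\<dots> \<le> (\<Sum>j<k. ?E)" using one by (intro sum_mono) auto
    finally show "avg N (\<lambda>L. of_bool (oscillates k N ?l L)) \<le> real k * ?E" by simp
  qed
qed

lemma avg_large_scaled:
  assumes d: "0 < d"
  shows "(\<lambda>N. avg N (\<lambda>L. of_bool (\<exists>b\<in>set L. d * sqrt (real N) < real (bsize b)) :: real)) \<longlonglongrightarrow> 0"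
proof -
  obtain C where C: "0 \<le> C" "\<And>n r. 0 < r \<Longrightarrow> avg n (\<lambda>L. of_bool (\<exists>b\<in>set L. r < real (bsize b))) \<le> C * real n / r ^ 4"
    using avg_large_block by blast
  show ?thesis
  proof (rule Lim_null_comparison)
    have "(\<lambda>N. C / d ^ 4 * (1 / real N)) \<longlonglongrightarrow> C / d ^ 4 * 0" by (intro tendsto_intros lim_1_over_n)
    then show "(\<lambda>N. C / d ^ 4 * (1 / real N)) \<longlonglongrightarrow> 0" by simp
    show "\<forall>\<^sub>F N in sequentially. norm (avg N (\<lambda>L. of_bool (\<exists>b\<in>set L. d * sqrt (real N) < real (bsize b)) :: real)) \<le> C / d ^ 4 * (1 / real N)"
      using eventually_gt_at_top[of 0]
    proof eventually_elim
      case (elim N)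
      have p: "0 < d * sqrt (real N)" using elim d by simp
      have "sqrt (real N) ^ 4 = (sqrt (real N) ^ 2) ^ 2" by (simp only: power_mult[symmetric]) simp
      then have "sqrt (real N) ^ 4 = real N * real N" by (simp add: power2_eq_square)
      then have "C * real N / (d * sqrt (real N)) ^ 4 = C / d ^ 4 * (1 / real N)"
        using elim by (simp add: power_mult_distrib)
      moreover have "0 \<le> avg N (\<lambda>L. of_bool (\<exists>b\<in>set L. d * sqrt (real N) < real (bsize b)) :: real)"
        using avg_mono[of N "\<lambda>_. 0"] by (simp add: avg_const)
      ultimately show ?case using C(2)[OF p, of N] by simp
    qed
  qed
qed

lemma expectation_random_dcc:
  fixes f :: "cell set \<Rightarrow> 'a::{banach,second_countable_topology}"
  assumes "0 < n" shows "measure_pmf.expectation (random_dcc n) f = avg n (\<lambda>L. f (polyomino_of L))"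
  unfolding random_dcc_words[OF assms] by (simp add: expectation_word_pmf)

text \<open>The process is replaced by its coarse version at the cost of a small uniform error outside a
rare event; then \<open>coarse_limit\<close> and \<open>Brownian_Lipschitz\<close> apply. The number \<open>k\<close> of windows is chosen
before \<open>N\<close> tends to infinity.\<close>

lemma process_limit:
  fixes M :: "'b measure"
  assumes B: "standard_brownian_motion M B"
    and g: "\<And>x y. x \<in> D01 \<Longrightarrow> y \<in> D01 \<Longrightarrow> \<bar>g x - g y\<bar> \<le> skorokhod_dist x y" "\<And>x. x \<in> D01 \<Longrightarrow> \<bar>g x\<bar> \<le> 1"
  shows "(\<lambda>n. measure_pmf.expectation (random_dcc n) (\<lambda>P. g (perimeter_process n P))) \<longlonglongrightarrow> (\<integral>\<omega>. g (path_of B \<omega>) \<partial>M)"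
proof (rule LIMSEQ_I)
  fix e :: real assume e: "0 < e"
  obtain C where C: "0 \<le> C" "\<And>k N d. 0 < k \<Longrightarrow> 44 * 44 * k \<le> N \<Longrightarrow> avg N (\<lambda>L. of_bool (oscillates k N (d * sqrt (real N)) L)) \<le> real k * (8 * exp (2 * C - d * sqrt (real k)))"
    using avg_oscillates by blast
  \<comment> \<open>On the good event the distance to the coarse process is at most \<open>53 * d / sigma4\<close>.\<close>
  define d where "d = e * sigma4 / (53 * 8)"
  have d: "0 < d" "53 * d / sigma4 = e / 8" using e sigma4_pos by (auto simp: d_def)
  let ?G = "\<lambda>k. gaussE k (1 / real k) (\<lambda>xs. g (stepf k (psums xs)))"
  let ?I = "\<integral>\<omega>. g (path_of B \<omega>) \<partial>M"
  have lim: "(\<lambda>k. real k * (8 * exp (2 * C - d * sqrt (real k)))) \<longlonglongrightarrow> 0" using d(1) by real_asymp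
  \<comment> \<open>\<open>Suc k\<close> rather than \<open>k\<close>: the grid must have at least one window.\<close>
  have l1: "\<forall>\<^sub>F k in sequentially. real (Suc k) * (8 * exp (2 * C - d * sqrt (real (Suc k)))) < e / 16"
    by (rule order_tendstoD(2)[OF LIMSEQ_Suc[OF lim]]) (use e in simp)
  have l2: "\<forall>\<^sub>F k in sequentially. dist (?G (Suc k)) ?I < e / 8"
    by (rule tendstoD[OF Brownian_Lipschitz(2)[OF B g]]) (use e in auto)
  obtain k0 where k0: "real (Suc k0) * (8 * exp (2 * C - d * sqrt (real (Suc k0)))) < e / 16" "dist (?G (Suc k0)) ?I < e / 8"
    using eventually_happens'[OF sequentially_bot eventually_conj[OF l1 l2]] by blast
  define k where "k = Suc k0"
  have k: "0 < k" "real k * (8 * exp (2 * C - d * sqrt (real k))) < e / 16" "\<bar>?G k - ?I\<bar> < e / 8"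
    using k0 by (auto simp: k_def dist_real_def)
  let ?b1 = "\<lambda>N L. of_bool (\<exists>b\<in>set L. d * sqrt (real N) < real (bsize b)) :: real"
  let ?b2 = "\<lambda>N L. of_bool (oscillates k N (d * sqrt (real N)) L) :: real"
  have m1: "\<forall>\<^sub>F N in sequentially. avg N (?b1 N) < e / 16"
    using order_tendstoD(2)[OF avg_large_scaled[OF d(1)], of "e / 16"] e by simp
  have m2: "\<forall>\<^sub>F N in sequentially. dist (avg N (\<lambda>L. g (coarse k N L))) (?G k) < e / 8"
    by (rule tendstoD[OF coarse_limit[OF k(1) g]]) (use e in auto)
  have m3: "\<forall>\<^sub>F N in sequentially. 1 \<le> d * sqrt (real N)" using d(1) by real_asymp
  have "\<forall>\<^sub>F N in sequentially. norm (measure_pmf.expectation (random_dcc N) (\<lambda>P. g (perimeter_process N P)) - ?I) < e"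
    using m1 m2 m3 eventually_ge_at_top[of "44 * 44 * k"]
  proof eventually_elim
    case (elim N)
    have N: "0 < N" using elim(4) k(1) by simp
    have sc: "0 < path_scale N" using N sigma4_pos by (simp add: path_scale_def)
    have pt: "\<bar>g (perimeter_process N (polyomino_of L)) - g (coarse k N L)\<bar> \<le> e / 8 + 2 * ?b1 N L + 2 * ?b2 N L" if L: "L \<in> words N" for L
    proof (cases "(\<exists>b\<in>set L. d * sqrt (real N) < real (bsize b)) \<or> oscillates k N (d * sqrt (real N)) L")
      case True
      have "\<bar>g (perimeter_process N (polyomino_of L)) - g (coarse k N L)\<bar> \<le> 2"
        using g(2)[OF perimeter_process_D01, of N "polyomino_of L"] g(2)[OF stepf_D01, of k "\<lambda>j. walk 0 L (gridpt k N j) / path_scale N"]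
        unfolding coarse_def[symmetric] by linarith
      then show ?thesis using True e by auto
    next
      case False
      then have small: "\<And>b. b \<in> set L \<Longrightarrow> real (bsize b) \<le> d * sqrt (real N)" and osc: "\<not> oscillates k N (d * sqrt (real N)) L"
        by (auto simp: not_less)
      have "\<bar>g (perimeter_process N (polyomino_of L)) - g (coarse k N L)\<bar> \<le> skorokhod_dist (perimeter_process N (polyomino_of L)) (coarse k N L)"
        by (rule g(1)) (simp_all add: perimeter_process_D01 coarse_def stepf_D01)
      also have "\<dots> \<le> (50 * (d * sqrt (real N)) + 2 + d * sqrt (real N)) / path_scale N"
        by (rule process_close_coarse[OF L N k(1) elim(3) small osc]) (use d(1) N in simp_all)
      also have "\<dots> \<le> (53 * (d * sqrt (real N))) / path_scale N"
        using elim(3) sc by (intro divide_right_mono) auto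
      also have "\<dots> = 53 * d / sigma4" using N by (simp add: path_scale_def)
      finally show ?thesis using d(2) by simp
    qed
    have "\<bar>avg N (\<lambda>L. g (perimeter_process N (polyomino_of L))) - avg N (\<lambda>L. g (coarse k N L))\<bar> \<le> avg N (\<lambda>L. e / 8 + 2 * ?b1 N L + 2 * ?b2 N L)"
      unfolding avg_diff[symmetric] real_norm_def[symmetric]
      by (rule order_trans[OF avg_norm avg_mono]) (use pt in simp)
    also have "\<dots> = e / 8 + 2 * avg N (?b1 N) + 2 * avg N (?b2 N)" by (simp add: avg_add avg_mult avg_const)
    also have "\<dots> \<le> e / 8 + 2 * (e / 16) + 2 * (e / 16)"
      using elim(1) C(2)[OF k(1) elim(4), of d] k(2) by (intro add_mono mult_left_mono) auto
    finally show ?case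
      using elim(2) k(3) e unfolding expectation_random_dcc[OF N] dist_real_def real_norm_def by linarith
  qed
  then show "\<exists>n0. \<forall>n\<ge>n0. norm (measure_pmf.expectation (random_dcc n) (\<lambda>P. g (perimeter_process n P)) - ?I) < e"
    by (simp add: eventually_sequentially)
qed

text \<open>The walk at the final time satisfies the central limit theorem, and its
distance from the centred perimeter is at most a multiple of the largest block, which is
negligible on the scale \<open>sqrt n\<close>.\<close>

lemma perimeter_CLT:
  "weak_conv_m (\<lambda>n. distr (measure_pmf (random_dcc n)) borel (\<lambda>P. (of_int (Rbar P n) - real n * mu4) / (sqrt (real n) * sigma4))) std_normal_distribution"
proof (rule levy_continuity[OF _ real_dist_normal_dist])
  let ?\<mu> = "\<lambda>n. distr (measure_pmf (random_dcc n)) borel (\<lambda>P. (of_int (Rbar P n) - real n * mu4) / (sqrt (real n) * sigma4))"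
  show "real_distribution (?\<mu> n)" for n
    by (rule prob_space.real_distribution_distr) (auto simp: measure_pmf.prob_space_axioms)
  fix t :: real
  have path: "(\<lambda>n. char (scaled_path_law n n 0 n) t) \<longlonglongrightarrow> char (gauss 1) t"
  proof (rule levy_continuity1[OF real_distribution_path_law real_distribution_gauss])
    have "(\<lambda>k. real k / real k) \<longlonglongrightarrow> 1"
      by (rule tendsto_eventually) (use eventually_gt_at_top[of "0::nat"] in \<open>auto elim: eventually_mono\<close>)
    then show "weak_conv_m (\<lambda>n. scaled_path_law n n 0 n) (gauss 1)"
      by (intro path_law_weak_conv[where N = "\<lambda>k. k" and n = "\<lambda>k. k" and s = "\<lambda>k. k" and u = "\<lambda>_. 0"] filterlim_ident) auto
  qed
  have diff: "(\<lambda>n. char (?\<mu> n) t - char (scaled_path_law n n 0 n) t) \<longlonglongrightarrow> 0"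
  proof (rule LIMSEQ_I)
    fix e :: real assume e: "0 < e"
    define w where "w = 1 + \<bar>t\<bar>"
    have w: "0 < w" "\<bar>t\<bar> \<le> w" by (auto simp: w_def)
    define d where "d = e * sigma4 / (200 * w)"
    have d: "0 < d" using e sigma4_pos w by (simp add: d_def)
    have dt: "\<bar>t\<bar> * (50 * d / sigma4) \<le> e / 4"
    proof -
      have "\<bar>t\<bar> * (50 * d / sigma4) = e / 4 * (\<bar>t\<bar> / w)"
        using sigma4_pos w by (simp add: d_def)
      also have "\<dots> \<le> e / 4 * 1" using e w by (intro mult_left_mono) (auto simp: divide_le_eq)
      finally show ?thesis by simp
    qed
    let ?b1 = "\<lambda>N L. of_bool (\<exists>b\<in>set L. d * sqrt (real N) < real (bsize b)) :: real"
    have m1: "\<forall>\<^sub>F N in sequentially. avg N (?b1 N) < e / 4"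
      using order_tendstoD(2)[OF avg_large_scaled[OF d], of "e / 4"] e by simp
    have m3: "\<forall>\<^sub>F N in sequentially. 1 \<le> d * sqrt (real N)" using d by real_asymp
    have "\<forall>\<^sub>F n in sequentially. norm (char (?\<mu> n) t - char (scaled_path_law n n 0 n) t - 0) < e"
      using m1 m3 eventually_gt_at_top[of 0]
    proof eventually_elim
      case (elim n)
      note n = elim(3)
      let ?Z = "\<lambda>L. (of_int (Rbar (polyomino_of L) n) - real n * mu4) / (sqrt (real n) * sigma4)"
      let ?Y = "\<lambda>L. walk 0 L n / (sigma4 * sqrt (real n))"
      have c1: "char (?\<mu> n) t = avg n (\<lambda>L. iexp (t * ?Z L))"
        unfolding char_def by (subst integral_distr) (auto simp: expectation_random_dcc[OF n])
      have c2: "char (scaled_path_law n n 0 n) t = avg n (\<lambda>L. iexp (t * ?Y L))"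
        unfolding char_def by (subst integral_path_law) auto
      have sc: "0 < sigma4 * sqrt (real n)" using n sigma4_pos by simp
      have pt: "cmod (iexp (t * ?Z L) - iexp (t * ?Y L)) \<le> e / 4 + 2 * ?b1 n L" if L: "L \<in> words n" for L
      proof (cases "\<exists>b\<in>set L. d * sqrt (real n) < real (bsize b)")
        case True
        have "cmod (iexp (t * ?Z L) - iexp (t * ?Y L)) \<le> cmod (iexp (t * ?Z L)) + cmod (iexp (t * ?Y L))" by (rule norm_triangle_ineq4)
        also have "\<dots> = 2" by (simp only: norm_exp_i_times)
        finally show ?thesis using True e by simp
      next
        case False
        then have small: "\<And>b. b \<in> set L \<Longrightarrow> real (bsize b) \<le> d * sqrt (real n)" by (auto simp: not_less)
        have "?Z L - ?Y L = (of_int (Rbar (polyomino_of L) n) - mu4 * real n - walk 0 L n) / (sigma4 * sqrt (real n))"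
          by (simp add: diff_divide_distrib mult.commute)
        then have "\<bar>?Z L - ?Y L\<bar> = \<bar>of_int (Rbar (polyomino_of L) n) - mu4 * real n - walk 0 L n\<bar> / (sigma4 * sqrt (real n))"
          using sc by simp
        also have "\<dots> \<le> (50 * (d * sqrt (real n))) / (sigma4 * sqrt (real n))"
          by (intro divide_right_mono Rbar_close_walk[OF L n elim(2) small]) (use sc in auto)
        also have "\<dots> = 50 * d / sigma4" using n by simp
        finally have zy: "\<bar>?Z L - ?Y L\<bar> \<le> 50 * d / sigma4" .
        have "iexp (t * ?Z L) - iexp (t * ?Y L) = iexp (t * ?Y L) * (iexp (t * ?Z L - t * ?Y L) - 1)"
          by (simp add: right_diff_distrib exp_add[symmetric] del: of_real_divide)
        then have "cmod (iexp (t * ?Z L) - iexp (t * ?Y L)) = cmod (iexp (t * ?Z L - t * ?Y L) - 1)"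
          by (simp only: norm_mult norm_exp_i_times mult_1)
        also have "\<dots> \<le> \<bar>t * ?Z L - t * ?Y L\<bar>" by (rule norm_iexp_Taylor0)
        also have "\<dots> = \<bar>t\<bar> * \<bar>?Z L - ?Y L\<bar>" by (simp only: right_diff_distrib[symmetric] abs_mult)
        also have "\<dots> \<le> \<bar>t\<bar> * (50 * d / sigma4)" using zy by (intro mult_left_mono) auto
        finally show ?thesis using dt False by simp
      qed
      have "norm (avg n (\<lambda>L. iexp (t * ?Z L) - iexp (t * ?Y L))) \<le> avg n (\<lambda>L. e / 4 + 2 * ?b1 n L)"
        by (rule order_trans[OF avg_norm avg_mono]) (use pt in simp)
      also have "\<dots> = e / 4 + 2 * avg n (?b1 n)" by (simp add: avg_add avg_mult avg_const)
      also have "\<dots> < e" using elim(1) e by linarith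
      finally show ?case unfolding c1 c2 by (simp only: avg_diff diff_zero)
    qed
    then show "\<exists>n0. \<forall>n\<ge>n0. norm (char (?\<mu> n) t - char (scaled_path_law n n 0 n) t - 0) < e"
      by (simp add: eventually_sequentially)
  qed
  show "(\<lambda>n. char (?\<mu> n) t) \<longlonglongrightarrow> char std_normal_distribution t"
    using tendsto_add[OF diff path] by (simp add: gauss_1)
qed

theorem theorem2p6:
  fixes M :: "'b measure" and B4 :: "real \<Rightarrow> 'b \<Rightarrow> real"
  shows
    "mu4 = mu1 * (mu3 + 2) \<and> mu4 = 6 / 5 + 6 * sqrt 5 / 25 \<and>
     sigma4\<^sup>2 = gamma * mu1 + sigma1_sq * beta\<^sup>2 \<and> sigma4\<^sup>2 = 17 * sqrt 5 / 50 - 19 / 125 \<and>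
     (standard_brownian_motion M B4 \<longrightarrow>
        converges_in_distribution skorokhod_topology
          (\<lambda>n. measure_pmf (random_dcc n)) perimeter_process
          M (\<lambda>\<omega>. \<lambda>t\<in>{0..1}. B4 t \<omega>)) \<and>
     weak_conv_m
       (\<lambda>n. distr (measure_pmf (random_dcc n)) borel
          (\<lambda>P. (of_int (Rbar P n) - real n * mu4) / (sqrt (real n) * sigma4)))
       std_normal_distribution"
proof (intro conjI impI)
  show "mu4 = mu1 * (mu3 + 2)" by (rule mu4_eq)
  show "mu4 = 6 / 5 + 6 * sqrt 5 / 25" using mu4_eq(1) by simp
  show "sigma4\<^sup>2 = gamma * mu1 + sigma1_sq * beta\<^sup>2" "sigma4\<^sup>2 = 17 * sqrt 5 / 50 - 19 / 125"
    by (rule sigma4_square)+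
  show "weak_conv_m (\<lambda>n. distr (measure_pmf (random_dcc n)) borel
          (\<lambda>P. (of_int (Rbar P n) - real n * mu4) / (sqrt (real n) * sigma4))) std_normal_distribution"
    by (rule perimeter_CLT)
next
  assume B: "standard_brownian_motion M B4"
  interpret prob_space M using B by (simp add: standard_brownian_motion_def)
  have scale: "\<exists>c>0. (\<forall>x\<in>D01. \<forall>y\<in>D01. \<bar>g x / c - g y / c\<bar> \<le> skorokhod_dist x y) \<and> (\<forall>x\<in>D01. \<bar>g x / c\<bar> \<le> 1)" if "BL_D01 g" for g
  proof -
    from that[unfolded BL_D01_def, THEN conjunct1] obtain A where A: "\<forall>x\<in>D01. \<bar>g x\<bar> \<le> A" ..
    from that[unfolded BL_D01_def, THEN conjunct2] obtain K where "0 \<le> K \<and> (\<forall>x\<in>D01. \<forall>y\<in>D01. \<bar>g x - g y\<bar> \<le> K * skorokhod_dist x y)" ..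
    then have K: "\<forall>x\<in>D01. \<forall>y\<in>D01. \<bar>g x - g y\<bar> \<le> K * skorokhod_dist x y" ..
    have AK: "\<bar>g x\<bar> \<le> A" "\<bar>g x - g y\<bar> \<le> K * skorokhod_dist x y" if "x \<in> D01" "y \<in> D01" for x y
      using A K that by auto
    define c where "c = max 1 (max A K)"
    have c: "0 < c" "A \<le> c" "K \<le> c" by (auto simp: c_def)
    have "\<bar>g x / c - g y / c\<bar> \<le> skorokhod_dist x y" if xy: "x \<in> D01" "y \<in> D01" for x y
    proof -
      have "\<bar>g x - g y\<bar> \<le> c * skorokhod_dist x y"
        using AK(2)[OF xy] mult_right_mono[OF c(3) skorokhod_dist_nonneg[of x y]] by linarith
      then have "\<bar>g x - g y\<bar> / c \<le> skorokhod_dist x y" using c(1) by (simp add: divide_le_eq mult.commute)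
      then show ?thesis using c(1) by (simp add: diff_divide_distrib[symmetric])
    qed
    moreover have "\<bar>g x / c\<bar> \<le> 1" if "x \<in> D01" for x using AK(1)[OF that that] c by (simp add: divide_le_eq)
    ultimately show ?thesis using c(1) by blast
  qed
  have "converges_in_distribution skorokhod_topology (\<lambda>n. measure_pmf (random_dcc n)) perimeter_process M (path_of B4)"
  proof (rule converges_in_distribution_Lipschitz[OF prob_space_axioms perimeter_process_D01])
    show "path_of B4 \<omega> \<in> D01" if "\<omega> \<in> space M" for \<omega>
      by (rule path_of_D01) (use B that in \<open>simp add: standard_brownian_motion_def\<close>)
    fix g assume "BL_D01 g"
    then obtain c where c: "0 < c" and g: "\<And>x y. x \<in> D01 \<Longrightarrow> y \<in> D01 \<Longrightarrow> \<bar>g x / c - g y / c\<bar> \<le> skorokhod_dist x y" "\<And>x. x \<in> D01 \<Longrightarrow> \<bar>g x / c\<bar> \<le> 1"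
      using scale by blast
    have "(\<lambda>\<omega>. c * (g (path_of B4 \<omega>) / c)) \<in> borel_measurable M"
      using Brownian_Lipschitz(1)[OF B, of "\<lambda>x. g x / c", OF g] by (rule borel_measurable_times[OF borel_measurable_const])
    then show "(\<lambda>\<omega>. g (path_of B4 \<omega>)) \<in> borel_measurable M" using c by simp
    have "(\<lambda>n. c * measure_pmf.expectation (random_dcc n) (\<lambda>P. g (perimeter_process n P) / c)) \<longlonglongrightarrow> c * (\<integral>\<omega>. g (path_of B4 \<omega>) / c \<partial>M)"
      by (intro tendsto_mult tendsto_const process_limit[OF B, of "\<lambda>x. g x / c", OF g])
    then show "(\<lambda>n. measure_pmf.expectation (random_dcc n) (\<lambda>P. g (perimeter_process n P))) \<longlonglongrightarrow> (\<integral>\<omega>. g (path_of B4 \<omega>) \<partial>M)"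
      using c by simp
  qed
  then show "converges_in_distribution skorokhod_topology (\<lambda>n. measure_pmf (random_dcc n)) perimeter_process M (\<lambda>\<omega>. \<lambda>t\<in>{0..1}. B4 t \<omega>)"
    by (simp add: path_of_def[abs_def])
qed

end
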